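(* There do not exist integers $d\geq 1$, $k\geq 1$ with $2k+d=12$ and a nearly free conic-line arrangement $\mathcal{C}\subset\mathbb{P}^{2}_{\mathbb{C}}$ consisting of $d$ lines and $k$ smooth conics (so of degree $m=12$) all of whose singular points are nodes, tacnodes, or ordinary triple points.
   Context: A conic-line arrangement $\mathcal{C}\subset\mathbb{P}^2_{\mathbb{C}}$ with $d$ lines and $k$ smooth conics is the reduced plane curve that is the union of $d$ pairwise distinct lines and $k$ pairwise distinct smooth conics; its degree is $m=2k+d$ and its defining equation is $f=0$, where $f\in S:=\mathbb{C}[x,y,z]$ is the product of the defining forms of all components. A node is an $A_1$ singularity (two smooth branches meeting transversally), a tacnode is an $A_3$ singularity (two smooth branches meeting with intersection multiplicity $2$), and an ordinary triple point is a $D_4$ singularity (three smooth branches with pairwise distinct tangents). It is not required that all three types occur. For a reduced plane curve $C: f=0$ with $f\in S$ homogeneous of degree $m$, let $J_f=\langle \partial_x f,\partial_y f,\partial_z f\rangle$ be the Jacobian ideal, let $I_f$ be the saturation of $J_f$ with respect to $\mathfrak{m}=\langle x,y,z\rangle$, and let $N(f)=I_f/J_f$, a graded $S$-module. The curve $C$ is nearly free if $N(f)\neq 0$ and $\dim_{\mathbb{C}} N(f)_j\leq 1$ for every integer $j$. *)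

theory Defs
  imports "HOL-Analysis.Analysis" "HOL-Library.Poly_Mapping"
    "HOL-Computational_Algebra.Formal_Power_Series"
begin

text \<open>Monomials in three variables are exponent vectors \<open>3 \<Rightarrow>\<^sub>0 nat\<close>; the variables
  \<open>x, y, z\<close> correspond to the three elements of the index type \<open>3\<close>.\<close>

type_synonym cpoly3 = "(3 \<Rightarrow>\<^sub>0 nat) \<Rightarrow>\<^sub>0 complex"

definition total_deg :: "(3 \<Rightarrow>\<^sub>0 nat) \<Rightarrow> nat" where
  "total_deg m = (\<Sum>i\<in>UNIV. Poly_Mapping.lookup m i)"

definition homogeneous :: "nat \<Rightarrow> cpoly3 \<Rightarrow> bool" where
  "homogeneous j f \<longleftrightarrow> (\<forall>m\<in>Poly_Mapping.keys f. total_deg m = j)"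

text \<open>Substitution of \<open>w i\<close> for the variable \<open>i\<close>, in a \<open>\<complex>\<close>-algebra with structure map \<open>\<phi>\<close>.\<close>

definition subst3 :: "(complex \<Rightarrow> 'r::comm_ring_1) \<Rightarrow> (3 \<Rightarrow> 'r) \<Rightarrow> cpoly3 \<Rightarrow> 'r" where
  "subst3 \<phi> w f = (\<Sum>m\<in>Poly_Mapping.keys f.
     \<phi> (Poly_Mapping.lookup f m) * (\<Prod>i\<in>UNIV. w i ^ Poly_Mapping.lookup m i))"

definition eval3 :: "cpoly3 \<Rightarrow> complex^3 \<Rightarrow> complex" where
  "eval3 f p = subst3 (\<lambda>c. c) (vec_nth p) f"

text \<open>The truncated subtraction is harmless: if variable \<open>i\<close> does not occur in \<open>m\<close>, the
  coefficient is zero.\<close>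

definition partial :: "3 \<Rightarrow> cpoly3 \<Rightarrow> cpoly3" where
  "partial i f = (\<Sum>m\<in>Poly_Mapping.keys f.
     Poly_Mapping.single (m - Poly_Mapping.single i 1)
       (of_nat (Poly_Mapping.lookup m i) * Poly_Mapping.lookup f m))"

text \<open>Points of the projective plane are given by homogeneous coordinate vectors
  \<open>p \<noteq> 0\<close>; a plane curve, as a set of points, is represented by its punctured affine cone.\<close>

definition zero_locus :: "cpoly3 \<Rightarrow> (complex^3) set" where
  "zero_locus f = {p. p \<noteq> 0 \<and> eval3 f p = 0}"

definition singular_point :: "cpoly3 \<Rightarrow> complex^3 \<Rightarrow> bool" where
  "singular_point f p \<longleftrightarrow> p \<in> zero_locus f \<and> (\<forall>i. eval3 (partial i f) p = 0)"

definition line_form :: "cpoly3 \<Rightarrow> bool" where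
  "line_form l \<longleftrightarrow> homogeneous 1 l \<and> l \<noteq> 0"

definition smooth_conic_form :: "cpoly3 \<Rightarrow> bool" where
  "smooth_conic_form q \<longleftrightarrow> homogeneous 2 q \<and> q \<noteq> 0 \<and> (\<forall>p. \<not> singular_point q p)"

text \<open>One defining form is chosen for each component; injectivity of \<^const>\<open>zero_locus\<close>
  says that different forms define different curves, i.e. that no two of them are proportional.\<close>

definition conic_line_arrangement :: "nat \<Rightarrow> nat \<Rightarrow> cpoly3 set \<Rightarrow> cpoly3 set \<Rightarrow> bool" where
  "conic_line_arrangement d k L Q \<longleftrightarrow>
     finite L \<and> card L = d \<and> (\<forall>l\<in>L. line_form l) \<and> inj_on zero_locus L \<and>
     finite Q \<and> card Q = k \<and> (\<forall>q\<in>Q. smooth_conic_form q) \<and> inj_on zero_locus Q"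

definition arrangement_form :: "cpoly3 set \<Rightarrow> cpoly3 set \<Rightarrow> cpoly3" where
  "arrangement_form L Q = (\<Prod>l\<in>L. l) * (\<Prod>q\<in>Q. q)"

text \<open>For subspaces \<open>W \<subseteq> V\<close> of a complex vector space with scalar multiplication \<open>s\<close>:
  the classes of the elements of some \<open>n\<close>-element set \<open>B\<close> form a basis of \<open>V / W\<close>,
  that is, \<open>dim (V / W) = n\<close>.\<close>

definition quotient_has_dim ::
  "(complex \<Rightarrow> 'v::ab_group_add \<Rightarrow> 'v) \<Rightarrow> 'v set \<Rightarrow> 'v set \<Rightarrow> nat \<Rightarrow> bool" where
  "quotient_has_dim s V W n \<longleftrightarrow> (\<exists>B. finite B \<and> card B = n \<and> B \<subseteq> V \<and>
     (\<forall>v\<in>V. \<exists>c. v - (\<Sum>b\<in>B. s (c b) b) \<in> W) \<and>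
     (\<forall>c. (\<Sum>b\<in>B. s (c b) b) \<in> W \<longrightarrow> (\<forall>b\<in>B. c b = 0)))"

definition scale_poly :: "complex \<Rightarrow> cpoly3 \<Rightarrow> cpoly3" where
  "scale_poly c f = Poly_Mapping.single 0 c * f"

definition jacobian_ideal :: "cpoly3 \<Rightarrow> cpoly3 set" where
  "jacobian_ideal f = {g. \<exists>a. g = (\<Sum>i\<in>UNIV. a i * partial i f)}"

text \<open>The saturation \<open>J : \<mm>\<^sup>\<infinity>\<close> with respect to \<open>\<mm> = \<langle>x, y, z\<rangle>\<close>; recall that \<open>\<mm>\<^sup>N\<close>
  is generated by the forms of degree \<open>N\<close>.\<close>

definition saturation :: "cpoly3 set \<Rightarrow> cpoly3 set" where
  "saturation J = {g. \<exists>N. \<forall>h. homogeneous N h \<longrightarrow> h * g \<in> J}"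

definition graded_piece :: "nat \<Rightarrow> cpoly3 set \<Rightarrow> cpoly3 set" where
  "graded_piece j I = {g\<in>I. homogeneous j g}"

text \<open>\<open>N(f) = I\<^sub>f / J\<^sub>f\<close> vanishes in negative degrees, so it suffices to let the degree \<open>j\<close>
  range over the natural numbers.\<close>

definition nearly_free :: "cpoly3 \<Rightarrow> bool" where
  "nearly_free f \<longleftrightarrow>
     saturation (jacobian_ideal f) \<noteq> jacobian_ideal f \<and>
     (\<forall>j. \<exists>n\<le>1. quotient_has_dim scale_poly
        (graded_piece j (saturation (jacobian_ideal f)))
        (graded_piece j (jacobian_ideal f)) n)"

text \<open>Germs of plane curves are given by power series in \<open>\<complex>[[u, v]]\<close>, realised as
  \<open>\<complex>[[u]][[v]]\<close>: the coefficient of \<open>u\<^sup>a v\<^sup>b\<close> in \<open>g\<close> is \<open>fps_nth (fps_nth g b) a\<close>.\<close>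

type_synonym germ = "complex fps fps"

definition germ_const :: "complex \<Rightarrow> germ" where
  "germ_const c = fps_const (fps_const c)"

definition germ_coeff :: "germ \<Rightarrow> nat \<Rightarrow> nat \<Rightarrow> complex" where
  "germ_coeff g a b = fps_nth (fps_nth g b) a"

text \<open>For a basis \<open>p, q, r\<close> of \<open>\<complex>\<^sup>3\<close>, \<open>(u, v) \<mapsto> [p + u q + v r]\<close> is an affine
  chart of the projective plane centred at \<open>[p]\<close>; \<open>f (p + u q + v r)\<close> is the local equation of
  the curve \<open>f = 0\<close> in this chart.\<close>

definition local_equation :: "cpoly3 \<Rightarrow> complex^3 \<Rightarrow> germ \<Rightarrow> bool" where
  "local_equation f p h \<longleftrightarrow> (\<exists>q r. det (vector [p, q, r] :: complex^3^3) \<noteq> 0 \<and>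
     h = subst3 germ_const
       (\<lambda>i. germ_const (vec_nth p i) + germ_const (vec_nth q i) * fps_const fps_X
          + germ_const (vec_nth r i) * fps_X) f)"

definition smooth_branch :: "germ \<Rightarrow> bool" where
  "smooth_branch g \<longleftrightarrow> germ_coeff g 0 0 = 0 \<and> (germ_coeff g 1 0 \<noteq> 0 \<or> germ_coeff g 0 1 \<noteq> 0)"

text \<open>Linear independence of the linear parts, i.e. distinct tangent lines.\<close>

definition transversal :: "germ \<Rightarrow> germ \<Rightarrow> bool" where
  "transversal g h \<longleftrightarrow>
     germ_coeff g 1 0 * germ_coeff h 0 1 - germ_coeff g 0 1 * germ_coeff h 1 0 \<noteq> 0"

text \<open>Intersection multiplicity \<open>dim (\<complex>[[u, v]] / (g, h)) = n\<close>.\<close>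

definition intersection_mult :: "germ \<Rightarrow> germ \<Rightarrow> nat \<Rightarrow> bool" where
  "intersection_mult g h n \<longleftrightarrow>
     quotient_has_dim (\<lambda>c w. germ_const c * w) UNIV {w. \<exists>a b. w = a * g + b * h} n"

text \<open>The equation of a branch matters only up to a unit of \<open>\<complex>[[u, v]]\<close>, so in the three
  definitions below no unit factor is needed.\<close>

definition node :: "cpoly3 \<Rightarrow> complex^3 \<Rightarrow> bool" where
  "node f p \<longleftrightarrow> (\<exists>g\<^sub>1 g\<^sub>2. local_equation f p (g\<^sub>1 * g\<^sub>2) \<and>
     smooth_branch g\<^sub>1 \<and> smooth_branch g\<^sub>2 \<and> transversal g\<^sub>1 g\<^sub>2)"

definition tacnode :: "cpoly3 \<Rightarrow> complex^3 \<Rightarrow> bool" where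
  "tacnode f p \<longleftrightarrow> (\<exists>g\<^sub>1 g\<^sub>2. local_equation f p (g\<^sub>1 * g\<^sub>2) \<and>
     smooth_branch g\<^sub>1 \<and> smooth_branch g\<^sub>2 \<and> intersection_mult g\<^sub>1 g\<^sub>2 2)"

definition ordinary_triple_point :: "cpoly3 \<Rightarrow> complex^3 \<Rightarrow> bool" where
  "ordinary_triple_point f p \<longleftrightarrow> (\<exists>g\<^sub>1 g\<^sub>2 g\<^sub>3. local_equation f p (g\<^sub>1 * g\<^sub>2 * g\<^sub>3) \<and>
     smooth_branch g\<^sub>1 \<and> smooth_branch g\<^sub>2 \<and> smooth_branch g\<^sub>3 \<and>
     transversal g\<^sub>1 g\<^sub>2 \<and> transversal g\<^sub>1 g\<^sub>3 \<and> transversal g\<^sub>2 g\<^sub>3)"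

end

theory Submission
  imports Defs "HOL-Computational_Algebra.Fundamental_Theorem_Algebra"
begin

text \<open>
  The proof compares two estimates of \<open>n + 3 t + 4 m\<close>, where \<open>n\<close>, \<open>t\<close> and \<open>m\<close> are the numbers of
  nodes, tacnodes and ordinary triple points. This is the total Tjurina number of the curve.

  Lower bound. Let \<open>J\<close> be the Jacobian ideal and \<open>I\<close> its saturation. The forms of degree \<open>15\<close> make up
  a space of dimension \<open>136\<close>. In this degree \<open>J\<close> is spanned by the products of the \<open>3\<close> partial
  derivatives, of degree \<open>11\<close>, with the \<open>15\<close> monomials of degree \<open>4\<close>; its dimension is at most \<open>45\<close>,
  and the dimension of \<open>I\<close> is at most \<open>46\<close> if the curve is nearly free
  (\<open>nearly_free_functional_bound\<close>; the choice of \<open>15\<close> makes the estimate as good as possible). On the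
  other hand, by the Nullstellensatz a form belongs to \<open>I\<close> as soon as it belongs to \<open>J\<close> locally at
  every singular point (\<open>in_saturation_if_locally\<close>). The latter amounts to \<open>1\<close>, \<open>3\<close> or \<open>4\<close> linear
  conditions at a node, a tacnode or an ordinary triple point (the lemmas \<open>local_conditions_\<dots>\<close>,
  and \<open>singular_point_cases\<close> for the passage from germs to components). Therefore
  \<open>n + 3 t + 4 m \<ge> 136 - 46 = 90\<close>.

  Upper bound. By Bezout a line carries at most \<open>11\<close> intersections with the other components, and a
  conic at most \<open>20\<close>, where a node counts once and a tacnode or a triple point counts twice. As \<open>11\<close>
  is odd, at most five points of a line are not nodes. If the weights \<open>1\<close>, \<open>3\<close>, \<open>4\<close> of the singular
  points are shared out equally among the components through them, the result is
  \<open>6 (n + 3 t + 4 m) \<le> 43 d + 80 k + 2 t\<close> (\<open>tjurina_bound\<close>). Since \<open>d = 12 - 2 k\<close>, the two estimates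
  together require \<open>t \<ge> 12 + 3 k\<close>: many tacnodes are needed.

  There are not so many. If two conics touch in \<open>s\<close> points and have \<open>c\<close> common tangents among the
  lines, then \<open>c + 2 s \<le> 4\<close>, because the dual conics meet in the \<open>c\<close> tangents and touch in the \<open>s\<close>
  tangents at the common points (\<open>common_tangents\<close>). Summing over all pairs of conics yields
  \<open>t \<le> k (k - 1) + 3 d / 2 = k\<^sup>2 - 4 k + 18\<close> (\<open>two_tacs_le\<close>). Hence \<open>(k - 1) (k - 6) \<ge> 0\<close>, and as
  \<open>k \<le> 5\<close>, there is only one conic. It contains every tacnode, so that \<open>t \<le> 10 < 15\<close>.
\<close>

section \<open>Polynomials in three variables\<close>

abbreviation cst :: "complex \<Rightarrow> cpoly3" where
  "cst c \<equiv> Poly_Mapping.single 0 c"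

definition var :: "3 \<Rightarrow> cpoly3" where
  "var i = Poly_Mapping.single (Poly_Mapping.single i 1) 1"

lemma poly_eq_sum_single:
  "f = (\<Sum>m\<in>Poly_Mapping.keys f. Poly_Mapping.single m (Poly_Mapping.lookup f m))"
  by (rule poly_mapping_eqI)
    (simp add: lookup_sum lookup_single when_def sum.delta in_keys_iff)

lemma cpoly3_induct_single [case_names single add]:
  assumes "\<And>m c. P (Poly_Mapping.single m c)"
    and "\<And>f g. P f \<Longrightarrow> P g \<Longrightarrow> P (f + g)"
  shows "P (f :: cpoly3)"
proof -
  have "P (\<Sum>m\<in>A. Poly_Mapping.single m (Poly_Mapping.lookup f m))" if "finite A" for A
    using that
  proof induction
    case empty
    show ?case using assms(1)[of 0 0] by simp
  qed (use assms in simp)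
  then show ?thesis using poly_eq_sum_single[of f] by (metis finite_keys)
qed

lemma total_deg_add [simp]: "total_deg (m + n) = total_deg m + total_deg n"
  by (simp add: total_deg_def lookup_add sum.distrib)

lemma total_deg_zero [simp]: "total_deg 0 = 0"
  by (simp add: total_deg_def)

lemma total_deg_single [simp]: "total_deg (Poly_Mapping.single i k) = k"
  by (simp add: total_deg_def lookup_single when_def)

lemma total_deg_eq_0_iff: "total_deg m = 0 \<longleftrightarrow> m = 0"
  by (auto simp: total_deg_def intro: poly_mapping_eqI)

lemma single_eq_prod_var:
  "Poly_Mapping.single m c = cst c * (\<Prod>i\<in>UNIV. var i ^ Poly_Mapping.lookup m i)"
proof -
  have pw: "var i ^ k = Poly_Mapping.single (Poly_Mapping.single i k) 1" for i k
    by (induction k) (simp_all add: var_def mult_single flip: single_add)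
  have *: "(\<Prod>i\<in>A. Poly_Mapping.single (n i) (1::complex))
      = Poly_Mapping.single (\<Sum>i\<in>A. n i) 1" if "finite A"
    for A :: "3 set" and n :: "3 \<Rightarrow> 3 \<Rightarrow>\<^sub>0 nat"
    using that by induction (simp_all add: mult_single)
  have "(\<Sum>i\<in>UNIV. Poly_Mapping.single i (Poly_Mapping.lookup m i)) = m"
    by (rule poly_mapping_eqI) (simp add: lookup_sum lookup_single when_def)
  then show ?thesis unfolding pw using * by (simp add: mult_single)
qed

lemma cpoly3_induct [case_names cst var add mult]:
  assumes c: "\<And>c. P (cst c)" and v: "\<And>i. P (var i)"
    and a: "\<And>f g. P f \<Longrightarrow> P g \<Longrightarrow> P (f + g)"
    and m: "\<And>f g. P f \<Longrightarrow> P g \<Longrightarrow> P (f * g)"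
  shows "P f"
proof (induction f rule: cpoly3_induct_single)
  case (single n b)
  have pw: "P (g ^ k)" if "P g" for g k
    by (induction k) (use that m c[of 1] in simp_all)
  have "P (\<Prod>i\<in>A. var i ^ Poly_Mapping.lookup n i)" if "finite A" for A
    using that by induction (use m pw v c[of 1] in simp_all)
  then show ?case by (subst single_eq_prod_var) (rule m[OF c], simp)
qed (rule a)

subsection \<open>Substitution\<close>

lemma subst3_superset:
  assumes "finite A" "Poly_Mapping.keys f \<subseteq> A" "\<phi> 0 = 0"
  shows "subst3 \<phi> w f = (\<Sum>m\<in>A. \<phi> (Poly_Mapping.lookup f m) *
    (\<Prod>i\<in>UNIV. w i ^ Poly_Mapping.lookup m i))"
  unfolding subst3_def
  by (rule sum.mono_neutral_left) (use assms in \<open>auto simp: in_keys_iff\<close>)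

text \<open>The structure map \<open>\<phi>\<close> of a \<open>\<complex>\<close>-algebra. The algebras that occur are \<open>\<complex>\<close> itself, the polynomial
  ring, and the power series in one and in two variables.\<close>

locale complex_algebra =
  fixes \<phi> :: "complex \<Rightarrow> 'r::comm_ring_1"
  assumes phi_0: "\<phi> 0 = 0" and phi_1: "\<phi> 1 = 1"
    and phi_add: "\<phi> (a + b) = \<phi> a + \<phi> b" and phi_mult: "\<phi> (a * b) = \<phi> a * \<phi> b"
begin

lemma subst3_add: "subst3 \<phi> w (f + g) = subst3 \<phi> w f + subst3 \<phi> w g"
proof -
  let ?A = "Poly_Mapping.keys f \<union> Poly_Mapping.keys g"
  have fin: "finite ?A" by simp
  show ?thesis
    using subst3_superset[of ?A f \<phi> w] subst3_superset[of ?A g \<phi> w]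
      subst3_superset[of ?A "f + g" \<phi> w] keys_add[of f g]
    by (simp add: phi_0 lookup_add phi_add sum.distrib algebra_simps)
qed

lemma subst3_single:
  "subst3 \<phi> w (Poly_Mapping.single m c) = \<phi> c * (\<Prod>i\<in>UNIV. w i ^ Poly_Mapping.lookup m i)"
  by (subst subst3_superset[of "{m}"]) (auto simp: phi_0)

lemma subst3_cst [simp]: "subst3 \<phi> w (cst c) = \<phi> c"
  by (simp add: subst3_single)

lemma subst3_var [simp]: "subst3 \<phi> w (var i) = w i"
proof -
  have "(\<Prod>j\<in>UNIV. w j ^ Poly_Mapping.lookup (Poly_Mapping.single i (1::nat)) j) =
      (\<Prod>j\<in>UNIV. if j = i then w i else 1)"
    by (rule prod.cong) (auto simp: lookup_single when_def)
  then show ?thesis by (simp add: var_def subst3_single prod.delta phi_1 del: One_nat_def)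
qed

lemma subst3_mult: "subst3 \<phi> w (f * g) = subst3 \<phi> w f * subst3 \<phi> w g"
proof (induction f rule: cpoly3_induct_single)
  case (single m c)
  show ?case
    by (induction g rule: cpoly3_induct_single)
      (simp_all add: mult_single subst3_single phi_mult lookup_add power_add prod.distrib
        distrib_left subst3_add)
qed (simp add: distrib_right subst3_add)

lemma subst3_0 [simp]: "subst3 \<phi> w 0 = 0"
  by (simp add: subst3_def)

lemma subst3_1 [simp]: "subst3 \<phi> w 1 = 1"
  using subst3_cst[of w 1] by (simp add: phi_1)

lemma subst3_uminus: "subst3 \<phi> w (- f) = - subst3 \<phi> w f"
  using subst3_add[of w f "- f"] by (simp add: eq_neg_iff_add_eq_0 add.commute)

lemma subst3_diff: "subst3 \<phi> w (f - g) = subst3 \<phi> w f - subst3 \<phi> w g"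
  using subst3_add[of w f "- g"] subst3_uminus[of w g] by simp

lemma subst3_sum: "subst3 \<phi> w (\<Sum>x\<in>A. h x) = (\<Sum>x\<in>A. subst3 \<phi> w (h x))"
  by (induction A rule: infinite_finite_induct) (simp_all add: subst3_add)

lemma subst3_prod: "subst3 \<phi> w (\<Prod>x\<in>A. h x) = (\<Prod>x\<in>A. subst3 \<phi> w (h x))"
  by (induction A rule: infinite_finite_induct) (simp_all add: subst3_mult)

lemma subst3_power: "subst3 \<phi> w (f ^ n) = subst3 \<phi> w f ^ n"
  by (induction n) (simp_all add: subst3_mult)

end

interpretation ev: complex_algebra "\<lambda>c::complex. c"
  by unfold_locales auto

lemma eval3_simps [simp]:
  "eval3 (f + g) p = eval3 f p + eval3 g p"
  "eval3 (f * g) p = eval3 f p * eval3 g p"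
  "eval3 (f - g) p = eval3 f p - eval3 g p"
  "eval3 (- f) p = - eval3 f p"
  "eval3 0 p = 0" "eval3 1 p = 1" "eval3 (cst c) p = c" "eval3 (var i) p = p $ i"
  "eval3 (f ^ n) p = eval3 f p ^ n"
  unfolding eval3_def
  by (rule ev.subst3_add ev.subst3_mult ev.subst3_diff ev.subst3_uminus ev.subst3_0 ev.subst3_1
      ev.subst3_cst ev.subst3_var ev.subst3_power)+

lemma eval3_sum [simp]: "eval3 (\<Sum>x\<in>A. h x) p = (\<Sum>x\<in>A. eval3 (h x) p)"
  unfolding eval3_def by (rule ev.subst3_sum)

lemma eval3_prod [simp]: "eval3 (\<Prod>x\<in>A. h x) p = (\<Prod>x\<in>A. eval3 (h x) p)"
  unfolding eval3_def by (rule ev.subst3_prod)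

lemma eval3_numeral [simp]: "eval3 (numeral n) p = numeral n"
proof -
  have "eval3 (cst (numeral n)) p = numeral n" by (rule eval3_simps(7))
  then show ?thesis by (simp only: single_numeral)
qed

lemma eval3_of_nat [simp]: "eval3 (of_nat n) p = of_nat n"
  by (induction n) simp_all

subsection \<open>Derivations\<close>

lemma partial_superset:
  assumes "finite A" "Poly_Mapping.keys f \<subseteq> A"
  shows "partial i f = (\<Sum>m\<in>A. Poly_Mapping.single (m - Poly_Mapping.single i 1)
       (of_nat (Poly_Mapping.lookup m i) * Poly_Mapping.lookup f m))"
  unfolding partial_def
  by (rule sum.mono_neutral_left) (use assms in \<open>auto simp: in_keys_iff\<close>)

lemma partial_single: "partial i (Poly_Mapping.single m c) =
    Poly_Mapping.single (m - Poly_Mapping.single i 1) (of_nat (Poly_Mapping.lookup m i) * c)"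
  by (subst partial_superset[of "{m}"]) auto

lemma partial_add: "partial i (f + g) = partial i f + partial i g"
proof -
  let ?A = "Poly_Mapping.keys f \<union> Poly_Mapping.keys g"
  have fin: "finite ?A" by simp
  show ?thesis
    using partial_superset[of ?A f i] partial_superset[of ?A g i]
      partial_superset[of ?A "f + g" i] keys_add[of f g]
    by (simp add: lookup_add sum.distrib algebra_simps single_add)
qed

lemma partial_mult: "partial i (f * g) = partial i f * g + f * partial i g"
proof (induction f rule: cpoly3_induct_single)
  case (single m c)
  show ?case
  proof (induction g rule: cpoly3_induct_single)
    case (single n d)
    let ?e = "Poly_Mapping.single i (1::nat)"
    have 1: "m + n - ?e = m - ?e + n" if "Poly_Mapping.lookup m i \<noteq> 0"
      by (rule poly_mapping_eqI)
        (use that in \<open>auto simp: lookup_add lookup_minus lookup_single when_def\<close>)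
    have 2: "m + n - ?e = m + (n - ?e)" if "Poly_Mapping.lookup n i \<noteq> 0"
      by (rule poly_mapping_eqI)
        (use that in \<open>auto simp: lookup_add lookup_minus lookup_single when_def\<close>)
    have A: "Poly_Mapping.single (m + n - ?e) (of_nat (Poly_Mapping.lookup m i) * (c * d))
        = Poly_Mapping.single (m - ?e + n) (of_nat (Poly_Mapping.lookup m i) * c * d)"
      by (cases "Poly_Mapping.lookup m i = 0") (simp_all add: 1 mult_ac del: One_nat_def)
    have B: "Poly_Mapping.single (m + n - ?e) (of_nat (Poly_Mapping.lookup n i) * (c * d))
        = Poly_Mapping.single (m + (n - ?e)) (c * (of_nat (Poly_Mapping.lookup n i) * d))"
      by (cases "Poly_Mapping.lookup n i = 0") (simp_all add: 2 mult_ac del: One_nat_def)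
    have "partial i (Poly_Mapping.single m c * Poly_Mapping.single n d) =
        Poly_Mapping.single (m + n - ?e) (of_nat (Poly_Mapping.lookup m i) * (c * d)) +
        Poly_Mapping.single (m + n - ?e) (of_nat (Poly_Mapping.lookup n i) * (c * d))"
      by (simp add: mult_single partial_single lookup_add distrib_right single_add)
    also have "\<dots> = partial i (Poly_Mapping.single m c) * Poly_Mapping.single n d +
        Poly_Mapping.single m c * partial i (Poly_Mapping.single n d)"
      unfolding A B by (simp add: mult_single partial_single)
    finally show ?case .
  qed (simp add: distrib_left partial_add)
qed (simp add: distrib_right partial_add algebra_simps)

lemma partial_cst [simp]: "partial i (cst c) = 0"
  by (simp add: partial_single)

lemma partial_var [simp]: "partial i (var j) = (if i = j then 1 else 0)"
  by (simp add: var_def partial_single lookup_single when_def)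

definition dir_deriv :: "complex^3 \<Rightarrow> cpoly3 \<Rightarrow> cpoly3" where
  "dir_deriv w f = (\<Sum>i\<in>UNIV. cst (w $ i) * partial i f)"

lemma dir_deriv_add: "dir_deriv w (f + g) = dir_deriv w f + dir_deriv w g"
  by (simp add: dir_deriv_def partial_add distrib_left sum.distrib)

lemma dir_deriv_mult: "dir_deriv w (f * g) = dir_deriv w f * g + f * dir_deriv w g"
  by (simp add: dir_deriv_def partial_mult distrib_left sum.distrib sum_distrib_left sum_distrib_right
      mult_ac)

lemma dir_deriv_cst [simp]: "dir_deriv w (cst c) = 0"
  by (simp add: dir_deriv_def)

lemma dir_deriv_scale: "dir_deriv w (cst c * f) = cst c * dir_deriv w f"
  by (simp add: dir_deriv_mult)

lemma dir_deriv_0 [simp]: "dir_deriv w 0 = 0"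
  using dir_deriv_cst[of w 0] by simp

lemma dir_deriv_power2: "dir_deriv w (f ^ 2) = 2 * f * dir_deriv w f"
  by (simp add: power2_eq_square dir_deriv_mult algebra_simps)

definition lin :: "complex^3 \<Rightarrow> cpoly3" where
  "lin a = (\<Sum>i\<in>UNIV. cst (a $ i) * var i)"

text \<open>Pairs the coefficients of a line with the coordinates of a point; it is bilinear over
  \<open>\<complex>\<close>, unlike the inner product of the Euclidean space underlying \<open>\<complex>\<^sup>3\<close>.\<close>

definition dot3 :: "complex^3 \<Rightarrow> complex^3 \<Rightarrow> complex" where
  "dot3 x y = (\<Sum>i\<in>UNIV. x $ i * y $ i)"

lemma eval3_lin [simp]: "eval3 (lin a) p = dot3 a p"
  by (simp add: lin_def dot3_def)

lemma dir_deriv_lin [simp]: "dir_deriv w (lin a) = cst (dot3 a w)"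
proof -
  have "partial i (lin a) = cst (a $ i)" for i
    unfolding lin_def sum_3 using exhaust_3[of i]
    by (auto simp: partial_add partial_mult)
  then show ?thesis
    by (simp add: dir_deriv_def dot3_def sum_3 mult_single single_add[symmetric] mult_ac)
qed

lemma dot3_simps [simp]:
  "dot3 (x + y) z = dot3 x z + dot3 y z" "dot3 x (y + z) = dot3 x y + dot3 x z"
  "dot3 (c *s x) z = c * dot3 x z" "dot3 x (c *s z) = c * dot3 x z"
  "dot3 (x - y) z = dot3 x z - dot3 y z" "dot3 x (y - z) = dot3 x y - dot3 x z"
  "dot3 0 x = 0" "dot3 x 0 = 0"
  by (simp_all add: dot3_def sum_3 algebra_simps)

lemma dot3_commute: "dot3 x y = dot3 y x"
  by (simp add: dot3_def mult.commute)

subsection \<open>Homogeneous polynomials\<close>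

lemma homogeneous_add: "homogeneous n f \<Longrightarrow> homogeneous n g \<Longrightarrow> homogeneous n (f + g)"
  using keys_add[of f g] by (auto simp: homogeneous_def)

lemma homogeneous_0 [simp]: "homogeneous n 0"
  by (simp add: homogeneous_def)

lemma homogeneous_single: "total_deg m = n \<Longrightarrow> homogeneous n (Poly_Mapping.single m c)"
  by (simp add: homogeneous_def)

lemma homogeneous_mult:
  "homogeneous m f \<Longrightarrow> homogeneous n g \<Longrightarrow> homogeneous (m + n) (f * g)"
  using keys_mult[of f g] by (force simp: homogeneous_def)

lemma homogeneous_cst [simp]: "homogeneous 0 (cst c)"
  by (simp add: homogeneous_single)

lemma homogeneous_var [simp]: "homogeneous (Suc 0) (var i)"
  by (simp add: var_def homogeneous_single)

lemma homogeneous_scale: "homogeneous n f \<Longrightarrow> homogeneous n (cst c * f)"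
  using homogeneous_mult[of 0 "cst c" n f] by simp

lemma homogeneous_sum: "(\<And>x. x \<in> A \<Longrightarrow> homogeneous n (h x)) \<Longrightarrow> homogeneous n (\<Sum>x\<in>A. h x)"
  by (induction A rule: infinite_finite_induct) (auto intro: homogeneous_add)

lemma homogeneous_prod:
  "finite A \<Longrightarrow> (\<And>x. x \<in> A \<Longrightarrow> homogeneous (d x) (h x)) \<Longrightarrow>
    homogeneous (\<Sum>x\<in>A. d x) (\<Prod>x\<in>A. h x)"
proof (induction A rule: finite_induct)
  case empty
  show ?case using homogeneous_cst[of 1] by simp
qed (auto intro: homogeneous_mult)

lemma homogeneous_lin [simp]: "homogeneous (Suc 0) (lin a)"
  unfolding lin_def by (intro homogeneous_sum homogeneous_scale) simp

lemma homogeneous_sum_single: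
  assumes "homogeneous n f"
  obtains A where "finite A" "\<And>m. m \<in> A \<Longrightarrow> total_deg m = n"
    "f = (\<Sum>m\<in>A. Poly_Mapping.single m (Poly_Mapping.lookup f m))"
  using that[of "Poly_Mapping.keys f"] poly_eq_sum_single[of f] assms
  by (auto simp: homogeneous_def)

lemma homogeneous_induct [consumes 1, case_names zero single add]:
  assumes "homogeneous n f" "P 0"
    and "\<And>m c. total_deg m = n \<Longrightarrow> P (Poly_Mapping.single m c)"
    and "\<And>f g. homogeneous n f \<Longrightarrow> homogeneous n g \<Longrightarrow> P f \<Longrightarrow> P g \<Longrightarrow> P (f + g)"
  shows "P f"
proof -
  obtain A where A: "finite A" "\<And>m. m \<in> A \<Longrightarrow> total_deg m = n"
    "f = (\<Sum>m\<in>A. Poly_Mapping.single m (Poly_Mapping.lookup f m))"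
    using homogeneous_sum_single[OF assms(1)] by metis
  have "P (\<Sum>m\<in>B. Poly_Mapping.single m (Poly_Mapping.lookup f m)) \<and>
      homogeneous n (\<Sum>m\<in>B. Poly_Mapping.single m (Poly_Mapping.lookup f m))"
    if "finite B" "B \<subseteq> A" for B
    using that
  proof induction
    case (insert x F)
    have "homogeneous n (Poly_Mapping.single x (Poly_Mapping.lookup f x))"
      using insert.prems A(2) by (intro homogeneous_single) auto
    with insert assms(3,4) A(2) show ?case by (simp add: homogeneous_add)
  qed (simp add: assms(2))
  from this[OF A(1) order_refl] show ?thesis by (simp flip: A(3))
qed

lemma homogeneous_partial: "homogeneous n f \<Longrightarrow> homogeneous (n - 1) (partial i f)"
proof (induction rule: homogeneous_induct)
  case (single m c)
  show ?case
  proof (cases "Poly_Mapping.lookup m i = 0")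
    case False
    have "m - Poly_Mapping.single i 1 + Poly_Mapping.single i 1 = m"
      by (rule poly_mapping_eqI)
        (use False in \<open>auto simp: lookup_add lookup_minus lookup_single when_def\<close>)
    then have "total_deg (m - Poly_Mapping.single i 1) + 1 = n"
      using single total_deg_add[of "m - Poly_Mapping.single i 1" "Poly_Mapping.single i 1"]
      by simp
    then show ?thesis by (auto simp: partial_single intro: homogeneous_single)
  qed (simp add: partial_single)
qed (auto simp: partial_add intro: homogeneous_add, simp add: partial_def)

lemma euler: "homogeneous n f \<Longrightarrow> (\<Sum>i\<in>UNIV. var i * partial i f) = cst (of_nat n) * f"
proof (induction rule: homogeneous_induct)
  case (single m c)
  have *: "var i * partial i (Poly_Mapping.single m c) =
      Poly_Mapping.single m (of_nat (Poly_Mapping.lookup m i) * c)" for i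
  proof (cases "Poly_Mapping.lookup m i = 0")
    case False
    have "Poly_Mapping.single i 1 + (m - Poly_Mapping.single i 1) = m"
      by (rule poly_mapping_eqI)
        (use False in \<open>auto simp: lookup_add lookup_minus lookup_single when_def\<close>)
    then show ?thesis by (simp add: var_def partial_single mult_single del: One_nat_def)
  qed (simp add: partial_single)
  have "(\<Sum>i\<in>UNIV. Poly_Mapping.single m (of_nat (Poly_Mapping.lookup m i) * c)) =
      Poly_Mapping.single m (of_nat (total_deg m) * c)"
    by (simp add: total_deg_def sum_3 distrib_right flip: single_add)
  then show ?case by (simp add: * single mult_single del: single_of_nat)
next
  case zero
  show ?case by (simp add: partial_def)
qed (simp add: partial_add distrib_left sum.distrib)

lemma eval_euler:
  "homogeneous n f \<Longrightarrow> eval3 (dir_deriv p f) p = of_nat n * eval3 f p"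
  using arg_cong[OF euler[of n f], of "\<lambda>g. eval3 g p"] by (simp add: dir_deriv_def)

lemma homogeneous_0_const:
  assumes "homogeneous 0 f" shows "f = cst (eval3 f p)"
  using assms by (induction rule: homogeneous_induct)
    (auto simp: total_deg_eq_0_iff single_add)

definition hom_part :: "nat \<Rightarrow> cpoly3 \<Rightarrow> cpoly3" where
  "hom_part n f = (\<Sum>m\<in>Poly_Mapping.keys f.
     if total_deg m = n then Poly_Mapping.single m (Poly_Mapping.lookup f m) else 0)"

lemma lookup_hom_part:
  "Poly_Mapping.lookup (hom_part n f) m = (if total_deg m = n then Poly_Mapping.lookup f m else 0)"
proof -
  have "Poly_Mapping.lookup (hom_part n f) m = (\<Sum>k\<in>Poly_Mapping.keys f.
      if k = m then (if total_deg m = n then Poly_Mapping.lookup f m else 0) else 0)"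
    unfolding hom_part_def lookup_sum
    by (rule sum.cong) (auto simp: lookup_single when_def)
  then show ?thesis by (simp add: in_keys_iff)
qed

lemma homogeneous_hom_part [simp]: "homogeneous n (hom_part n f)"
  by (auto simp: homogeneous_def in_keys_iff lookup_hom_part split: if_splits)

lemma hom_part_add: "hom_part n (f + g) = hom_part n f + hom_part n g"
  by (rule poly_mapping_eqI) (simp add: lookup_hom_part lookup_add)

lemma hom_part_0 [simp]: "hom_part n 0 = 0"
  by (simp add: hom_part_def)

lemma hom_part_sum: "hom_part n (\<Sum>x\<in>A. h x) = (\<Sum>x\<in>A. hom_part n (h x))"
  by (induction A rule: infinite_finite_induct) (simp_all add: hom_part_add)

lemma hom_part_diff: "hom_part n (f - g) = hom_part n f - hom_part n g"
  by (rule poly_mapping_eqI) (simp add: lookup_hom_part lookup_minus)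

lemma hom_part_homogeneous: "homogeneous m f \<Longrightarrow> hom_part n f = (if n = m then f else 0)"
  by (rule poly_mapping_eqI) (auto simp: lookup_hom_part homogeneous_def in_keys_iff)

lemma hom_part_mult:
  assumes "homogeneous d h"
  shows "hom_part n (h * g) = (if d \<le> n then h * hom_part (n - d) g else 0)"
proof (induction g rule: cpoly3_induct_single)
  case (single m c)
  have "homogeneous (d + total_deg m) (h * Poly_Mapping.single m c)"
    using assms by (intro homogeneous_mult homogeneous_single refl)
  then show ?case using hom_part_homogeneous[OF homogeneous_single[of m "total_deg m" c]]
    by (auto simp: hom_part_homogeneous)
qed (simp add: distrib_left hom_part_add)

lemma hom_part_eq_0_large: "\<exists>N. \<forall>n\<ge>N. hom_part n f = 0"
proof -
  define N where "N = Suc (Max (insert 0 (total_deg ` Poly_Mapping.keys f)))"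
  have "total_deg m < N" if "m \<in> Poly_Mapping.keys f" for m
    using that by (auto simp: N_def less_Suc_eq_le)
  then show ?thesis
    by (intro exI[of _ N] allI impI poly_mapping_eqI)
      (force simp: lookup_hom_part in_keys_iff)
qed

section \<open>Ideals and the Nullstellensatz\<close>

lemma lookup_cst_mult: "Poly_Mapping.lookup (cst c * f) m = c * Poly_Mapping.lookup f m"
  by (induction f rule: cpoly3_induct_single)
    (simp_all add: mult_single lookup_single when_def distrib_left lookup_add)

lemma underdetermined_system:
  fixes a :: "'c \<Rightarrow> 'm \<Rightarrow> complex"
  assumes "finite M" "finite C" "card M < card C"
  shows "\<exists>u. (\<exists>c\<in>C. u c \<noteq> 0) \<and> (\<forall>m\<in>M. (\<Sum>c\<in>C. u c * a c m) = 0)"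
  using assms
proof (induction M arbitrary: C a rule: finite_induct)
  case empty
  then obtain c where "c \<in> C" by (metis card_gt_0_iff ex_in_conv card.empty)
  then show ?case by (intro exI[of _ "\<lambda>_. 1"]) auto
next
  case (insert m M)
  show ?case
  proof (cases "\<forall>c\<in>C. a c m = 0")
    case True
    obtain u where u: "\<exists>c\<in>C. u c \<noteq> 0" "\<forall>m\<in>M. (\<Sum>c\<in>C. u c * a c m) = 0"
      using insert.IH[of C a] insert.prems insert.hyps by auto
    have "(\<Sum>c\<in>C. u c * a c m) = 0" using True by (intro sum.neutral) auto
    with u show ?thesis by (intro exI[of _ u]) auto
  next
    case False
    then obtain c0 where c0: "c0 \<in> C" "a c0 m \<noteq> 0" by blast
    define a' where "a' c n = a c n - a c m / a c0 m * a c0 n" for c n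
    have "card M < card (C - {c0})"
      using insert.prems insert.hyps c0 by (simp add: card_Diff_singleton)
    then obtain u where u: "\<exists>c\<in>C - {c0}. u c \<noteq> 0"
      "\<forall>n\<in>M. (\<Sum>c\<in>C - {c0}. u c * a' c n) = 0"
      using insert.IH[of "C - {c0}" a'] insert.prems(1) by auto
    define s where "s = (\<Sum>c\<in>C - {c0}. u c * a c m)"
    define v where "v = u(c0 := - s / a c0 m)"
    have split: "(\<Sum>c\<in>C. v c * a c n) = - s / a c0 m * a c0 n + (\<Sum>c\<in>C - {c0}. u c * a c n)" for n
    proof -
      have "(\<Sum>c\<in>C - {c0}. v c * a c n) = (\<Sum>c\<in>C - {c0}. u c * a c n)"
        by (rule sum.cong) (auto simp: v_def)
      then show ?thesis
        using sum.remove[OF insert.prems(1) c0(1), of "\<lambda>c. v c * a c n"] by (simp add: v_def)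
    qed
    have "(\<Sum>c\<in>C. v c * a c n) = 0" if "n \<in> insert m M" for n
    proof (cases "n = m")
      case True
      then show ?thesis using c0 by (simp add: split s_def)
    next
      case False
      then have "(\<Sum>c\<in>C - {c0}. u c * a' c n) = 0" using u that by auto
      then have "(\<Sum>c\<in>C - {c0}. u c * a c n) - s / a c0 m * a c0 n = 0"
        by (simp add: a'_def s_def right_diff_distrib sum_subtractf sum_distrib_right
            sum_divide_distrib mult.assoc)
      then show ?thesis by (simp add: split)
    qed
    moreover have "\<exists>c\<in>C. v c \<noteq> 0" using u(1) by (auto simp: v_def)
    ultimately show ?thesis by blast
  qed
qed

definition is_ideal :: "cpoly3 set \<Rightarrow> bool" where
  "is_ideal I \<longleftrightarrow> 0 \<in> I \<and> (\<forall>a\<in>I. \<forall>b\<in>I. a + b \<in> I) \<and> (\<forall>r. \<forall>a\<in>I. r * a \<in> I)"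

lemma is_idealD:
  assumes "is_ideal I"
  shows "0 \<in> I" "a \<in> I \<Longrightarrow> b \<in> I \<Longrightarrow> a + b \<in> I" "a \<in> I \<Longrightarrow> r * a \<in> I"
    "a \<in> I \<Longrightarrow> a * r \<in> I" "a \<in> I \<Longrightarrow> - a \<in> I" "a \<in> I \<Longrightarrow> b \<in> I \<Longrightarrow> a - b \<in> I"
proof -
  show 1: "0 \<in> I" "a \<in> I \<Longrightarrow> b \<in> I \<Longrightarrow> a + b \<in> I" "a \<in> I \<Longrightarrow> r * a \<in> I" for a b r
    using assms by (auto simp: is_ideal_def)
  show "a \<in> I \<Longrightarrow> a * r \<in> I" using 1(3)[of a r] by (simp add: mult.commute)
  show 2: "a \<in> I \<Longrightarrow> - a \<in> I" for a using 1(3)[of a "-1"] by simp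
  show "a \<in> I \<Longrightarrow> b \<in> I \<Longrightarrow> a - b \<in> I" using 1(2)[of a "-b"] 2[of b] by simp
qed

lemma is_ideal_sum:
  "is_ideal I \<Longrightarrow> (\<And>x. x \<in> A \<Longrightarrow> h x \<in> I) \<Longrightarrow> (\<Sum>x\<in>A. h x) \<in> I"
  by (induction A rule: infinite_finite_induct) (auto simp: is_idealD)

definition maximal_ideal :: "cpoly3 set \<Rightarrow> bool" where
  "maximal_ideal M \<longleftrightarrow> is_ideal M \<and> 1 \<notin> M \<and> (\<forall>a. a \<notin> M \<longrightarrow> (\<exists>s. s * a - 1 \<in> M))"

lemma ex_maximal_ideal:
  assumes "is_ideal I" "1 \<notin> I"
  obtains M where "maximal_ideal M" "I \<subseteq> M"
proof -
  define \<A> where "\<A> = {M. is_ideal M \<and> I \<subseteq> M \<and> 1 \<notin> M}"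
  have ne: "\<A> \<noteq> {}" using assms by (auto simp: \<A>_def)
  have "\<Union>\<C> \<in> \<A>" if "\<C> \<noteq> {}" "subset.chain \<A> \<C>" for \<C>
  proof -
    have sub: "X \<in> \<A>" if "X \<in> \<C>" for X using that \<open>subset.chain \<A> \<C>\<close>
      by (auto simp: subset.chain_def)
    have lin: "X \<subseteq> Y \<or> Y \<subseteq> X" if "X \<in> \<C>" "Y \<in> \<C>" for X Y
      using that \<open>subset.chain \<A> \<C>\<close> by (auto simp: subset.chain_def)
    obtain X0 where X0: "X0 \<in> \<C>" using \<open>\<C> \<noteq> {}\<close> by blast
    have "a + b \<in> \<Union>\<C>" if ab: "a \<in> \<Union>\<C>" "b \<in> \<Union>\<C>" for a b
    proof -
      obtain X Y where "X \<in> \<C>" "a \<in> X" "Y \<in> \<C>" "b \<in> Y" using ab by blast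
      then obtain Z where "Z \<in> \<C>" "a \<in> Z" "b \<in> Z" using lin[of X Y] by blast
      then show ?thesis using sub[of Z] is_idealD(2)[of Z a b] by (auto simp: \<A>_def)
    qed
    moreover have "0 \<in> \<Union>\<C>" using X0 sub[OF X0] is_idealD(1) by (auto simp: \<A>_def)
    moreover have "r * a \<in> \<Union>\<C>" if "a \<in> \<Union>\<C>" for a r
      using that sub is_idealD(3) by (fastforce simp: \<A>_def)
    ultimately have "is_ideal (\<Union>\<C>)" by (auto simp: is_ideal_def)
    moreover have "I \<subseteq> \<Union>\<C>" "1 \<notin> \<Union>\<C>" using X0 sub by (auto simp: \<A>_def)
    ultimately show ?thesis by (simp add: \<A>_def)
  qed
  from subset_Zorn_nonempty[OF ne this] obtain M where M: "M \<in> \<A>"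
    and max: "\<And>X. X \<in> \<A> \<Longrightarrow> M \<subseteq> X \<Longrightarrow> X = M" by blast
  have iM: "is_ideal M" "I \<subseteq> M" "1 \<notin> M" using M by (auto simp: \<A>_def)
  have "\<exists>s. s * a - 1 \<in> M" if "a \<notin> M" for a
  proof -
    define M' where "M' = {m + r * a |m r. m \<in> M}"
    have mem: "m + r * a \<in> M'" if "m \<in> M" for m r using that by (auto simp: M'_def)
    have "is_ideal M'" unfolding is_ideal_def
    proof (intro conjI ballI allI)
      show "0 \<in> M'" using mem[of 0 0] iM by (simp add: is_idealD)
    next
      fix u v assume "u \<in> M'" "v \<in> M'"
      then obtain m r m' r' where "u = m + r * a" "v = m' + r' * a" "m \<in> M" "m' \<in> M"
        by (auto simp: M'_def)
      then show "u + v \<in> M'" using mem[of "m + m'" "r + r'"] iM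
        by (simp add: is_idealD algebra_simps)
    next
      fix s u assume "u \<in> M'"
      then obtain m r where "u = m + r * a" "m \<in> M" by (auto simp: M'_def)
      then show "s * u \<in> M'" using mem[of "s * m" "s * r"] iM
        by (simp add: is_idealD algebra_simps)
    qed
    moreover have "M \<subseteq> M'" using mem[of _ 0] by auto
    moreover have "a \<in> M'" using mem[of 0 1] iM by (simp add: is_idealD)
    ultimately have "1 \<in> M'" using max[of M'] that iM by (auto simp: \<A>_def)
    then obtain m r where "1 = m + r * a" "m \<in> M" by (auto simp: M'_def)
    then have "r * a - 1 = - m" by (simp add: algebra_simps)
    then show ?thesis using \<open>m \<in> M\<close> iM by (metis is_idealD(5))
  qed
  with iM that[of M] show thesis by (simp add: maximal_ideal_def)
qed

definition var_poly :: "3 \<Rightarrow> complex poly \<Rightarrow> cpoly3" where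
  "var_poly i p = poly (map_poly cst p) (var i)"

lemma var_poly_pCons: "var_poly i (pCons a p) = cst a + var i * var_poly i p"
  by (simp add: var_poly_def map_poly_pCons)

lemma var_poly_0 [simp]: "var_poly i 0 = 0"
  by (simp add: var_poly_def)

lemma var_poly_1 [simp]: "var_poly i 1 = 1"
  using var_poly_pCons[of i 1 0] by (simp add: one_pCons)

lemma var_poly_add: "var_poly i (p + q) = var_poly i p + var_poly i q"
proof (induction p arbitrary: q)
  case (pCons a p)
  show ?case
  proof (cases q)
    case (pCons b r)
    then show ?thesis using pCons.IH[of r]
      by (simp add: var_poly_pCons single_add algebra_simps)
  qed
qed simp

lemma var_poly_smult: "var_poly i (smult c p) = cst c * var_poly i p"
  by (induction p) (simp_all add: var_poly_pCons algebra_simps mult_single)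

lemma var_poly_mult: "var_poly i (p * q) = var_poly i p * var_poly i q"
  by (induction p) (simp_all add: var_poly_pCons var_poly_add var_poly_smult algebra_simps)

lemma var_poly_sum: "var_poly i (\<Sum>x\<in>A. h x) = (\<Sum>x\<in>A. var_poly i (h x))"
  by (induction A rule: infinite_finite_induct) (simp_all add: var_poly_add)

lemma var_poly_prod: "var_poly i (\<Prod>x\<in>A. h x) = (\<Prod>x\<in>A. var_poly i (h x))"
  by (induction A rule: infinite_finite_induct) (simp_all add: var_poly_mult)

lemma var_poly_linear: "var_poly i [:- c, 1:] = var i - cst c"
  by (simp add: var_poly_pCons single_uminus)

lemma exponent_decomposition:
  "m = Poly_Mapping.single 1 (Poly_Mapping.lookup m 1)
      + Poly_Mapping.single 2 (Poly_Mapping.lookup m 2)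
      + Poly_Mapping.single 3 (Poly_Mapping.lookup m 3)"
  for m :: "3 \<Rightarrow>\<^sub>0 nat"
  by (rule poly_mapping_eqI, rename_tac k)
    (use exhaust_3 in \<open>auto simp: lookup_add lookup_single when_def\<close>)

lemma finite_total_deg: "finite {m. total_deg m \<le> N}"
proof -
  have "{m. total_deg m \<le> N} \<subseteq> (\<lambda>(a, b, c). Poly_Mapping.single 1 a +
      Poly_Mapping.single 2 b + Poly_Mapping.single 3 c) ` ({..N} \<times> {..N} \<times> {..N})"
  proof
    fix m assume "m \<in> {m. total_deg m \<le> N}"
    then have "(Poly_Mapping.lookup m 1, Poly_Mapping.lookup m 2, Poly_Mapping.lookup m 3)
        \<in> {..N} \<times> {..N} \<times> {..N}"
      by (simp add: total_deg_def sum_3)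
    then show "m \<in> (\<lambda>(a, b, c). Poly_Mapping.single 1 a +
        Poly_Mapping.single 2 b + Poly_Mapping.single 3 c) ` ({..N} \<times> {..N} \<times> {..N})"
      by (rule rev_image_eqI) (simp flip: exponent_decomposition)
  qed
  then show ?thesis by (rule finite_subset) auto
qed

text \<open>If no \<open>var i - cst c\<close> lies in \<open>M\<close>, all of them have inverses modulo \<open>M\<close>. There are uncountably many
  of these, in a space of countable dimension, so finitely many of them satisfy a linear relation.
  Clearing denominators turns the relation into a nonzero polynomial in \<open>var i\<close> alone that lies in
  \<open>M\<close>. One of minimal degree has a root \<open>e\<close>, and can be divided by the invertible \<open>var i - cst e\<close>.\<close>

lemma maximal_ideal_var:
  assumes M: "maximal_ideal M"
  shows "\<exists>c. var i - cst c \<in> M"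
proof (rule ccontr)
  assume "\<not> ?thesis"
  then have "\<forall>c. \<exists>s. s * (var i - cst c) - 1 \<in> M" using M by (auto simp: maximal_ideal_def)
  then obtain s where s: "s c * (var i - cst c) - 1 \<in> M" for c by metis
  have iM: "is_ideal M" "1 \<notin> M" using M by (auto simp: maximal_ideal_def)
  define A where "A N = {c. \<forall>m\<in>Poly_Mapping.keys (s c). total_deg m \<le> N}" for N
  have "\<exists>N. c \<in> A N" for c
    by (intro exI[of _ "Max (insert 0 (total_deg ` Poly_Mapping.keys (s c)))"]) (auto simp: A_def)
  then have "(\<Union>N. A N) = UNIV" by blast
  then have "\<exists>N. infinite (A N)"
    using countable_UN[of UNIV A] uncountable_UNIV_complex by (metis countable_finite countableI_type)
  then obtain N where N: "infinite (A N)" by blast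
  obtain C where C: "finite C" "C \<subseteq> A N" "card C = Suc (card {m. total_deg m \<le> N})"
    using infinite_arbitrarily_large[OF N] by blast
  obtain u where u: "\<exists>c\<in>C. u c \<noteq> 0"
    "\<And>m. total_deg m \<le> N \<Longrightarrow> (\<Sum>c\<in>C. u c * Poly_Mapping.lookup (s c) m) = 0"
    using underdetermined_system[OF finite_total_deg[of N] C(1), of "\<lambda>c. Poly_Mapping.lookup (s c)"] C(3)
    by auto
  have rel: "(\<Sum>c\<in>C. cst (u c) * s c) = 0"
  proof (rule poly_mapping_eqI)
    fix m
    have "(\<Sum>c\<in>C. u c * Poly_Mapping.lookup (s c) m) = 0"
    proof (cases "total_deg m \<le> N")
      case False
      then have "Poly_Mapping.lookup (s c) m = 0" if "c \<in> C" for c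
        using that C(2) by (fastforce simp: A_def in_keys_iff)
      then show ?thesis by simp
    qed (rule u)
    then show "Poly_Mapping.lookup (\<Sum>c\<in>C. cst (u c) * s c) m = Poly_Mapping.lookup 0 m"
      by (simp add: lookup_sum lookup_cst_mult)
  qed
  \<comment> \<open>The relation multiplied by all \<open>var i - cst d\<close>, with \<open>s c * (var i - cst c)\<close> replaced by \<open>1\<close>.\<close>
  define P where "P = (\<Sum>c\<in>C. smult (u c) (\<Prod>d\<in>C - {c}. [:- d, 1:]))"
  have P_in: "var_poly i P \<in> M"
  proof -
    define w where "w c = s c * (var i - cst c) - 1" for c
    define R where "R c = cst (u c) * (\<Prod>d\<in>C - {c}. var i - cst d)" for c
    have "var_poly i P = (\<Sum>c\<in>C. R c)"
      by (simp add: P_def R_def var_poly_sum var_poly_smult var_poly_prod var_poly_linear)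
    moreover have "(\<Sum>c\<in>C. R c) + (\<Sum>c\<in>C. R c * w c) = 0"
    proof -
      have "R c + R c * w c = cst (u c) * s c * (\<Prod>d\<in>C. var i - cst d)" if "c \<in> C" for c
      proof -
        have "R c + R c * w c = cst (u c) * s c *
            ((var i - cst c) * (\<Prod>d\<in>C - {c}. var i - cst d))"
          unfolding R_def w_def by (simp only: algebra_simps mult_1_left)
        then show ?thesis by (simp only: prod.remove[OF C(1) that, of "\<lambda>d. var i - cst d"])
      qed
      then have "(\<Sum>c\<in>C. R c + R c * w c) = (\<Sum>c\<in>C. cst (u c) * s c) * (\<Prod>d\<in>C. var i - cst d)"
        by (simp add: sum_distrib_right)
      then show ?thesis by (simp add: rel sum.distrib)
    qed
    moreover have "(\<Sum>c\<in>C. R c * w c) \<in> M"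
      by (rule is_ideal_sum[OF iM(1)]) (use s in \<open>auto simp: w_def intro: is_idealD(3)[OF iM(1)]\<close>)
    ultimately show ?thesis using is_idealD(5)[OF iM(1)] by (metis eq_neg_iff_add_eq_0)
  qed
  have "P \<noteq> 0"
  proof -
    obtain c0 where c0: "c0 \<in> C" "u c0 \<noteq> 0" using u(1) by blast
    have "poly P c0 = (\<Sum>c\<in>C. u c * (\<Prod>d\<in>C - {c}. c0 - d))"
      by (simp add: P_def poly_sum poly_prod)
    also have "\<dots> = (\<Sum>c\<in>C. if c = c0 then u c0 * (\<Prod>d\<in>C - {c0}. c0 - d) else 0)"
      by (rule sum.cong) (use c0 C(1) in auto)
    also have "\<dots> \<noteq> 0" using c0 C(1) by simp
    finally show ?thesis by auto
  qed
  obtain p where p: "p \<noteq> 0" "var_poly i p \<in> M"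
    and minimal: "\<And>q. q \<noteq> 0 \<Longrightarrow> var_poly i q \<in> M \<Longrightarrow> degree p \<le> degree q"
    using ex_has_least_nat[of "\<lambda>q. q \<noteq> 0 \<and> var_poly i q \<in> M" P degree] \<open>P \<noteq> 0\<close> P_in by blast
  show False
  proof (cases "degree p = 0")
    case True
    then obtain a where a: "p = [:a:]" by (rule degree_eq_zeroE)
    then have "cst (inverse a) * cst a \<in> M" using p is_idealD(3)[OF iM(1)]
      by (simp add: var_poly_pCons del: mult_single)
    then show False using a p iM by (simp add: mult_single)
  next
    case False
    then obtain e where "poly p e = 0"
      using fundamental_theorem_of_algebra[of p] by (auto simp: constant_degree)
    then obtain q where q: "p = [:- e, 1:] * q" by (auto simp: poly_eq_0_iff_dvd dvd_def)
    then have "q \<noteq> 0" using p by auto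
    have "var_poly i q = s e * var_poly i p - (s e * (var i - cst e) - 1) * var_poly i q"
      unfolding q var_poly_mult var_poly_linear by (simp add: algebra_simps)
    also have "\<dots> \<in> M"
      by (rule is_idealD(6)[OF iM(1) is_idealD(3)[OF iM(1) p(2)] is_idealD(4)[OF iM(1) s]])
    finally have "degree p \<le> degree q" using \<open>q \<noteq> 0\<close> minimal by blast
    moreover have "degree p = Suc (degree q)"
      unfolding q using \<open>q \<noteq> 0\<close> by (subst degree_mult_eq) auto
    ultimately show False by simp
  qed
qed

lemma weak_nullstellensatz:
  assumes "is_ideal I" "1 \<notin> I"
  shows "\<exists>p. \<forall>g\<in>I. eval3 g p = 0"
proof -
  obtain M where M: "maximal_ideal M" "I \<subseteq> M" using ex_maximal_ideal[OF assms] .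
  then have iM: "is_ideal M" "1 \<notin> M" by (auto simp: maximal_ideal_def)
  obtain c where c: "var i - cst (c i) \<in> M" for i using maximal_ideal_var[OF M(1)] by metis
  define p :: "complex^3" where "p = (\<chi> i. c i)"
  have *: "g - cst (eval3 g p) \<in> M" for g
  proof (induction g rule: cpoly3_induct)
    case (cst c)
    show ?case by (simp add: is_idealD iM)
  next
    case (var i)
    show ?case using c[of i] by (simp add: p_def)
  next
    case (add f g)
    then show ?case using is_idealD(2)[OF iM(1) add] by (simp add: single_add algebra_simps)
  next
    case (mult f g)
    have "f * g - cst (eval3 (f * g) p) =
        f * (g - cst (eval3 g p)) + cst (eval3 g p) * (f - cst (eval3 f p))"
      by (simp add: algebra_simps mult_single)
    then show ?case using mult is_idealD[OF iM(1)] by metis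
  qed
  have "eval3 g p = 0" if "g \<in> M" for g
  proof (rule ccontr)
    assume ne: "eval3 g p \<noteq> 0"
    have "cst (eval3 g p) \<in> M" using is_idealD(6)[OF iM(1) that *[of g]] by simp
    then have "cst (inverse (eval3 g p)) * cst (eval3 g p) \<in> M" by (rule is_idealD(3)[OF iM(1)])
    then show False using ne iM by (simp add: mult_single)
  qed
  then show ?thesis using M(2) by blast
qed

text \<open>The ideal generated by \<open>J\<close> and \<open>var i - 1\<close> has no zero, so \<open>1 = j + (var i - 1) * s\<close> with \<open>j \<in> J\<close>.
  The homogeneous components of this equation show, degree by degree, that the component of \<open>s\<close> of
  degree \<open>n\<close> is congruent to \<open>- var i ^ n\<close> modulo \<open>J\<close>; for large \<open>n\<close> it is zero.\<close>

lemma homogeneous_nullstellensatz: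
  assumes J: "is_ideal J" and hom: "\<And>g n. g \<in> J \<Longrightarrow> hom_part n g \<in> J"
    and zero: "\<And>p. p \<noteq> 0 \<Longrightarrow> \<exists>h\<in>J. eval3 h p \<noteq> 0"
  shows "\<exists>N. var i ^ N \<in> J"
proof -
  define I where "I = {j + (var i - 1) * s |j s. j \<in> J}"
  have mem: "j + (var i - 1) * s \<in> I" if "j \<in> J" for j s using that by (auto simp: I_def)
  have iI: "is_ideal I" unfolding is_ideal_def
  proof (intro conjI ballI allI)
    show "0 \<in> I" using mem[of 0 0] J by (simp add: is_idealD)
  next
    fix u v assume "u \<in> I" "v \<in> I"
    then obtain m r m' r' where uv: "u = m + (var i - 1) * r" "v = m' + (var i - 1) * r'"
      "m \<in> J" "m' \<in> J"
      by (auto simp: I_def)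
    have "u + v = (m + m') + (var i - 1) * (r + r')" unfolding uv by (simp add: algebra_simps)
    then show "u + v \<in> I" using mem[of "m + m'" "r + r'"] uv(3,4) is_idealD(2)[OF J] by simp
  next
    fix s u assume "u \<in> I"
    then obtain m r where u: "u = m + (var i - 1) * r" "m \<in> J" by (auto simp: I_def)
    have "s * u = s * m + (var i - 1) * (s * r)" unfolding u by (simp add: algebra_simps)
    then show "s * u \<in> I" using mem[of "s * m" "s * r"] u(2) is_idealD(3)[OF J] by simp
  qed
  have "1 \<in> I"
  proof (rule ccontr)
    assume "1 \<notin> I"
    then obtain p where p: "\<And>g. g \<in> I \<Longrightarrow> eval3 g p = 0"
      using weak_nullstellensatz[OF iI] by blast
    have "eval3 (0 + (var i - 1) * 1) p = 0" by (rule p, rule mem) (simp add: is_idealD J)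
    then have "p $ i = 1" by simp
    then have "p \<noteq> 0" by auto
    then obtain h where h: "h \<in> J" "eval3 h p \<noteq> 0" using zero by blast
    have "eval3 (h + (var i - 1) * 0) p = 0" by (rule p, rule mem, rule h)
    then show False using h by simp
  qed
  then obtain j s where js: "j \<in> J" "1 = j + (var i - 1) * s" by (auto simp: I_def)
  have *: "hom_part n s + var i ^ n \<in> J" for n
  proof (induction n)
    case 0
    have "hom_part 0 1 = hom_part 0 (j + (var i - 1) * s)" using js by simp
    then have "1 = hom_part 0 j - hom_part 0 s"
      using hom_part_homogeneous[OF homogeneous_cst[of 1], of 0]
        hom_part_mult[OF homogeneous_var[of i], of 0 s]
      by (simp add: hom_part_add hom_part_diff left_diff_distrib)
    then have "hom_part 0 s + 1 = hom_part 0 j" by (simp add: algebra_simps)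
    then show ?case using hom js by simp
  next
    case (Suc n)
    have "hom_part (Suc n) 1 = hom_part (Suc n) (j + (var i - 1) * s)" using js by simp
    then have "0 = hom_part (Suc n) j + var i * hom_part n s - hom_part (Suc n) s"
      using hom_part_homogeneous[OF homogeneous_cst[of 1], of "Suc n"]
        hom_part_mult[OF homogeneous_var[of i], of "Suc n" s]
      by (simp add: hom_part_add hom_part_diff left_diff_distrib add_diff_eq)
    then have "hom_part (Suc n) s + var i ^ Suc n =
        hom_part (Suc n) j + var i * (hom_part n s + var i ^ n)"
      by (simp add: algebra_simps)
    then show ?case using hom js Suc is_idealD[OF J] by metis
  qed
  obtain N where "hom_part N s = 0" using hom_part_eq_0_large[of s] by blast
  with *[of N] show ?thesis by auto
qed

text \<open>The colon ideal of \<open>J\<close> and \<open>g\<close> is homogeneous and, by the local hypothesis, has no projective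
  zero. So it contains a power of every variable, and hence all forms of large degree, since a
  monomial of degree \<open>3 N\<close> is divisible by the \<open>N\<close>-th power of some variable.\<close>

lemma in_saturation_if_locally:
  assumes J: "is_ideal J" and hom: "\<And>g n. g \<in> J \<Longrightarrow> hom_part n g \<in> J"
    and g: "homogeneous d g"
    and loc: "\<And>p. p \<noteq> 0 \<Longrightarrow> \<exists>h. eval3 h p \<noteq> 0 \<and> h * g \<in> J"
  shows "g \<in> saturation J"
proof -
  define J' where "J' = {h. h * g \<in> J}"
  have J': "is_ideal J'"
    using is_idealD[OF J] by (auto simp: is_ideal_def J'_def distrib_right mult.assoc)
  have "hom_part n h \<in> J'" if "h \<in> J'" for h n
  proof -
    have "hom_part (n + d) (h * g) = hom_part n h * g"
      using hom_part_mult[OF g, of "n + d" h] by (simp add: mult.commute)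
    then show ?thesis using hom[of "h * g" "n + d"] that by (simp add: J'_def)
  qed
  then have "\<exists>N. var i ^ N \<in> J'" for i
    by (rule homogeneous_nullstellensatz[OF J']) (use loc in \<open>unfold J'_def, blast+\<close>)
  then obtain n where n: "var i ^ n i \<in> J'" for i by metis
  define N where "N = Max (n ` UNIV)"
  have N: "var i ^ k \<in> J'" if "N \<le> k" for i k
  proof -
    have "n i \<le> N" by (simp add: N_def)
    then have "var i ^ k = var i ^ (k - n i) * var i ^ n i"
      using that by (simp flip: power_add)
    then show ?thesis using n is_idealD(3)[OF J'] by metis
  qed
  have "h \<in> J'" if "homogeneous (3 * N) h" for h
    using that
  proof (induction rule: homogeneous_induct)
    case (single m c)
    have "\<exists>i. N \<le> Poly_Mapping.lookup m i"
    proof (rule ccontr)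
      assume "\<not> ?thesis"
      then have "Poly_Mapping.lookup m i < N" for i by (simp add: not_le)
      from this[of 1] this[of 2] this[of 3] show False
        using single by (simp add: total_deg_def sum_3)
    qed
    then obtain i where i: "var i ^ Poly_Mapping.lookup m i \<in> J'" using N by blast
    have "Poly_Mapping.single m c = (cst c * (\<Prod>j\<in>UNIV - {i}. var j ^ Poly_Mapping.lookup m j))
        * var i ^ Poly_Mapping.lookup m i"
    proof -
      have "(\<Prod>j\<in>UNIV. var j ^ Poly_Mapping.lookup m j) =
          var i ^ Poly_Mapping.lookup m i * (\<Prod>j\<in>UNIV - {i}. var j ^ Poly_Mapping.lookup m j)"
        by (rule prod.remove) auto
      then show ?thesis unfolding single_eq_prod_var[of m c] by (simp only: mult_ac)
    qed
    then show ?case using i is_idealD(3)[OF J'] by metis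
  qed (use is_idealD[OF J'] in auto)
  then show ?thesis by (auto simp: saturation_def J'_def)
qed

lemma is_ideal_jacobian: "is_ideal (jacobian_ideal f)"
proof -
  define D where "D a = (\<Sum>i\<in>UNIV. a i * partial i f)" for a
  have J: "jacobian_ideal f = range D" by (auto simp: jacobian_ideal_def D_def)
  have "0 = D (\<lambda>_. 0)" "D a + D b = D (\<lambda>i. a i + b i)" "r * D a = D (\<lambda>i. r * a i)" for a b r
    by (simp_all add: D_def distrib_right sum.distrib sum_distrib_left mult.assoc)
  then show ?thesis unfolding is_ideal_def J by blast
qed

lemma hom_part_jacobian:
  assumes f: "homogeneous (Suc e) f" and g: "g = (\<Sum>i\<in>UNIV. a i * partial i f)" and "e \<le> n"
  shows "hom_part n g = (\<Sum>i\<in>UNIV. hom_part (n - e) (a i) * partial i f)"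
proof -
  have "hom_part n (a i * partial i f) = hom_part (n - e) (a i) * partial i f" for i
    using hom_part_mult[OF homogeneous_partial[OF f], of n i "a i"] \<open>e \<le> n\<close>
    by (simp add: mult.commute)
  then show ?thesis by (simp add: g hom_part_sum)
qed

lemma hom_part_in_jacobian:
  assumes f: "homogeneous (Suc e) f" and g: "g \<in> jacobian_ideal f"
  shows "hom_part n g \<in> jacobian_ideal f"
proof -
  obtain a where a: "g = (\<Sum>i\<in>UNIV. a i * partial i f)" using g by (auto simp: jacobian_ideal_def)
  show ?thesis
  proof (cases "e \<le> n")
    case True
    then show ?thesis using hom_part_jacobian[OF f a] by (auto simp: jacobian_ideal_def)
  next
    case False
    then have "hom_part n (a i * partial i f) = 0" for i
      using hom_part_mult[OF homogeneous_partial[OF f], of n i "a i"] by (simp add: mult.commute)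
    then show ?thesis by (simp add: a hom_part_sum is_idealD[OF is_ideal_jacobian])
  qed
qed

section \<open>Counting dimensions\<close>

interpretation polys: vector_space scale_poly
  by unfold_locales (simp_all add: scale_poly_def algebra_simps single_add mult_single)

lemma single_one_inject:
  "Poly_Mapping.single x (1::complex) = Poly_Mapping.single y 1 \<longleftrightarrow> x = y"
proof
  assume "Poly_Mapping.single x (1::complex) = Poly_Mapping.single y 1"
  then have "Poly_Mapping.keys (Poly_Mapping.single x (1::complex)) =
      Poly_Mapping.keys (Poly_Mapping.single y (1::complex))" by (rule arg_cong)
  then show "x = y" by simp
qed simp

lemma card_total_deg: "card {m. total_deg m = n} = (n + 2) choose 2"
proof -
  let ?T = "SIGMA a:{..n}. {..n - a}"
  let ?m = "\<lambda>(a, b). Poly_Mapping.single (1::3) a + Poly_Mapping.single 2 b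
      + Poly_Mapping.single 3 (n - a - b)"
  have "bij_betw ?m ?T {m. total_deg m = n}"
  proof (rule bij_betw_byWitness[where f' = "\<lambda>m :: 3 \<Rightarrow>\<^sub>0 nat. (Poly_Mapping.lookup m 1, Poly_Mapping.lookup m 2)"])
    show "\<forall>m\<in>{m. total_deg m = n}. ?m (Poly_Mapping.lookup m 1, Poly_Mapping.lookup m 2) = m"
    proof (intro ballI)
      fix m :: "3 \<Rightarrow>\<^sub>0 nat" assume m: "m \<in> {m. total_deg m = n}"
      show "?m (Poly_Mapping.lookup m 1, Poly_Mapping.lookup m 2) = m"
      proof -
        have n: "n - Poly_Mapping.lookup m 1 - Poly_Mapping.lookup m 2 = Poly_Mapping.lookup m 3"
        proof -
          have "total_deg m = n" using m by simp
          then show ?thesis unfolding total_deg_def sum_3 by linarith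
        qed
        show ?thesis unfolding prod.case n by (rule exponent_decomposition[symmetric])
      qed
    qed
  next
    show "?m ` ?T \<subseteq> {m. total_deg m = n}" by auto
    show "(\<lambda>m. (Poly_Mapping.lookup m 1, Poly_Mapping.lookup m 2)) ` {m. total_deg m = n} \<subseteq> ?T"
      unfolding total_deg_def sum_3 by auto
    show "\<forall>a\<in>?T. (Poly_Mapping.lookup (?m a) 1, Poly_Mapping.lookup (?m a) 2) = a"
    proof
      fix ab assume "ab \<in> ?T"
      obtain a b where ab: "ab = (a, b)" by force
      have "Poly_Mapping.lookup (Poly_Mapping.single (1::3) a + Poly_Mapping.single 2 b
          + Poly_Mapping.single 3 c) 1 = a" "Poly_Mapping.lookup (Poly_Mapping.single (1::3) a
          + Poly_Mapping.single 2 b + Poly_Mapping.single 3 c) 2 = b" for c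
        by (simp_all add: lookup_add lookup_single when_def)
      then show "(Poly_Mapping.lookup (?m ab) 1, Poly_Mapping.lookup (?m ab) 2) = ab"
        unfolding ab prod.case by simp
    qed
  qed
  then have "card {m. total_deg m = n} = card ?T" by (rule bij_betw_same_card[symmetric])
  also have "\<dots> = (\<Sum>a\<le>n. Suc (n - a))" by simp
  also have "\<dots> = (n + 2) choose 2"
  proof (induction n)
    case (Suc n)
    have "(\<Sum>a\<le>Suc n. Suc (Suc n - a)) = Suc (Suc n) + (\<Sum>a\<le>n. Suc (n - a))"
      by (simp add: sum.atMost_Suc_shift del: sum.atMost_Suc)
    then show ?case using Suc by (simp add: numeral_2_eq_2)
  qed (simp add: choose_two)
  finally show ?thesis .
qed

lemma independent_monomials:
  "polys.independent ((\<lambda>m. Poly_Mapping.single m 1) ` A)"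
  unfolding polys.independent_explicit_module
proof (intro allI impI)
  fix T u w assume T: "finite T" "T \<subseteq> (\<lambda>m. Poly_Mapping.single m 1) ` A"
    and 0: "(\<Sum>v\<in>T. scale_poly (u v) v) = 0" and w: "w \<in> T"
  obtain m where wm: "w = Poly_Mapping.single m 1" using w T(2) by blast
  with w have m: "Poly_Mapping.single m 1 \<in> T" by simp
  have "0 = Poly_Mapping.lookup (\<Sum>v\<in>T. scale_poly (u v) v) m" by (simp add: 0)
  also have "\<dots> = (\<Sum>v\<in>T. u v * Poly_Mapping.lookup v m)"
    by (simp add: lookup_sum scale_poly_def lookup_cst_mult)
  also have "\<dots> = (\<Sum>v\<in>T. if v = Poly_Mapping.single m 1 then u v else 0)"
  proof (rule sum.cong)
    fix v assume "v \<in> T"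
    then obtain n where "v = Poly_Mapping.single n 1" using T(2) by blast
    then show "u v * Poly_Mapping.lookup v m = (if v = Poly_Mapping.single m 1 then u v else 0)"
      by (auto simp: lookup_single when_def single_one_inject)
  qed simp
  also have "\<dots> = u (Poly_Mapping.single m 1)" using T m by simp
  finally show "u w = 0" by (simp add: wm)
qed

definition functional :: "(cpoly3 \<Rightarrow> complex) \<Rightarrow> bool" where
  "functional \<phi> \<longleftrightarrow> (\<forall>a b. \<phi> (a + b) = \<phi> a + \<phi> b) \<and> (\<forall>c a. \<phi> (cst c * a) = c * \<phi> a)"

text \<open>A linear functional cuts the dimension by at most one: every vector of \<open>V\<close> is the sum of an
  element of the kernel and a multiple of one fixed vector outside the kernel.\<close>

lemma span_of_kernel:
  assumes "finite \<Phi>" "\<forall>\<phi>\<in>\<Phi>. functional \<phi>" "polys.subspace V" "finite G"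
    "{v\<in>V. \<forall>\<phi>\<in>\<Phi>. \<phi> v = 0} \<subseteq> polys.span G"
  shows "\<exists>G'. finite G' \<and> card G' \<le> card G + card \<Phi> \<and> V \<subseteq> polys.span G'"
  using assms
proof (induction \<Phi> arbitrary: V rule: finite_induct)
  case empty
  then show ?case by auto
next
  case (insert \<phi> \<Phi>)
  have \<phi>: "\<phi> (a + b) = \<phi> a + \<phi> b" "\<phi> (scale_poly c a) = c * \<phi> a" for a b c
    using insert.prems by (auto simp: functional_def scale_poly_def)
  have \<phi>0: "\<phi> 0 = 0" using \<phi>(2)[of 0 0] by (simp add: scale_poly_def)
  define V' where "V' = {v\<in>V. \<phi> v = 0}"
  have "polys.subspace V'"
    using insert.prems(2) by (auto simp: polys.subspace_def V'_def \<phi> \<phi>0)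
  moreover have "{v\<in>V'. \<forall>\<phi>\<in>\<Phi>. \<phi> v = 0} \<subseteq> polys.span G"
    using insert.prems by (auto simp: V'_def)
  ultimately obtain G1 where G1: "finite G1" "card G1 \<le> card G + card \<Phi>" "V' \<subseteq> polys.span G1"
    using insert.IH[of V'] insert.prems by auto
  show ?case
  proof (cases "V' = V")
    case True
    then show ?thesis using G1 insert.hyps by (intro exI[of _ G1]) auto
  next
    case False
    then obtain b where b: "b \<in> V" "\<phi> b \<noteq> 0" by (auto simp: V'_def)
    have "v \<in> polys.span (insert b G1)" if "v \<in> V" for v
    proof -
      define c where "c = \<phi> v / \<phi> b"
      have neg: "v - scale_poly c b = v + scale_poly (- c) b"
        by (simp add: scale_poly_def single_uminus)
      have "v - scale_poly c b \<in> V"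
        using that b insert.prems(2) by (simp add: polys.subspace_diff polys.subspace_scale)
      moreover have "\<phi> (v - scale_poly c b) = \<phi> v + (- c) * \<phi> b" by (simp only: neg \<phi>)
      then have "\<phi> (v - scale_poly c b) = 0" using b(2) by (simp add: c_def)
      ultimately have "v - scale_poly c b \<in> polys.span G1" using G1 by (auto simp: V'_def)
      then show ?thesis by (auto simp: polys.span_insert)
    qed
    moreover have "card (insert b G1) \<le> card G + card (insert \<phi> \<Phi>)"
      using G1 insert.hyps by (simp add: card_insert_if)
    ultimately show ?thesis using G1(1) by (intro exI[of _ "insert b G1"]) auto
  qed
qed

text \<open>In degree \<open>j\<close> the saturation is spanned by the products of monomials with the partial derivatives
  and at most one further element. If \<open>\<Phi>\<close> cuts out a subspace of the saturation, adding one
  generator for each functional gives a spanning set of the space of all forms of degree \<open>j\<close>, which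
  cannot have fewer elements than there are monomials.\<close>

lemma nearly_free_functional_bound:
  assumes f: "homogeneous (Suc e) f" and nf: "nearly_free f" and "e \<le> j"
    and \<Phi>: "finite \<Phi>" "\<forall>\<phi>\<in>\<Phi>. functional \<phi>"
    and sat: "\<And>g. homogeneous j g \<Longrightarrow> \<forall>\<phi>\<in>\<Phi>. \<phi> g = 0 \<Longrightarrow> g \<in> saturation (jacobian_ideal f)"
  shows "(j + 2) choose 2 \<le> 3 * ((j - e + 2) choose 2) + 1 + card \<Phi>"
proof -
  obtain n where "n \<le> 1" and qd: "quotient_has_dim scale_poly
        (graded_piece j (saturation (jacobian_ideal f)))
        (graded_piece j (jacobian_ideal f)) n"
    using nf by (auto simp: nearly_free_def)
  let ?I = "graded_piece j (saturation (jacobian_ideal f))"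
  obtain B where "finite B \<and> card B = n \<and> B \<subseteq> ?I \<and>
     (\<forall>v\<in>?I. \<exists>c. v - (\<Sum>b\<in>B. scale_poly (c b) b) \<in> graded_piece j (jacobian_ideal f)) \<and>
     (\<forall>c. (\<Sum>b\<in>B. scale_poly (c b) b) \<in> graded_piece j (jacobian_ideal f) \<longrightarrow> (\<forall>b\<in>B. c b = 0))"
    using qd unfolding quotient_has_dim_def ..
  then have B: "finite B" "card B = n"
    "\<And>v. v \<in> ?I \<Longrightarrow>
      \<exists>c. v - (\<Sum>b\<in>B. scale_poly (c b) b) \<in> graded_piece j (jacobian_ideal f)"
    by auto
  define D where "D = (\<lambda>(i, m). Poly_Mapping.single m 1 * partial i f) `
      ((UNIV :: 3 set) \<times> {m. total_deg m = j - e})"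
  have fin: "finite {m. total_deg m = j - e}"
    by (rule finite_subset[OF _ finite_total_deg[of "j - e"]]) auto
  then have finD: "finite D" by (simp add: D_def)
  have cardD: "card D \<le> 3 * ((j - e + 2) choose 2)"
  proof -
    have "card D \<le> card ((UNIV :: 3 set) \<times> {m. total_deg m = j - e})"
      unfolding D_def using fin by (intro card_image_le) simp
    then show ?thesis by (simp add: card_cartesian_product card_total_deg)
  qed
  have "w \<in> polys.span D" if "w \<in> graded_piece j (jacobian_ideal f)" for w
  proof -
    have wj: "homogeneous j w" and "w \<in> jacobian_ideal f"
      using that by (simp_all add: graded_piece_def)
    then obtain a where a: "w = (\<Sum>i\<in>UNIV. a i * partial i f)"
      unfolding jacobian_ideal_def by blast
    have "w = (\<Sum>i\<in>UNIV. hom_part (j - e) (a i) * partial i f)"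
      using hom_part_jacobian[OF f a \<open>e \<le> j\<close>] hom_part_homogeneous[OF wj, of j] by simp
    also have "\<dots> \<in> polys.span D"
    proof (rule polys.span_sum)
      fix i :: 3
      have "h * partial i f \<in> polys.span D" if "homogeneous (j - e) h" for h
        using that
      proof (induction rule: homogeneous_induct)
        case (single m c)
        have "Poly_Mapping.single m c * partial i f =
            scale_poly c (Poly_Mapping.single m 1 * partial i f)"
          by (simp add: scale_poly_def mult_single flip: mult.assoc)
        moreover have "Poly_Mapping.single m 1 * partial i f \<in> D"
          using single by (auto simp: D_def)
        ultimately show ?case by (simp add: polys.span_base polys.span_scale)
      qed (simp_all add: distrib_right polys.span_add polys.span_zero)
      then show "hom_part (j - e) (a i) * partial i f \<in> polys.span D" by simp
    qed
    finally show ?thesis .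
  qed
  then have span: "v \<in> polys.span (B \<union> D)"
    if v: "v \<in> graded_piece j (saturation (jacobian_ideal f))" for v
  proof -
    obtain c where "v - (\<Sum>b\<in>B. scale_poly (c b) b) \<in> graded_piece j (jacobian_ideal f)"
      using B(3)[OF v] by blast
    then have "v - (\<Sum>b\<in>B. scale_poly (c b) b) \<in> polys.span (B \<union> D)"
      using \<open>\<And>w. w \<in> graded_piece j (jacobian_ideal f) \<Longrightarrow> w \<in> polys.span D\<close>
        polys.span_mono[of D "B \<union> D"] by blast
    moreover have "(\<Sum>b\<in>B. scale_poly (c b) b) \<in> polys.span (B \<union> D)"
      by (intro polys.span_sum polys.span_scale polys.span_base) simp
    ultimately show ?thesis using polys.span_add by fastforce
  qed
  define V where "V = {g. homogeneous j g}"
  have "polys.subspace V"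
    by (auto simp: polys.subspace_def V_def scale_poly_def homogeneous_add homogeneous_scale)
  moreover have "{v\<in>V. \<forall>\<phi>\<in>\<Phi>. \<phi> v = 0} \<subseteq> polys.span (B \<union> D)"
    using sat span by (auto simp: V_def graded_piece_def)
  ultimately obtain G where G: "finite G" "card G \<le> card (B \<union> D) + card \<Phi>" "V \<subseteq> polys.span G"
    using span_of_kernel[OF \<Phi>, of V "B \<union> D"] B(1) finD by auto
  let ?S = "(\<lambda>m. Poly_Mapping.single m (1::complex)) ` {m. total_deg m = j}"
  have "?S \<subseteq> V" by (auto simp: V_def intro: homogeneous_single)
  then have "card ?S \<le> card G"
    using polys.independent_span_bound[OF G(1) independent_monomials] G(3) by blast
  moreover have "card ?S = (j + 2) choose 2"
    by (subst card_image) (simp_all add: card_total_deg inj_on_def single_one_inject)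
  ultimately show ?thesis using G(2) card_Un_le[of B D] B(2) \<open>n \<le> 1\<close> cardD by linarith
qed

section \<open>The Jacobian ideal near a singular point\<close>

subsection \<open>Coordinates at a point\<close>

text \<open>\<open>U\<close> and \<open>V\<close> are the two coordinate forms vanishing at \<open>p\<close> that belong to the basis
  \<open>p, q, r\<close>.\<close>

definition dual_frame where
  "dual_frame p q r U V \<longleftrightarrow> p \<noteq> 0 \<and> dot3 U p = 0 \<and> dot3 V p = 0 \<and>
     dot3 U q = 1 \<and> dot3 U r = 0 \<and> dot3 V q = 0 \<and> dot3 V r = 1 \<and>
     (\<forall>a. dot3 a p = 0 \<longrightarrow> a = dot3 a q *s U + dot3 a r *s V)"

lemma dual_frame_exists:
  assumes "det (vector [p, q, r] :: complex^3^3) \<noteq> 0"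
  obtains U V where "dual_frame p q r U V"
proof -
  define M :: "complex^3^3" where "M = vector [p, q, r]"
  have rows: "(M *v x) $ 1 = dot3 x p" "(M *v x) $ 2 = dot3 x q" "(M *v x) $ 3 = dot3 x r" for x
    by (simp_all add: M_def matrix_vector_mult_def dot3_def mult.commute)
  have "invertible M" using assms by (simp add: invertible_det_nz M_def)
  then obtain N where N: "M ** N = mat 1" "N ** M = mat 1" by (auto simp: invertible_def)
  have col: "M *v (N *v e) = e" for e
    by (simp add: matrix_vector_mul_assoc N matrix_vector_mul_lid)
  have inj: "x = 0" if "M *v x = 0" for x
    using arg_cong[OF that, of "\<lambda>y. N *v y"]
    by (simp add: matrix_vector_mul_assoc N matrix_vector_mul_lid)
  define U where "U = N *v axis 2 1"
  define V where "V = N *v axis 3 1"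
  have U: "dot3 U p = 0" "dot3 U q = 1" "dot3 U r = 0"
    using rows[of U] col[of "axis 2 1"] by (simp_all add: U_def axis_def)
  have V: "dot3 V p = 0" "dot3 V q = 0" "dot3 V r = 1"
    using rows[of V] col[of "axis 3 1"] by (simp_all add: V_def axis_def)
  have "a = dot3 a q *s U + dot3 a r *s V" if "dot3 a p = 0" for a
  proof -
    have "M *v (a - (dot3 a q *s U + dot3 a r *s V)) = 0"
      using that by (simp add: vec_eq_iff forall_3 rows U V)
    then show ?thesis using inj by fastforce
  qed
  moreover have "p \<noteq> 0"
  proof
    assume "p = 0"
    then have "(axis 1 1 :: complex^3) $ 1 = 0"
      using rows(1)[of "N *v axis 1 1"] by (simp add: col)
    then show False by (simp add: axis_def)
  qed
  ultimately show thesis using that[of U V] U V by (simp add: dual_frame_def)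
qed

lemma dual_frame_change:
  assumes fr: "dual_frame p q r U V" and \<Delta>: "\<alpha> * \<delta> - \<beta> * \<gamma> \<noteq> 0"
  obtains U' V' where "dual_frame p (\<alpha> *s q + \<beta> *s r) (\<gamma> *s q + \<delta> *s r) U' V'"
proof -
  define D where "D = \<alpha> * \<delta> - \<beta> * \<gamma>"
  have D: "D \<noteq> 0" using \<Delta> by (simp add: D_def)
  define U' where "U' = (\<delta> / D) *s U - (\<gamma> / D) *s V"
  define V' where "V' = (\<alpha> / D) *s V - (\<beta> / D) *s U"
  have 1: "\<delta> / D * \<alpha> - \<gamma> / D * \<beta> = 1" "\<alpha> / D * \<delta> - \<beta> / D * \<gamma> = 1"
  proof -
    have "\<delta> / D * \<alpha> - \<gamma> / D * \<beta> = (\<alpha> * \<delta> - \<beta> * \<gamma>) / D"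
      "\<alpha> / D * \<delta> - \<beta> / D * \<gamma> = (\<alpha> * \<delta> - \<beta> * \<gamma>) / D"
      by (simp_all add: diff_divide_distrib mult.commute)
    then have "\<delta> / D * \<alpha> - \<gamma> / D * \<beta> = D / D" "\<alpha> / D * \<delta> - \<beta> / D * \<gamma> = D / D"
      unfolding D_def .
    then show "\<delta> / D * \<alpha> - \<gamma> / D * \<beta> = 1" "\<alpha> / D * \<delta> - \<beta> / D * \<gamma> = 1" using D by simp_all
  qed
  have "a = dot3 a (\<alpha> *s q + \<beta> *s r) *s U' + dot3 a (\<gamma> *s q + \<delta> *s r) *s V'"
    if "dot3 a p = 0" for a
  proof -
    have a: "a = dot3 a q *s U + dot3 a r *s V" using fr that by (auto simp: dual_frame_def)
    have "dot3 a (\<alpha> *s q + \<beta> *s r) *s U' + dot3 a (\<gamma> *s q + \<delta> *s r) *s V' =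
        (dot3 a q * (\<delta> / D * \<alpha> - \<gamma> / D * \<beta>)) *s U + (dot3 a r * (\<alpha> / D * \<delta> - \<beta> / D * \<gamma>)) *s V"
      by (simp add: U'_def V'_def vec_eq_iff algebra_simps)
    also have "\<dots> = a" unfolding 1 using a by simp
    finally show ?thesis by simp
  qed
  then show thesis using fr 1 that[of U' V'] D
    by (simp add: dual_frame_def U'_def V'_def algebra_simps)
qed

lemma subst3_homogeneous:
  assumes "complex_algebra \<phi>" "homogeneous n g"
  shows "subst3 \<phi> (\<lambda>j. \<phi> (p $ j) * x) g = \<phi> (eval3 g p) * x ^ n"
proof -
  interpret complex_algebra \<phi> by fact
  have pow: "\<phi> (a ^ k) = \<phi> a ^ k" for a k by (induction k) (simp_all add: phi_1 phi_mult)
  have phi_prod: "\<phi> (\<Prod>i\<in>A. h i) = (\<Prod>i\<in>A. \<phi> (h i))" for A :: "3 set" and h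
    by (induction A rule: infinite_finite_induct) (simp_all add: phi_1 phi_mult)
  show ?thesis using assms(2)
  proof (induction rule: homogeneous_induct)
    case (single m c)
    have "x ^ n = (\<Prod>i\<in>UNIV. x ^ Poly_Mapping.lookup m i)"
      by (simp add: total_deg_def power_sum flip: single)
    moreover have "\<phi> (\<Prod>i\<in>UNIV. p $ i ^ Poly_Mapping.lookup m i) =
        (\<Prod>i\<in>UNIV. \<phi> (p $ i) ^ Poly_Mapping.lookup m i)"
      by (simp add: phi_prod pow)
    ultimately show ?case
      by (simp add: subst3_single eval3_def ev.subst3_single phi_mult power_mult_distrib
          prod.distrib)
  qed (simp_all add: subst3_add phi_0 phi_add distrib_right)
qed

lemma eval3_scale: "homogeneous n g \<Longrightarrow> eval3 g (c *s p) = c ^ n * eval3 g p"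
proof -
  assume "homogeneous n g"
  moreover have "vec_nth (c *s p) = (\<lambda>j. p $ j * c)" by (auto simp: mult.commute)
  ultimately show ?thesis
    using subst3_homogeneous[OF ev.complex_algebra_axioms, of n g p c]
    by (simp add: eval3_def mult.commute)
qed

lemma cst_mult: "cst (a * b) = cst a * cst b"
  by (simp add: mult_single)

lemma lin_lincomb: "lin (c *s a + d *s b) = cst c * lin a + cst d * lin b"
  by (simp add: lin_def sum_3 algebra_simps single_add cst_mult del: mult_single)

lemma complex_algebra_cst: "complex_algebra cst"
  by unfold_locales (simp_all add: single_add mult_single)

text \<open>A form vanishing at \<open>p\<close> lies in the ideal of the point: replacing every variable by the
  corresponding coordinate of \<open>p\<close> times one variable that does not vanish at \<open>p\<close> changes a
  polynomial only modulo this ideal, and turns a form into a multiple of its value.\<close>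

lemma decompose_at_point:
  assumes fr: "dual_frame p q r U V" and g: "homogeneous n g" "eval3 g p = 0"
  obtains a b where "homogeneous (n - 1) a" "homogeneous (n - 1) b" "g = lin U * a + lin V * b"
    "n = 0 \<longrightarrow> a = 0 \<and> b = 0"
proof -
  define I where "I = {lin U * a + lin V * b |a b. True}"
  have mem: "lin U * a + lin V * b \<in> I" for a b by (auto simp: I_def)
  have I: "is_ideal I" unfolding is_ideal_def
  proof (intro conjI ballI allI)
    show "0 \<in> I" using mem[of 0 0] by simp
  next
    fix x y assume "x \<in> I" "y \<in> I"
    then obtain a b a' b' where "x = lin U * a + lin V * b" "y = lin U * a' + lin V * b'"
      by (auto simp: I_def)
    then have "x + y = lin U * (a + a') + lin V * (b + b')" by (simp add: algebra_simps)
    then show "x + y \<in> I" using mem by metis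
  next
    fix s x assume "x \<in> I"
    then obtain a b where "x = lin U * a + lin V * b" by (auto simp: I_def)
    then have "s * x = lin U * (s * a) + lin V * (s * b)" by (simp add: algebra_simps)
    then show "s * x \<in> I" using mem by metis
  qed
  have linI: "lin a \<in> I" if "dot3 a p = 0" for a
  proof -
    have "a = dot3 a q *s U + dot3 a r *s V" using fr that by (auto simp: dual_frame_def)
    then have "lin a = lin U * cst (dot3 a q) + lin V * cst (dot3 a r)"
      using lin_lincomb[of "dot3 a q" U "dot3 a r" V] by (simp add: mult.commute)
    then show ?thesis using mem by simp
  qed
  obtain k where k: "p $ k \<noteq> 0" using fr by (auto simp: dual_frame_def vec_eq_iff)
  define t where "t = inverse (p $ k) *s p"
  have tk: "t $ k = 1" using k by (simp add: t_def)
  \<comment> \<open>\<open>t\<close> is the multiple of \<open>p\<close> with \<open>k\<close>-th coordinate \<open>1\<close>.\<close>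
  define \<psi> where "\<psi> = subst3 cst (\<lambda>j. cst (t $ j) * var k)"
  interpret cs: complex_algebra cst by (rule complex_algebra_cst)
  have var: "var j - cst (t $ j) * var k \<in> I" for j
  proof -
    have lin_axis: "lin (axis i 1) = var i" for i
    proof -
      have "cst (axis i 1 $ l) * var l = (if l = i then var l else 0)" for l
        by (simp add: axis_def)
      then show ?thesis by (simp add: lin_def)
    qed
    have "var j - cst (t $ j) * var k = lin (1 *s axis j 1 + (- t $ j) *s axis k 1)"
      unfolding lin_lincomb lin_axis by (simp add: single_uminus)
    moreover have "dot3 (1 *s axis j 1 + (- t $ j) *s axis k 1) p = 0"
    proof -
      have "dot3 (axis i 1) p = p $ i" for i
      proof -
        have "axis i 1 $ l * p $ l = (if l = i then p $ l else 0)" for l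
          by (simp add: axis_def)
        then show ?thesis by (simp add: dot3_def)
      qed
      then show ?thesis using k by (simp add: t_def)
    qed
    ultimately show ?thesis using linI by simp
  qed
  have "h - \<psi> h \<in> I" for h
  proof (induction h rule: cpoly3_induct)
    case (cst c)
    show ?case by (simp add: \<psi>_def is_idealD[OF I])
  next
    case (var i)
    show ?case using \<open>\<And>j. var j - cst (t $ j) * var k \<in> I\<close> by (simp add: \<psi>_def)
  next
    case (add f g)
    have "f + g - \<psi> (f + g) = (f - \<psi> f) + (g - \<psi> g)" by (simp add: \<psi>_def cs.subst3_add)
    then show ?case using is_idealD(2)[OF I add] by (simp only:)
  next
    case (mult f g)
    have "f * g - \<psi> (f * g) = f * (g - \<psi> g) + \<psi> g * (f - \<psi> f)"
      by (simp add: \<psi>_def cs.subst3_mult algebra_simps)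
    then show ?case using is_idealD(2,3)[OF I] mult by metis
  qed
  moreover have "\<psi> g = 0"
    unfolding \<psi>_def subst3_homogeneous[OF complex_algebra_cst g(1)]
    by (simp add: t_def eval3_scale[OF g(1)] g(2))
  ultimately have "g \<in> I" by (metis diff_zero)
  then obtain a b where ab: "g = lin U * a + lin V * b" by (auto simp: I_def)
  have "g = hom_part n g" using hom_part_homogeneous[OF g(1), of n] by simp
  also have "\<dots> = lin U * (if n = 0 then 0 else hom_part (n - 1) a)
      + lin V * (if n = 0 then 0 else hom_part (n - 1) b)"
    using hom_part_mult[OF homogeneous_lin, of n U a] hom_part_mult[OF homogeneous_lin, of n V b]
    by (auto simp: ab hom_part_add)
  finally show thesis using that[of "if n = 0 then 0 else hom_part (n - 1) a"
      "if n = 0 then 0 else hom_part (n - 1) b"] by auto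
qed

text \<open>Tangency to \<open>V = 0\<close> means that the coefficient of \<open>lin U\<close> vanishes at \<open>p\<close> and decomposes once more.
  For a line this coefficient is a constant, hence zero; this is the case \<open>\<beta> = 0\<close>.\<close>

lemma decompose_tangent:
  assumes fr: "dual_frame p q r U V" and g: "homogeneous n g" "eval3 g p = 0"
    "eval3 (dir_deriv q g) p = 0"
  obtains \<alpha> \<beta> where "homogeneous (n - 1) \<alpha>" "\<beta> = 0 \<or> 2 \<le> n \<and> homogeneous (n - 2) \<beta>"
    "g = lin V * \<alpha> + (lin U)\<^sup>2 * \<beta>"
proof -
  obtain a b where ab: "homogeneous (n - 1) a" "homogeneous (n - 1) b" "g = lin U * a + lin V * b"
    "n = 0 \<longrightarrow> a = 0 \<and> b = 0"
    by (rule decompose_at_point[OF fr g(1,2)])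
  have "eval3 a p = 0"
    using g(3) fr by (simp add: ab dir_deriv_add dir_deriv_mult dual_frame_def)
  then obtain c d where cd: "homogeneous (n - 1 - 1) c" "homogeneous (n - 1 - 1) d"
    "a = lin U * c + lin V * d" "n - 1 = 0 \<longrightarrow> c = 0 \<and> d = 0"
    using decompose_at_point[OF fr ab(1)] by metis
  have "homogeneous (n - 1) (b + lin U * d)"
  proof (cases "n - 1 = 0")
    case False
    then have "Suc 0 + (n - 1 - 1) = n - 1" by simp
    then have "homogeneous (n - 1) (lin U * d)"
      using homogeneous_mult[OF homogeneous_lin cd(2), of U] by metis
    then show ?thesis by (rule homogeneous_add[OF ab(2)])
  qed (use ab(2) cd(4) in simp)
  moreover have "g = lin V * (b + lin U * d) + (lin U)\<^sup>2 * c"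
    by (simp add: ab(3) cd(3) algebra_simps power2_eq_square)
  moreover have "c = 0 \<or> 2 \<le> n \<and> homogeneous (n - 2) c"
  proof (cases "n - 1 = 0")
    case False
    then show ?thesis using cd(1) by (simp add: numeral_2_eq_2)
  qed (use cd(4) in simp)
  ultimately show thesis using that by blast
qed

subsection \<open>Localising an ideal\<close>

text \<open>The polynomials that lie in the extension of \<open>J\<close> to the local ring of \<open>\<complex>\<^sup>3\<close> at \<open>p\<close>.\<close>

definition local_ideal :: "cpoly3 set \<Rightarrow> complex^3 \<Rightarrow> cpoly3 set" where
  "local_ideal J p = {g. \<exists>h. eval3 h p \<noteq> 0 \<and> h * g \<in> J}"

lemma is_ideal_local:
  assumes J: "is_ideal J" shows "is_ideal (local_ideal J p)"
  unfolding is_ideal_def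
proof (intro conjI ballI allI)
  show "0 \<in> local_ideal J p"
    using is_idealD(1)[OF J] by (auto simp: local_ideal_def intro: exI[of _ 1])
next
  fix a b assume "a \<in> local_ideal J p" "b \<in> local_ideal J p"
  then obtain h k where h: "eval3 h p \<noteq> 0" "h * a \<in> J" "eval3 k p \<noteq> 0" "k * b \<in> J"
    by (auto simp: local_ideal_def)
  have "h * k * (a + b) = k * (h * a) + h * (k * b)" by (simp add: algebra_simps)
  also have "\<dots> \<in> J" by (rule is_idealD(2)[OF J is_idealD(3)[OF J h(2)] is_idealD(3)[OF J h(4)]])
  finally show "a + b \<in> local_ideal J p"
    using h by (auto simp: local_ideal_def intro!: exI[of _ "h * k"])
next
  fix s a assume "a \<in> local_ideal J p"
  then obtain h where h: "eval3 h p \<noteq> 0" "h * a \<in> J" by (auto simp: local_ideal_def)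
  have "h * (s * a) \<in> J" using is_idealD(3)[OF J h(2), of s] by (simp add: algebra_simps)
  then show "s * a \<in> local_ideal J p" using h(1) unfolding local_ideal_def by blast
qed

lemma local_ideal_superset: "g \<in> J \<Longrightarrow> g \<in> local_ideal J p"
  by (auto simp: local_ideal_def intro: exI[of _ 1])

lemma local_ideal_cancel:
  assumes "eval3 h p \<noteq> 0" "h * g \<in> local_ideal J p"
  shows "g \<in> local_ideal J p"
proof -
  obtain k where "eval3 k p \<noteq> 0" "k * (h * g) \<in> J" using assms(2) by (auto simp: local_ideal_def)
  then have "eval3 (k * h) p \<noteq> 0" "(k * h) * g \<in> J" using assms(1) by (simp_all add: mult.assoc)
  then show ?thesis unfolding local_ideal_def by blast
qed

lemma local_ideal_cramer:
  assumes J: "is_ideal J"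
    and 1: "x * a + y * b \<in> local_ideal J p" and 2: "z * a + w * b \<in> local_ideal J p"
    and det: "eval3 x p * eval3 w p - eval3 y p * eval3 z p \<noteq> 0"
  shows "a \<in> local_ideal J p" "b \<in> local_ideal J p"
proof -
  note I = is_idealD[OF is_ideal_local[OF J, of p]]
  have D: "eval3 (x * w - y * z) p \<noteq> 0" using det by simp
  have "(x * w - y * z) * a = w * (x * a + y * b) - y * (z * a + w * b)"
    by (simp add: algebra_simps)
  also have "\<dots> \<in> local_ideal J p" by (rule I(6)[OF I(3)[OF 1] I(3)[OF 2]])
  finally show "a \<in> local_ideal J p" by (rule local_ideal_cancel[OF D])
  have "(x * w - y * z) * b = x * (z * a + w * b) - z * (x * a + y * b)"
    by (simp add: algebra_simps)
  also have "\<dots> \<in> local_ideal J p" by (rule I(6)[OF I(3)[OF 2] I(3)[OF 1]])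
  finally show "b \<in> local_ideal J p" by (rule local_ideal_cancel[OF D])
qed

lemma dir_deriv_in_jacobian: "dir_deriv w f \<in> jacobian_ideal f"
  by (auto simp: dir_deriv_def jacobian_ideal_def)

subsection \<open>Membership in the Jacobian ideal as linear conditions\<close>

text \<open>\<open>n\<close> linear conditions on forms of degree \<open>j\<close> suffice for membership in the Jacobian ideal
  near \<open>p\<close>; the least such \<open>n\<close> is at most the Tjurina number of \<open>f\<close> at \<open>p\<close>.\<close>

definition local_conditions :: "cpoly3 \<Rightarrow> complex^3 \<Rightarrow> nat \<Rightarrow> nat \<Rightarrow> bool" where
  "local_conditions f p j n \<longleftrightarrow> (\<exists>\<Phi>. finite \<Phi> \<and> card \<Phi> \<le> n \<and> (\<forall>\<phi>\<in>\<Phi>. functional \<phi>) \<and>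
     (\<forall>g. homogeneous j g \<longrightarrow> (\<forall>\<phi>\<in>\<Phi>. \<phi> g = 0) \<longrightarrow> g \<in> local_ideal (jacobian_ideal f) p))"

lemma local_conditionsI:
  assumes "\<And>\<phi>. \<phi> \<in> set \<phi>s \<Longrightarrow> functional \<phi>" "length \<phi>s \<le> n"
    "\<And>g. homogeneous j g \<Longrightarrow> \<forall>\<phi>\<in>set \<phi>s. \<phi> g = 0 \<Longrightarrow> g \<in> local_ideal (jacobian_ideal f) p"
  shows "local_conditions f p j n"
  unfolding local_conditions_def
  by (intro exI[of _ "set \<phi>s"]) (use assms card_length[of \<phi>s] in auto)

lemma functional_simps:
  "functional (\<lambda>g. eval3 g p)" "functional (\<lambda>g. eval3 (dir_deriv w g) p)"
  "functional (\<lambda>g. eval3 (dir_deriv w (dir_deriv w' g)) p)"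
  by (simp_all add: functional_def dir_deriv_add dir_deriv_scale)

lemma functional_diff:
  "functional \<phi> \<Longrightarrow> functional \<psi> \<Longrightarrow> functional (\<lambda>g. \<phi> g - \<psi> g)"
  by (simp add: functional_def algebra_simps)

lemma functional_scale: "functional \<phi> \<Longrightarrow> functional (\<lambda>g. a * \<phi> g)"
  by (simp add: functional_def algebra_simps)

text \<open>The derivatives of \<open>f\<close> along \<open>q\<close> and \<open>r\<close> are combinations of \<open>u = lin U\<close> and \<open>v = lin V\<close> whose
  determinant at \<open>p\<close> is \<open>4 A C - B\<^sup>2\<close>. By Cramer's rule \<open>u\<close> and \<open>v\<close> lie in the local ideal, and with them
  every form that vanishes at \<open>p\<close>.\<close>

lemma local_conditions_node:
  assumes fr: "dual_frame p q r U V"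
    and f: "f = (lin U)\<^sup>2 * A + lin U * lin V * B + (lin V)\<^sup>2 * C"
    and disc: "(eval3 B p)\<^sup>2 \<noteq> 4 * eval3 A p * eval3 C p"
  shows "local_conditions f p j 1"
proof (rule local_conditionsI[of "[\<lambda>g. eval3 g p]"])
  let ?u = "lin U" and ?v = "lin V"
  let ?I = "local_ideal (jacobian_ideal f) p"
  note I = is_idealD[OF is_ideal_local[OF is_ideal_jacobian, of f p]]
  have U: "dot3 U p = 0" "dot3 V p = 0" "dot3 U q = 1" "dot3 U r = 0" "dot3 V q = 0" "dot3 V r = 1"
    using fr by (auto simp: dual_frame_def)
  have Dq: "dir_deriv q f = (2 * A + ?u * dir_deriv q A + ?v * dir_deriv q B) * ?u + (B + ?v * dir_deriv q C) * ?v"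
    by (simp add: f dir_deriv_add dir_deriv_mult power2_eq_square U algebra_simps)
  have Dr: "dir_deriv r f = (B + ?u * dir_deriv r A) * ?u + (2 * C + ?u * dir_deriv r B + ?v * dir_deriv r C) * ?v"
    by (simp add: f dir_deriv_add dir_deriv_mult power2_eq_square U algebra_simps)
  have 1: "(2 * A + ?u * dir_deriv q A + ?v * dir_deriv q B) * ?u + (B + ?v * dir_deriv q C) * ?v \<in> ?I"
    unfolding Dq[symmetric] by (rule local_ideal_superset[OF dir_deriv_in_jacobian])
  have 2: "(B + ?u * dir_deriv r A) * ?u + (2 * C + ?u * dir_deriv r B + ?v * dir_deriv r C) * ?v \<in> ?I"
    unfolding Dr[symmetric] by (rule local_ideal_superset[OF dir_deriv_in_jacobian])
  have uv: "?u \<in> ?I" "?v \<in> ?I"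
    by (rule local_ideal_cramer[OF is_ideal_jacobian 1 2];
        use disc in \<open>simp add: U power2_eq_square algebra_simps\<close>)+
  fix g assume g: "homogeneous j g" and \<phi>: "\<forall>\<phi>\<in>set [\<lambda>g. eval3 g p]. \<phi> g = 0"
  have "eval3 g p = 0" using \<phi> by simp
  then obtain a b where "g = ?u * a + ?v * b" by (rule decompose_at_point[OF fr g])
  then show "g \<in> ?I" using uv I(2,4) by simp
qed (auto simp: functional_simps)

text \<open>Give \<open>u = lin U\<close> weight \<open>1\<close> and \<open>v = lin V\<close> weight \<open>2\<close>; then \<open>f\<close> begins with a form of weight \<open>4\<close>, whose
  two factors are distinct by the condition on the discriminant. The derivative along \<open>r\<close> begins
  with \<open>2 A v + B u\<^sup>2\<close> and eliminates \<open>v\<close>; what the derivative along \<open>q\<close> leaves is \<open>u\<^sup>3\<close> times a polynomial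
  with the value \<open>4 A (4 A C - B\<^sup>2)\<close> at \<open>p\<close>. So the local ideal contains \<open>u\<^sup>3\<close>, \<open>u v\<close> and one
  combination of \<open>v\<close> and \<open>u\<^sup>2\<close>, and a form belongs to it if its coefficients of \<open>1\<close> and \<open>u\<close> vanish and
  those of \<open>v\<close> and \<open>u\<^sup>2\<close> are in the right proportion.\<close>

lemma local_conditions_tacnode:
  assumes fr: "dual_frame p q r U V" and hom: "homogeneous (Suc e) A" "homogeneous e B"
    and f: "f = (lin V)\<^sup>2 * A + lin V * (lin U)\<^sup>2 * B + (lin U) ^ 4 * C"
    and A: "eval3 A p \<noteq> 0" and disc: "(eval3 B p)\<^sup>2 \<noteq> 4 * eval3 A p * eval3 C p"
    and "2 \<le> j"
  shows "local_conditions f p j 3"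
proof (rule local_conditionsI[of "[\<lambda>g. eval3 g p, \<lambda>g. eval3 (dir_deriv q g) p,
    \<lambda>g. eval3 A p * eval3 (dir_deriv q (dir_deriv q g)) p - eval3 B p * eval3 (dir_deriv r g) p]"])
  let ?u = "lin U" and ?v = "lin V"
  let ?I = "local_ideal (jacobian_ideal f) p"
  note I = is_idealD[OF is_ideal_local[OF is_ideal_jacobian, of f p]]
  have U: "dot3 U p = 0" "dot3 V p = 0" "dot3 U q = 1" "dot3 U r = 0" "dot3 V q = 0" "dot3 V r = 1"
    using fr by (auto simp: dual_frame_def)
  define \<alpha> where "\<alpha> = 2 * A + ?v * dir_deriv r A + ?u\<^sup>2 * dir_deriv r B"
  define \<beta> where "\<beta> = B + ?u\<^sup>2 * dir_deriv r C"
  define \<gamma> where "\<gamma> = 2 * B + ?u * dir_deriv q B"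
  define \<delta> where "\<delta> = 4 * C + ?u * dir_deriv q C"
  define \<epsilon> where "\<epsilon> = dir_deriv q A"
  have ev: "eval3 \<alpha> p = 2 * eval3 A p" "eval3 \<beta> p = eval3 B p" "eval3 \<gamma> p = 2 * eval3 B p"
    "eval3 \<delta> p = 4 * eval3 C p"
    by (simp_all add: \<alpha>_def \<beta>_def \<gamma>_def \<delta>_def U)
  have \<alpha>: "eval3 \<alpha> p \<noteq> 0" using A by (simp add: ev)
  have u4: "dir_deriv w (?u ^ 4) = 4 * ?u ^ 3 * cst (dot3 U w)" for w
    by (simp add: numeral_eq_Suc dir_deriv_mult algebra_simps)
  have Dr: "dir_deriv r f = ?v * \<alpha> + ?u\<^sup>2 * \<beta>"
    by (simp add: f \<alpha>_def \<beta>_def dir_deriv_add dir_deriv_mult u4 dir_deriv_power2 U algebra_simps)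
      (simp add: power2_eq_square numeral_eq_Suc algebra_simps)
  have Dq: "dir_deriv q f = ?u * ?v * \<gamma> + ?v\<^sup>2 * \<epsilon> + ?u ^ 3 * \<delta>"
    by (simp add: f \<gamma>_def \<delta>_def \<epsilon>_def dir_deriv_add dir_deriv_mult u4 dir_deriv_power2 U algebra_simps)
      (simp add: power2_eq_square numeral_eq_Suc algebra_simps)
  have r: "?v * \<alpha> + ?u\<^sup>2 * \<beta> \<in> ?I"
    unfolding Dr[symmetric] by (rule local_ideal_superset[OF dir_deriv_in_jacobian])
  have q: "?u * ?v * \<gamma> + ?v\<^sup>2 * \<epsilon> + ?u ^ 3 * \<delta> \<in> ?I"
    unfolding Dq[symmetric] by (rule local_ideal_superset[OF dir_deriv_in_jacobian])
  have u3: "?u ^ 3 \<in> ?I"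
  proof (rule local_ideal_cancel)
    have "(\<alpha>\<^sup>2 * \<delta> - \<alpha> * \<beta> * \<gamma> + ?u * \<beta>\<^sup>2 * \<epsilon>) * ?u ^ 3 =
        \<alpha>\<^sup>2 * (?u * ?v * \<gamma> + ?v\<^sup>2 * \<epsilon> + ?u ^ 3 * \<delta>)
        - (\<alpha> * ?u * \<gamma> + \<epsilon> * (?v * \<alpha> + ?u\<^sup>2 * \<beta> - 2 * ?u\<^sup>2 * \<beta>)) * (?v * \<alpha> + ?u\<^sup>2 * \<beta>)"
      by (simp add: power2_eq_square power3_eq_cube algebra_simps)
    also have "\<dots> \<in> ?I" by (rule I(6)[OF I(3)[OF q] I(3)[OF r]])
    finally show "(\<alpha>\<^sup>2 * \<delta> - \<alpha> * \<beta> * \<gamma> + ?u * \<beta>\<^sup>2 * \<epsilon>) * ?u ^ 3 \<in> ?I" .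
    have "eval3 (\<alpha>\<^sup>2 * \<delta> - \<alpha> * \<beta> * \<gamma> + ?u * \<beta>\<^sup>2 * \<epsilon>) p =
        4 * eval3 A p * (4 * eval3 A p * eval3 C p - (eval3 B p)\<^sup>2)"
      by (simp add: ev U power2_eq_square algebra_simps)
    then show "eval3 (\<alpha>\<^sup>2 * \<delta> - \<alpha> * \<beta> * \<gamma> + ?u * \<beta>\<^sup>2 * \<epsilon>) p \<noteq> 0" using A disc by simp
  qed
  have uv: "?u * ?v \<in> ?I"
  proof (rule local_ideal_cancel[OF \<alpha>])
    have "\<alpha> * (?u * ?v) = ?u * (?v * \<alpha> + ?u\<^sup>2 * \<beta>) - \<beta> * ?u ^ 3"
      by (simp add: power2_eq_square power3_eq_cube algebra_simps)
    also have "\<dots> \<in> ?I" by (rule I(6)[OF I(3)[OF r] I(3)[OF u3]])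
    finally show "\<alpha> * (?u * ?v) \<in> ?I" .
  qed
  fix g assume g: "homogeneous j g" and \<phi>: "\<forall>\<phi>\<in>set [\<lambda>g. eval3 g p, \<lambda>g. eval3 (dir_deriv q g) p,
    \<lambda>g. eval3 A p * eval3 (dir_deriv q (dir_deriv q g)) p - eval3 B p * eval3 (dir_deriv r g) p]. \<phi> g = 0"
  have 0: "eval3 g p = 0" "eval3 (dir_deriv q g) p = 0"
    "eval3 A p * eval3 (dir_deriv q (dir_deriv q g)) p - eval3 B p * eval3 (dir_deriv r g) p = 0"
    using \<phi> by simp_all
  obtain b a where ab: "homogeneous (j - 1) b" "a = 0 \<or> 2 \<le> j \<and> homogeneous (j - 2) a"
    "g = ?v * b + ?u\<^sup>2 * a"
    by (rule decompose_tangent[OF fr g 0(1,2)])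
  have "homogeneous (j - 2) a" using ab(2) by auto
  have "eval3 (dir_deriv q (dir_deriv q g)) p = 2 * eval3 a p" "eval3 (dir_deriv r g) p = eval3 b p"
    by (simp_all add: ab(3) dir_deriv_add dir_deriv_mult power2_eq_square U)
  then have zero: "eval3 (cst 2 * A * a - B * b) p = 0" using 0(3) by (simp add: mult_ac)
  have "homogeneous (e + (j - 1)) (cst 2 * A * a - B * b)"
  proof -
    have "homogeneous (Suc e + (j - 2)) (cst 2 * A * a)"
      by (intro homogeneous_mult homogeneous_scale hom) fact
    moreover have "Suc e + (j - 2) = e + (j - 1)" using \<open>2 \<le> j\<close> by simp
    ultimately have "homogeneous (e + (j - 1)) (cst 2 * A * a)" by (simp only:)
    moreover have "homogeneous (e + (j - 1)) (cst (- 1) * (B * b))"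
      by (intro homogeneous_mult homogeneous_scale hom ab)
    ultimately have "homogeneous (e + (j - 1)) (cst 2 * A * a + cst (- 1) * (B * b))"
      by (rule homogeneous_add)
    moreover have "cst 2 * A * a + cst (- 1) * (B * b) = cst 2 * A * a - B * b"
      by (simp add: single_uminus)
    ultimately show ?thesis by (simp only:)
  qed
  then obtain c d where cd: "cst 2 * A * a - B * b = ?u * c + ?v * d"
    using decompose_at_point[OF fr _ zero] by metis
  show "g \<in> ?I"
  proof (rule local_ideal_cancel[OF \<alpha>])
    have "\<alpha> * g = b * (?v * \<alpha> + ?u\<^sup>2 * \<beta>) + ?u\<^sup>2 * (cst 2 * A * a - B * b)
        + ?u * ?v * (?u * dir_deriv r A * a) + ?u ^ 3 * (?u * (dir_deriv r B * a - dir_deriv r C * b))"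
      by (simp add: ab(3) \<alpha>_def \<beta>_def power2_eq_square power3_eq_cube algebra_simps)
    also have "\<dots> = b * (?v * \<alpha> + ?u\<^sup>2 * \<beta>) + ?u * ?v * (?u * d + ?u * dir_deriv r A * a)
        + ?u ^ 3 * (c + ?u * (dir_deriv r B * a - dir_deriv r C * b))"
      unfolding cd by (simp add: power2_eq_square power3_eq_cube algebra_simps)
    also have "\<dots> \<in> ?I" by (intro I(2) I(3)[OF r] I(4)[OF uv] I(4)[OF u3])
    finally show "\<alpha> * g \<in> ?I" .
  qed
qed (auto simp: functional_simps intro!: functional_diff functional_scale)

text \<open>Here \<open>u = lin U\<close> and \<open>v = lin V\<close> are two of the three tangents. The derivatives of \<open>f\<close> begin with the
  quadratic forms \<open>2 B u v + C v\<^sup>2\<close> and \<open>B u\<^sup>2 + 2 C u v\<close>. Multiplied by \<open>u\<close> and \<open>v\<close> they produce all four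
  cubic monomials, up to units, and modulo these they identify the three quadratic monomials with
  multiples of \<open>u v\<close>. So membership requires the coefficients of \<open>1\<close>, \<open>u\<close>, \<open>v\<close> to vanish, and one
  relation between the quadratic ones.\<close>

lemma local_conditions_triple_point:
  assumes fr: "dual_frame p q r U V"
    and hom: "homogeneous e A" "homogeneous e B" "homogeneous e C" "homogeneous e D"
    and f: "f = (lin U) ^ 3 * A + (lin U)\<^sup>2 * lin V * B + lin U * (lin V)\<^sup>2 * C + (lin V) ^ 3 * D"
    and 0: "eval3 A p = 0" "eval3 D p = 0" and BC: "eval3 B p \<noteq> 0" "eval3 C p \<noteq> 0"
    and "2 \<le> j"
  shows "local_conditions f p j 4"
proof (rule local_conditionsI[of "[\<lambda>g. eval3 g p, \<lambda>g. eval3 (dir_deriv q g) p, \<lambda>g. eval3 (dir_deriv r g) p,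
    \<lambda>g. eval3 B p * eval3 C p * eval3 (dir_deriv q (dir_deriv r g)) p
      - (eval3 C p)\<^sup>2 * eval3 (dir_deriv q (dir_deriv q g)) p
      - (eval3 B p)\<^sup>2 * eval3 (dir_deriv r (dir_deriv r g)) p]"])
  let ?u = "lin U" and ?v = "lin V"
  let ?I = "local_ideal (jacobian_ideal f) p"
  note I = is_idealD[OF is_ideal_local[OF is_ideal_jacobian, of f p]]
  have U: "dot3 U p = 0" "dot3 V p = 0" "dot3 U q = 1" "dot3 U r = 0" "dot3 V q = 0" "dot3 V r = 1"
    using fr by (auto simp: dual_frame_def)
  define a1 where "a1 = 3 * A + ?u * dir_deriv q A"
  define b1 where "b1 = 2 * B + ?u * dir_deriv q B"
  define c1 where "c1 = C + ?u * dir_deriv q C + ?v * dir_deriv q D"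
  define a2 where "a2 = B + ?u * dir_deriv r A + ?v * dir_deriv r B"
  define b2 where "b2 = 2 * C + ?v * dir_deriv r C"
  define c2 where "c2 = 3 * D + ?v * dir_deriv r D"
  have ev: "eval3 a1 p = 0" "eval3 b1 p = 2 * eval3 B p" "eval3 c1 p = eval3 C p"
    "eval3 a2 p = eval3 B p" "eval3 b2 p = 2 * eval3 C p" "eval3 c2 p = 0"
    by (simp_all add: a1_def b1_def c1_def a2_def b2_def c2_def U 0)
  have Dq: "dir_deriv q f = ?u\<^sup>2 * a1 + ?u * ?v * b1 + ?v\<^sup>2 * c1"
    by (simp add: f a1_def b1_def c1_def dir_deriv_add dir_deriv_mult power2_eq_square power3_eq_cube U
        algebra_simps)
  have Dr: "dir_deriv r f = ?u\<^sup>2 * a2 + ?u * ?v * b2 + ?v\<^sup>2 * c2"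
    by (simp add: f a2_def b2_def c2_def dir_deriv_add dir_deriv_mult power2_eq_square power3_eq_cube U
        algebra_simps)
  have q: "?u\<^sup>2 * a1 + ?u * ?v * b1 + ?v\<^sup>2 * c1 \<in> ?I"
    unfolding Dq[symmetric] by (rule local_ideal_superset[OF dir_deriv_in_jacobian])
  have r: "?u\<^sup>2 * a2 + ?u * ?v * b2 + ?v\<^sup>2 * c2 \<in> ?I"
    unfolding Dr[symmetric] by (rule local_ideal_superset[OF dir_deriv_in_jacobian])
  have 1: "(a2 * b1 - a1 * b2) * (?u\<^sup>2 * ?v) + (a2 * c1 - a1 * c2) * (?u * ?v\<^sup>2) \<in> ?I"
  proof -
    have "(a2 * b1 - a1 * b2) * (?u\<^sup>2 * ?v) + (a2 * c1 - a1 * c2) * (?u * ?v\<^sup>2) =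
        (a2 * ?u) * (?u\<^sup>2 * a1 + ?u * ?v * b1 + ?v\<^sup>2 * c1)
        - (a1 * ?u) * (?u\<^sup>2 * a2 + ?u * ?v * b2 + ?v\<^sup>2 * c2)"
      by (simp add: power2_eq_square algebra_simps)
    also have "\<dots> \<in> ?I" by (rule I(6)[OF I(3)[OF q] I(3)[OF r]])
    finally show ?thesis .
  qed
  have 2: "(a2 * c1 - a1 * c2) * (?u\<^sup>2 * ?v) + (b2 * c1 - b1 * c2) * (?u * ?v\<^sup>2) \<in> ?I"
  proof -
    have "(a2 * c1 - a1 * c2) * (?u\<^sup>2 * ?v) + (b2 * c1 - b1 * c2) * (?u * ?v\<^sup>2) =
        (c1 * ?v) * (?u\<^sup>2 * a2 + ?u * ?v * b2 + ?v\<^sup>2 * c2)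
        - (c2 * ?v) * (?u\<^sup>2 * a1 + ?u * ?v * b1 + ?v\<^sup>2 * c1)"
      by (simp add: power2_eq_square algebra_simps)
    also have "\<dots> \<in> ?I" by (rule I(6)[OF I(3)[OF r] I(3)[OF q]])
    finally show ?thesis .
  qed
  have det: "eval3 (a2 * b1 - a1 * b2) p * eval3 (b2 * c1 - b1 * c2) p
      - eval3 (a2 * c1 - a1 * c2) p * eval3 (a2 * c1 - a1 * c2) p \<noteq> 0"
    using BC by (simp add: ev)
  have uuv: "?u\<^sup>2 * ?v \<in> ?I" and uvv: "?u * ?v\<^sup>2 \<in> ?I"
    by (rule local_ideal_cramer[OF is_ideal_jacobian 1 2 det])+
  have u3: "?u ^ 3 \<in> ?I"
  proof (rule local_ideal_cancel)
    have "a2 * ?u ^ 3 = ?u * (?u\<^sup>2 * a2 + ?u * ?v * b2 + ?v\<^sup>2 * c2)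
        - (b2 * (?u\<^sup>2 * ?v) + c2 * (?u * ?v\<^sup>2))"
      by (simp add: power2_eq_square power3_eq_cube algebra_simps)
    also have "\<dots> \<in> ?I" by (rule I(6)[OF I(3)[OF r] I(2)[OF I(3)[OF uuv] I(3)[OF uvv]]])
    finally show "a2 * ?u ^ 3 \<in> ?I" .
  qed (simp add: ev BC)
  have v3: "?v ^ 3 \<in> ?I"
  proof (rule local_ideal_cancel)
    have "c1 * ?v ^ 3 = ?v * (?u\<^sup>2 * a1 + ?u * ?v * b1 + ?v\<^sup>2 * c1)
        - (a1 * (?u\<^sup>2 * ?v) + b1 * (?u * ?v\<^sup>2))"
      by (simp add: power2_eq_square power3_eq_cube algebra_simps)
    also have "\<dots> \<in> ?I" by (rule I(6)[OF I(3)[OF q] I(2)[OF I(3)[OF uuv] I(3)[OF uvv]]])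
    finally show "c1 * ?v ^ 3 \<in> ?I" .
  qed (simp add: ev BC)
  fix g assume g: "homogeneous j g" and \<phi>: "\<forall>\<phi>\<in>set [\<lambda>g. eval3 g p, \<lambda>g. eval3 (dir_deriv q g) p,
    \<lambda>g. eval3 (dir_deriv r g) p,
    \<lambda>g. eval3 B p * eval3 C p * eval3 (dir_deriv q (dir_deriv r g)) p
      - (eval3 C p)\<^sup>2 * eval3 (dir_deriv q (dir_deriv q g)) p
      - (eval3 B p)\<^sup>2 * eval3 (dir_deriv r (dir_deriv r g)) p]. \<phi> g = 0"
  have g0: "eval3 g p = 0" "eval3 (dir_deriv q g) p = 0" "eval3 (dir_deriv r g) p = 0"
    "eval3 B p * eval3 C p * eval3 (dir_deriv q (dir_deriv r g)) p
      - (eval3 C p)\<^sup>2 * eval3 (dir_deriv q (dir_deriv q g)) p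
      - (eval3 B p)\<^sup>2 * eval3 (dir_deriv r (dir_deriv r g)) p = 0"
    using \<phi> by simp_all
  obtain a b where ab: "homogeneous (j - 1) a" "homogeneous (j - 1) b" "g = ?u * a + ?v * b"
    by (rule decompose_at_point[OF fr g g0(1)])
  have "eval3 a p = 0" "eval3 b p = 0"
    using g0(2,3) by (simp_all add: ab(3) dir_deriv_add dir_deriv_mult U)
  then obtain x y' y'' z where xz: "homogeneous (j - 1 - 1) x" "homogeneous (j - 1 - 1) y'"
    "homogeneous (j - 1 - 1) y''" "homogeneous (j - 1 - 1) z"
    "a = ?u * x + ?v * y'" "b = ?u * y'' + ?v * z"
    using decompose_at_point[OF fr ab(1)] decompose_at_point[OF fr ab(2)] by metis
  define y where "y = y' + y''"
  have y: "homogeneous (j - 1 - 1) y" unfolding y_def by (intro homogeneous_add xz)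
  have gxyz: "g = ?u\<^sup>2 * x + ?u * ?v * y + ?v\<^sup>2 * z"
    by (simp add: ab(3) xz(5,6) y_def power2_eq_square algebra_simps)
  have "eval3 (dir_deriv q (dir_deriv q g)) p = 2 * eval3 x p" "eval3 (dir_deriv r (dir_deriv r g)) p = 2 * eval3 z p"
    "eval3 (dir_deriv q (dir_deriv r g)) p = eval3 y p"
    by (simp_all add: gxyz dir_deriv_add dir_deriv_mult power2_eq_square U)
  then have zero: "eval3 (B * C * y + cst (- 2) * (C * C * x) + cst (- 2) * (B * B * z)) p = 0"
    using g0(4) by (simp add: power2_eq_square mult_ac)
  have "homogeneous (e + e + (j - 1 - 1))
      (B * C * y + cst (- 2) * (C * C * x) + cst (- 2) * (B * B * z))"
    by (intro homogeneous_add homogeneous_scale homogeneous_mult hom xz y)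
  then obtain c d where
    cd: "B * C * y + cst (- 2) * (C * C * x) + cst (- 2) * (B * B * z) = ?u * c + ?v * d"
    using decompose_at_point[OF fr _ zero] by metis
  obtain s t where st: "A = ?u * s + ?v * t" using decompose_at_point[OF fr hom(1) 0(1)] by metis
  obtain s' t' where st': "D = ?u * s' + ?v * t'"
    using decompose_at_point[OF fr hom(4) 0(2)] by metis
  \<comment> \<open>Modulo the cubic monomials, \<open>B u\<^sup>2\<close> and \<open>C v\<^sup>2\<close> are multiples of \<open>u v\<close>; here it matters that \<open>A\<close>
    and \<open>D\<close> vanish at \<open>p\<close>.\<close>
  have uu: "?u\<^sup>2 * B + 2 * ?u * ?v * C \<in> ?I"
  proof -
    have "?u\<^sup>2 * B + 2 * ?u * ?v * C = (?u\<^sup>2 * a2 + ?u * ?v * b2 + ?v\<^sup>2 * c2)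
        - ((?u ^ 3 * dir_deriv r A + ?u\<^sup>2 * ?v * dir_deriv r B) + (?u * ?v\<^sup>2 * (dir_deriv r C + 3 * s')
        + ?v ^ 3 * (3 * t' + dir_deriv r D)))"
      by (simp add: a2_def b2_def c2_def st' power2_eq_square power3_eq_cube algebra_simps)
    also have "\<dots> \<in> ?I"
      by (intro I(6)[OF r] I(2) I(4)[OF u3] I(4)[OF uuv] I(4)[OF uvv] I(4)[OF v3])
    finally show ?thesis .
  qed
  have vv: "?v\<^sup>2 * C + 2 * ?u * ?v * B \<in> ?I"
  proof -
    have "?v\<^sup>2 * C + 2 * ?u * ?v * B = (?u\<^sup>2 * a1 + ?u * ?v * b1 + ?v\<^sup>2 * c1)
        - ((?v ^ 3 * dir_deriv q D + ?u * ?v\<^sup>2 * dir_deriv q C) + (?u\<^sup>2 * ?v * (dir_deriv q B + 3 * t)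
        + ?u ^ 3 * (3 * s + dir_deriv q A)))"
      by (simp add: a1_def b1_def c1_def st power2_eq_square power3_eq_cube algebra_simps)
    also have "\<dots> \<in> ?I"
      by (intro I(6)[OF q] I(2) I(4)[OF u3] I(4)[OF uuv] I(4)[OF uvv] I(4)[OF v3])
    finally show ?thesis .
  qed
  show "g \<in> ?I"
  proof (rule local_ideal_cancel)
    have two: "cst (- 2) = - 2" by (simp add: single_uminus)
    have "(B * C) * g = (C * x) * (?u\<^sup>2 * B + 2 * ?u * ?v * C)
        + (B * z) * (?v\<^sup>2 * C + 2 * ?u * ?v * B)
        + ?u * ?v * (B * C * y + cst (- 2) * (C * C * x) + cst (- 2) * (B * B * z))"
      unfolding gxyz two by (simp add: power2_eq_square algebra_simps)
    also have "\<dots> = (C * x) * (?u\<^sup>2 * B + 2 * ?u * ?v * C)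
        + (B * z) * (?v\<^sup>2 * C + 2 * ?u * ?v * B) + (?u\<^sup>2 * ?v * c + ?u * ?v\<^sup>2 * d)"
      unfolding cd by (simp add: power2_eq_square algebra_simps)
    also have "\<dots> \<in> ?I" by (intro I(2) I(3)[OF uu] I(3)[OF vv] I(4)[OF uuv] I(4)[OF uvv])
    finally show "(B * C) * g \<in> ?I" .
  qed (simp add: BC)
next
  fix \<phi> assume "\<phi> \<in> set [\<lambda>g. eval3 g p, \<lambda>g. eval3 (dir_deriv q g) p, \<lambda>g. eval3 (dir_deriv r g) p,
    \<lambda>g. eval3 B p * eval3 C p * eval3 (dir_deriv q (dir_deriv r g)) p
      - (eval3 C p)\<^sup>2 * eval3 (dir_deriv q (dir_deriv q g)) p
      - (eval3 B p)\<^sup>2 * eval3 (dir_deriv r (dir_deriv r g)) p]"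
  then show "functional \<phi>"
    by (auto simp: functional_simps intro!: functional_diff functional_scale)
qed simp

section \<open>Restricting germs to arcs\<close>

text \<open>The substitution of \<open>u(t), v(t)\<close> for the two variables. As \<open>v\<close> will have no constant term, the terms
  with \<open>b > n\<close> do not contribute to the coefficient of \<open>t\<^sup>n\<close>.\<close>

definition arc :: "complex fps \<Rightarrow> complex fps \<Rightarrow> germ \<Rightarrow> complex fps" where
  "arc u v g = Abs_fps (\<lambda>n. fps_nth (\<Sum>b\<le>n. (fps_nth g b oo u) * v ^ b) n)"

lemma fps_nth_mult_power_0:
  fixes v :: "complex fps"
  assumes "fps_nth v 0 = 0" "n < b" shows "fps_nth (x * v ^ b) n = 0"
  unfolding fps_mult_nth
  by (intro sum.neutral) (use assms startsby_zero_power_prefix[of v b] in auto)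

lemma arc_nth:
  assumes "fps_nth v 0 = 0" "n \<le> N"
  shows "fps_nth (arc u v g) n = fps_nth (\<Sum>b\<le>N. (fps_nth g b oo u) * v ^ b) n"
proof -
  have "(\<Sum>b\<le>N. fps_nth ((fps_nth g b oo u) * v ^ b) n) =
      (\<Sum>b\<le>n. fps_nth ((fps_nth g b oo u) * v ^ b) n)"
    by (rule sum.mono_neutral_right)
      (use assms in \<open>auto simp: fps_nth_mult_power_0 not_le\<close>)
  then show ?thesis by (simp add: arc_def fps_sum_nth)
qed

lemma arc_add: "arc u v (g + h) = arc u v g + arc u v h"
  by (rule fps_ext)
    (simp add: arc_def fps_compose_add_distrib distrib_right sum.distrib)

lemma arc_mult:
  assumes u: "fps_nth u 0 = 0" and v: "fps_nth v 0 = 0"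
  shows "arc u v (g * h) = arc u v g * arc u v h"
proof (rule fps_ext)
  fix n
  define G where "G b = fps_nth g b oo u" for b
  define H where "H b = fps_nth h b oo u" for b
  define t where "t i j = fps_nth (G i * H j * v ^ (i + j)) n" for i j
  have "fps_nth (g * h) b oo u = (\<Sum>i\<le>b. G i * H (b - i))" for b
    by (simp add: fps_mult_nth fps_compose_sum_distrib fps_compose_mult_distrib[OF u] G_def H_def
        atLeast0AtMost)
  then have "fps_nth (arc u v (g * h)) n = (\<Sum>b\<le>n. \<Sum>i\<le>b. t i (b - i))"
    by (simp add: arc_def fps_sum_nth sum_distrib_right t_def)
  also have "\<dots> = (\<Sum>(i, j)\<in>{(i, j). i + j \<le> n}. t i j)"
    by (rule sum.triangle_reindex_eq[symmetric])
  also have "\<dots> = (\<Sum>(i, j)\<in>{..n} \<times> {..n}. t i j)"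
  proof (rule sum.mono_neutral_left)
    have "t i j = 0" if "\<not> i + j \<le> n" for i j
      using that by (simp add: t_def fps_nth_mult_power_0[OF v] not_le)
    then show "\<forall>x\<in>{..n} \<times> {..n} - {(i, j). i + j \<le> n}. (case x of (i, j) \<Rightarrow> t i j) = 0"
      by auto
  qed auto
  also have "\<dots> = fps_nth ((\<Sum>i\<le>n. G i * v ^ i) * (\<Sum>j\<le>n. H j * v ^ j)) n"
    by (simp add: sum_product sum.cartesian_product fps_sum_nth t_def power_add mult_ac
        split_beta)
  also have "\<dots> = (\<Sum>k=0..n. fps_nth (arc u v g) k * fps_nth (arc u v h) (n - k))"
    unfolding fps_mult_nth
    by (rule sum.cong) (simp_all add: arc_nth[OF v, of _ n] G_def H_def)
  finally show "fps_nth (arc u v (g * h)) n = fps_nth (arc u v g * arc u v h) n"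
    by (simp add: fps_mult_nth)
qed

lemma arc_const: "arc u v (germ_const c) = fps_const c"
proof (rule fps_ext)
  fix n
  have "(\<Sum>b\<le>n. fps_nth ((fps_nth (germ_const c) b oo u) * v ^ b) n) =
      (\<Sum>b\<le>n. if b = 0 then fps_nth (fps_const c) n else 0)"
    by (rule sum.cong) (auto simp: germ_const_def)
  then show "fps_nth (arc u v (germ_const c)) n = fps_nth (fps_const c) n"
    by (simp add: arc_def fps_sum_nth)
qed

lemma germ_const_1 [simp]: "germ_const 1 = 1"
  by (simp add: germ_const_def)

lemma arc_1 [simp]: "arc u v 1 = 1"
  using arc_const[of u v 1] by simp

lemma arc_X: "fps_nth u 0 = 0 \<Longrightarrow> arc u v (fps_const fps_X) = u"
proof (rule fps_ext)
  fix n assume u: "fps_nth u 0 = 0"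
  have "(\<Sum>b\<le>n. fps_nth ((fps_nth (fps_const fps_X :: germ) b oo u) * v ^ b) n) =
      (\<Sum>b\<le>n. if b = 0 then fps_nth u n else 0)"
    by (rule sum.cong) (auto simp: fps_X_fps_compose_startby0[OF u])
  then show "fps_nth (arc u v (fps_const fps_X)) n = fps_nth u n"
    by (simp add: arc_def fps_sum_nth)
qed

lemma arc_Y: "fps_nth v 0 = 0 \<Longrightarrow> arc u v fps_X = v"
proof (rule fps_ext)
  fix n assume v: "fps_nth v 0 = 0"
  have "(\<Sum>b\<le>Suc n. fps_nth ((fps_nth (fps_X :: germ) b oo u) * v ^ b) n) =
      (\<Sum>b\<le>Suc n. if b = 1 then fps_nth v n else 0)"
    by (rule sum.cong) (auto simp: fps_X_def)
  then show "fps_nth (arc u v fps_X) n = fps_nth v n"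
    using arc_nth[OF v, of n "Suc n"] by (simp add: fps_sum_nth)
qed

lemma arc_prod:
  assumes "fps_nth u 0 = 0" "fps_nth v 0 = 0"
  shows "arc u v (\<Prod>x\<in>A. h x) = (\<Prod>x\<in>A. arc u v (h x))"
  by (induction A rule: infinite_finite_induct) (simp_all add: arc_mult assms)

lemma arc_nth_0: "fps_nth (arc u v g) 0 = germ_coeff g 0 0"
  by (simp add: arc_def germ_coeff_def)

lemma arc_nth_1:
  assumes "fps_nth u 0 = 0" "fps_nth v 0 = 0"
  shows "fps_nth (arc u v g) 1 =
    germ_coeff g 1 0 * fps_nth u 1 + germ_coeff g 0 1 * fps_nth v 1"
  using assms by (simp add: arc_def germ_coeff_def fps_compose_nth fps_mult_nth)

lemma arc_nth_2:
  assumes "fps_nth u 0 = 0" "fps_nth v 0 = 0"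
  shows "fps_nth (arc u v g) 2 =
    germ_coeff g 1 0 * fps_nth u 2 + germ_coeff g 0 1 * fps_nth v 2 +
    (germ_coeff g 2 0 * (fps_nth u 1)\<^sup>2 + germ_coeff g 1 1 * fps_nth u 1 * fps_nth v 1
      + germ_coeff g 0 2 * (fps_nth v 1)\<^sup>2)"
  using assms
  by (simp add: arc_def germ_coeff_def fps_compose_nth fps_mult_nth numeral_2_eq_2
      atLeast0_atMost_Suc atMost_Suc algebra_simps)

subsection \<open>Local equations along arcs\<close>

text \<open>The same substitution in the local equation of a polynomial, carried out in one step; in this form
  its coefficients are directional derivatives.\<close>

definition chart_arc :: "complex^3 \<Rightarrow> complex^3 \<Rightarrow> complex^3 \<Rightarrow> complex fps \<Rightarrow> complex fps \<Rightarrow>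
    cpoly3 \<Rightarrow> complex fps" where
  "chart_arc p q r u v = subst3 fps_const
     (\<lambda>i. fps_const (p $ i) + fps_const (q $ i) * u + fps_const (r $ i) * v)"

interpretation fc: complex_algebra "fps_const :: complex \<Rightarrow> complex fps"
  by unfold_locales simp_all

interpretation gc: complex_algebra germ_const
  by unfold_locales (simp_all add: germ_const_def)

lemma arc_local_equation:
  assumes uv: "fps_nth u 0 = 0" "fps_nth v 0 = 0"
  shows "arc u v (subst3 germ_const (\<lambda>i. germ_const (vec_nth p i)
      + germ_const (vec_nth q i) * fps_const fps_X + germ_const (vec_nth r i) * fps_X) f)
    = chart_arc p q r u v f"
  unfolding chart_arc_def
proof (induction f rule: cpoly3_induct)
  case (cst c)
  show ?case by (simp add: gc.subst3_cst fc.subst3_cst arc_const)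
next
  case (var i)
  show ?case
    by (simp add: gc.subst3_var fc.subst3_var arc_add arc_mult uv arc_const arc_X arc_Y)
next
  case (add f g)
  then show ?case by (simp add: gc.subst3_add fc.subst3_add arc_add)
next
  case (mult f g)
  then show ?case by (simp add: gc.subst3_mult fc.subst3_mult arc_mult uv)
qed

lemma fps_mult_nth_one: "fps_nth (f * g) 1 = fps_nth f 0 * fps_nth g 1 + fps_nth f 1 * fps_nth g 0"
  by (simp add: fps_mult_nth)

lemma fps_mult_nth_2: "fps_nth (f * g) 2 =
    fps_nth f 0 * fps_nth g 2 + fps_nth f 1 * fps_nth g 1 + fps_nth f 2 * fps_nth g 0"
  by (simp add: fps_mult_nth numeral_2_eq_2)

lemma chart_arc_nth:
  fixes q r :: "complex^3" and u v :: "complex fps"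
  assumes uv: "fps_nth u 0 = 0" "fps_nth v 0 = 0"
  defines "w \<equiv> \<lambda>n. fps_nth u n *s q + fps_nth v n *s r"
  shows "fps_nth (chart_arc p q r u v f) 0 = eval3 f p"
    and "fps_nth (chart_arc p q r u v f) 1 = eval3 (dir_deriv (w 1) f) p"
    and "2 * fps_nth (chart_arc p q r u v f) 2 =
      2 * eval3 (dir_deriv (w 2) f) p + eval3 (dir_deriv (w 1) (dir_deriv (w 1) f)) p"
proof -
  have "fps_nth (chart_arc p q r u v f) 0 = eval3 f p \<and>
    fps_nth (chart_arc p q r u v f) 1 = eval3 (dir_deriv (w 1) f) p \<and>
    2 * fps_nth (chart_arc p q r u v f) 2 =
      2 * eval3 (dir_deriv (w 2) f) p + eval3 (dir_deriv (w 1) (dir_deriv (w 1) f)) p"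
    unfolding chart_arc_def
  proof (induction f rule: cpoly3_induct)
    case (cst c)
    show ?case by (simp add: fc.subst3_cst)
  next
    case (var i)
    have dv: "dir_deriv x (var i) = cst (x $ i)" for x
    proof -
      have "cst (x $ l) * partial l (var i) = (if l = i then cst (x $ i) else 0)" for l by simp
      then show ?thesis by (simp add: dir_deriv_def)
    qed
    show ?case using uv by (simp add: fc.subst3_var dv w_def algebra_simps)
  next
    case (add f g)
    then show ?case by (simp add: fc.subst3_add dir_deriv_add algebra_simps)
  next
    case (mult f g)
    let ?X = "\<lambda>f. subst3 fps_const (\<lambda>i. fps_const (p $ i) + fps_const (q $ i) * u
        + fps_const (r $ i) * v) f"
    have 0: "fps_nth (?X f) 0 = eval3 f p" "fps_nth (?X g) 0 = eval3 g p"
      "fps_nth (?X f) 1 = eval3 (dir_deriv (w 1) f) p" "fps_nth (?X g) 1 = eval3 (dir_deriv (w 1) g) p"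
      using mult by auto
    have "2 * fps_nth (?X f * ?X g) 2 = eval3 f p * (2 * fps_nth (?X g) 2)
        + 2 * eval3 (dir_deriv (w 1) f) p * eval3 (dir_deriv (w 1) g) p
        + (2 * fps_nth (?X f) 2) * eval3 g p"
      by (simp only: fps_mult_nth_2 0) (simp add: algebra_simps)
    also have "\<dots> = 2 * eval3 (dir_deriv (w 2) (f * g)) p + eval3 (dir_deriv (w 1) (dir_deriv (w 1) (f * g))) p"
      using mult by (simp add: dir_deriv_mult dir_deriv_add algebra_simps)
    finally have 2: "2 * fps_nth (?X f * ?X g) 2 =
      2 * eval3 (dir_deriv (w 2) (f * g)) p + eval3 (dir_deriv (w 1) (dir_deriv (w 1) (f * g))) p" .
    have "fps_nth (?X f * ?X g) 1 = eval3 (dir_deriv (w 1) (f * g)) p"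
      by (simp only: fps_mult_nth_one 0) (simp add: dir_deriv_mult)
    moreover have "fps_nth (?X f * ?X g) 0 = eval3 (f * g) p"
      by (simp only: fps_mult_nth_0 0 eval3_simps)
    ultimately show ?case using 2 unfolding fc.subst3_mult by blast
  qed
  then show "fps_nth (chart_arc p q r u v f) 0 = eval3 f p"
    and "fps_nth (chart_arc p q r u v f) 1 = eval3 (dir_deriv (w 1) f) p"
    and "2 * fps_nth (chart_arc p q r u v f) 2 =
      2 * eval3 (dir_deriv (w 2) f) p + eval3 (dir_deriv (w 1) (dir_deriv (w 1) f)) p" by auto
qed

lemma chart_arc_mult: "chart_arc p q r u v (f * g) = chart_arc p q r u v f * chart_arc p q r u v g"
  by (simp add: chart_arc_def fc.subst3_mult)

lemma chart_arc_prod: "chart_arc p q r u v (\<Prod>x\<in>A. h x) = (\<Prod>x\<in>A. chart_arc p q r u v (h x))"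
  by (simp add: chart_arc_def fc.subst3_prod)

lemma dir_deriv_lincomb:
  "eval3 (dir_deriv (a *s x + b *s y) f) p = a * eval3 (dir_deriv x f) p + b * eval3 (dir_deriv y f) p"
  by (simp add: dir_deriv_def sum_3 algebra_simps)

lemma fps_prod_nth_card:
  fixes h :: "'a \<Rightarrow> complex fps"
  assumes "finite A" "\<And>x. x \<in> A \<Longrightarrow> fps_nth (h x) 0 = 0"
  shows "fps_nth ((\<Prod>x\<in>A. h x) * k) (card A) = (\<Prod>x\<in>A. fps_nth (h x) 1) * fps_nth k 0"
proof -
  have "h x = fps_X * fps_shift 1 (h x)" if "x \<in> A" for x
    by (rule fps_ext) (use assms(2)[OF that] in \<open>auto simp: gr0_conv_Suc fps_X_mult_nth\<close>)
  then have "(\<Prod>x\<in>A. h x) = (\<Prod>x\<in>A. fps_X * fps_shift 1 (h x))" by (intro prod.cong) auto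
  also have "\<dots> = fps_X ^ card A * (\<Prod>x\<in>A. fps_shift 1 (h x))" by (simp add: prod.distrib)
  finally have "fps_nth ((\<Prod>x\<in>A. h x) * k) (card A) =
      fps_nth (fps_X ^ card A * ((\<Prod>x\<in>A. fps_shift 1 (h x)) * k)) (card A)"
    by (simp add: mult.assoc)
  also have "\<dots> = fps_nth (\<Prod>x\<in>A. fps_shift 1 (h x)) 0 * fps_nth k 0"
    by (subst fps_X_power_mult_nth) simp
  also have "fps_nth (\<Prod>x\<in>A. fps_shift 1 (h x)) 0 = (\<Prod>x\<in>A. fps_nth (h x) 1)"
    using assms(1) by induction simp_all
  finally show ?thesis .
qed

lemma generic_direction:
  assumes "finite S" "\<And>x. x \<in> S \<Longrightarrow> a x \<noteq> 0 \<or> b x \<noteq> (0::complex)"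
  obtains s t where "\<And>x. x \<in> S \<Longrightarrow> a x * s + b x * t \<noteq> 0"
proof -
  obtain t where t: "t \<notin> (\<lambda>x. - a x / b x) ` S"
    using ex_new_if_finite[of "(\<lambda>x. - a x / b x) ` S"] assms(1) infinite_UNIV_char_0 by blast
  have "a x * 1 + b x * t \<noteq> 0" if "x \<in> S" for x
  proof (cases "b x = 0")
    case False
    show ?thesis
    proof
      assume "a x * 1 + b x * t = 0"
      then have "t = - a x / b x" using False by (simp add: field_simps add_eq_0_iff)
      then show False using t that by blast
    qed
  qed (use assms(2)[OF that] in auto)
  then show thesis by (rule that)
qed

text \<open>Modulo \<open>t\<^sup>3\<close> the restriction to an arc of nonzero velocity maps \<open>\<complex>[[u, v]]\<close> onto a space of dimension
  \<open>3\<close>. If it kills \<open>g1\<close> and \<open>g2\<close>, the quotient by these cannot have dimension \<open>2\<close>.\<close>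

lemma intersection_mult_arc:
  assumes im: "intersection_mult g1 g2 2"
    and uv: "fps_nth u 0 = 0" "fps_nth v 0 = 0" "fps_nth u 1 \<noteq> 0 \<or> fps_nth v 1 \<noteq> 0"
    and g: "\<And>k. k \<le> 2 \<Longrightarrow> fps_nth (arc u v g1) k = 0" "\<And>k. k \<le> 2 \<Longrightarrow> fps_nth (arc u v g2) k = 0"
  shows False
proof -
  obtain B where B: "finite B" "card B = 2"
    "\<forall>w. \<exists>c. w - (\<Sum>b\<in>B. germ_const (c b) * b) \<in> {w. \<exists>a b. w = a * g1 + b * g2}"
    using im unfolding intersection_mult_def quotient_has_dim_def by auto
  obtain z where z: "\<exists>k\<in>{..2::nat}. z k \<noteq> 0"
    "\<And>b. b \<in> B \<Longrightarrow> (\<Sum>k\<le>2. z k * fps_nth (arc u v b) k) = 0"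
    using underdetermined_system[of B "{..2::nat}" "\<lambda>k b. fps_nth (arc u v b) k"] B by auto
  have zero: "(\<Sum>k\<le>2. z k * fps_nth (arc u v w) k) = 0" for w
  proof -
    obtain c where "w - (\<Sum>b\<in>B. germ_const (c b) * b) \<in> {w. \<exists>a b. w = a * g1 + b * g2}"
      using B(3) by blast
    then obtain a b where "w - (\<Sum>b\<in>B. germ_const (c b) * b) = a * g1 + b * g2" by blast
    then have w: "w = (\<Sum>b\<in>B. germ_const (c b) * b) + (a * g1 + b * g2)"
      by (simp add: algebra_simps)
    have sum: "arc u v (\<Sum>x\<in>B. h x) = (\<Sum>x\<in>B. arc u v (h x))" for h
      using B(1)
    proof induction
      case empty
      show ?case using arc_const[of u v 0] by (simp add: germ_const_def)
    qed (simp add: arc_add)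
    have "fps_nth (arc u v w) k = (\<Sum>b\<in>B. c b * fps_nth (arc u v b) k)" if "k \<le> 2" for k
    proof -
      have "fps_nth (f * arc u v g1) k = 0" "fps_nth (f * arc u v g2) k = 0" for f
        unfolding fps_mult_nth by (intro sum.neutral; use g that in auto)+
      then show ?thesis
        by (simp add: w arc_add sum arc_mult uv arc_const fps_sum_nth)
    qed
    then have "(\<Sum>k\<le>2. z k * fps_nth (arc u v w) k) =
        (\<Sum>k\<le>2. \<Sum>b\<in>B. c b * (z k * fps_nth (arc u v b) k))"
      by (simp add: sum_distrib_left mult_ac)
    also have "\<dots> = (\<Sum>b\<in>B. c b * (\<Sum>k\<le>2. z k * fps_nth (arc u v b) k))"
      by (subst sum.swap) (simp add: sum_distrib_left)
    finally show ?thesis using z(2) by simp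
  qed
  have expand: "(\<Sum>k\<le>2. z k * x k) = z 0 * x 0 + z 1 * x 1 + z 2 * x 2" for x
    by (simp add: numeral_2_eq_2)
  obtain \<alpha> \<beta> where ab: "\<alpha> * fps_nth u 1 + \<beta> * fps_nth v 1 = 1"
    using uv(3) that[of "1 / fps_nth u 1" 0] that[of 0 "1 / fps_nth v 1"] by auto
  define w where "w = germ_const \<alpha> * fps_const fps_X + germ_const \<beta> * fps_X"
  have aw: "arc u v w = fps_const \<alpha> * u + fps_const \<beta> * v"
    by (simp add: w_def arc_add arc_mult uv arc_const arc_X arc_Y)
  have w: "fps_nth (arc u v w) 0 = 0" "fps_nth (arc u v w) 1 = 1"
    using uv ab by (simp_all add: aw)
  have ww: "fps_nth (arc u v (w * w)) 0 = 0" "fps_nth (arc u v (w * w)) 1 = 0"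
    "fps_nth (arc u v (w * w)) 2 = 1"
    unfolding arc_mult[OF uv(1,2)] fps_mult_nth_2 fps_mult_nth_one fps_mult_nth_0 w by simp_all
  have z0: "z 0 = 0" using zero[of 1] unfolding expand by simp
  have z2: "z 2 = 0" using zero[of "w * w"] unfolding expand ww by simp
  have z1: "z 1 = 0" using zero[of w] unfolding expand w z0 z2 by simp
  have "k = 0 \<or> k = 1 \<or> k = 2" if "k \<le> 2" for k :: nat using that by auto
  then show False using z(1) z0 z1 z2 by (metis atMost_iff)
qed

section \<open>Singular points of a product of smooth curves\<close>

definition curves_through :: "cpoly3 set \<Rightarrow> complex^3 \<Rightarrow> cpoly3 set" where
  "curves_through C p = {F\<in>C. eval3 F p = 0}"

definition tangent_at :: "complex^3 \<Rightarrow> cpoly3 \<Rightarrow> cpoly3 \<Rightarrow> bool" where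
  "tangent_at p F F' \<longleftrightarrow>
    (\<exists>c. c \<noteq> 0 \<and> (\<forall>w. eval3 (dir_deriv w F') p = c * eval3 (dir_deriv w F) p))"

text \<open>The setting at a single point \<open>p\<close>: a product of forms, each smooth at \<open>p\<close> if it vanishes there.
  This treats lines and conics alike.\<close>

locale point_of_arrangement =
  fixes C :: "cpoly3 set" and deg :: "cpoly3 \<Rightarrow> nat" and p :: "complex^3" and N :: nat
  assumes finite_C: "finite C"
    and hom: "F \<in> C \<Longrightarrow> homogeneous (deg F) F"
    and deg_pos: "F \<in> C \<Longrightarrow> 1 \<le> deg F"
    and degree_sum: "(\<Sum>F\<in>C. deg F) = N"
    and smooth: "F \<in> C \<Longrightarrow> eval3 F p = 0 \<Longrightarrow> \<exists>w. eval3 (dir_deriv w F) p \<noteq> 0"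
begin

abbreviation branches :: "cpoly3 set" where
  "branches \<equiv> curves_through C p"

abbreviation slope :: "complex^3 \<Rightarrow> cpoly3 \<Rightarrow> complex" where
  "slope w F \<equiv> eval3 (dir_deriv w F) p"

lemma finite_branches: "finite branches"
  using finite_C by (simp add: curves_through_def)

lemma slope_nonzero:
  assumes fr: "dual_frame p q r U V" and F: "F \<in> branches"
  shows "slope q F \<noteq> 0 \<or> slope r F \<noteq> 0"
proof (rule ccontr)
  assume 0: "\<not> ?thesis"
  have F': "homogeneous (deg F) F" "eval3 F p = 0" "F \<in> C"
    using F hom by (auto simp: curves_through_def)
  obtain a b where ab: "F = lin U * a + lin V * b"
    by (rule decompose_at_point[OF fr F'(1,2)])
  have s: "slope w F = dot3 U w * eval3 a p + dot3 V w * eval3 b p" for w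
    using fr by (simp add: ab dir_deriv_add dir_deriv_mult dual_frame_def)
  have "eval3 a p = 0" "eval3 b p = 0"
    using 0 fr by (simp_all add: s dual_frame_def)
  then have "slope w F = 0" for w by (simp add: s)
  then show False using smooth[OF F'(3,2)] by blast
qed

definition cofactor :: complex where
  "cofactor = (\<Prod>F\<in>C - branches. eval3 F p)"

lemma cofactor_nonzero: "cofactor \<noteq> 0"
  using finite_C by (auto simp: cofactor_def curves_through_def)

lemma prod_split: "(\<Prod>F\<in>C. F) = (\<Prod>F\<in>branches. F) * (\<Prod>F\<in>C - branches. F)"
  using prod.subset_diff[of branches C "\<lambda>F. F"] finite_C by (simp add: curves_through_def mult.commute)

abbreviation line_arc :: "complex^3 \<Rightarrow> complex^3 \<Rightarrow> complex \<Rightarrow> complex \<Rightarrow> cpoly3 \<Rightarrow> complex fps" where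
  "line_arc q r s t \<equiv> chart_arc p q r (fps_const s * fps_X) (fps_const t * fps_X)"

lemma line_arc_nth:
  "fps_nth (line_arc q r s t F) 0 = eval3 F p"
  "fps_nth (line_arc q r s t F) 1 = slope q F * s + slope r F * t"
  using chart_arc_nth(1,2)[of "fps_const s * fps_X" "fps_const t * fps_X" p q r F]
  by (simp_all add: dir_deriv_lincomb mult.commute)

lemma line_arc_order:
  assumes "\<And>F. F \<in> branches \<Longrightarrow> slope q F * s + slope r F * t \<noteq> 0"
  shows "subdegree (line_arc q r s t (\<Prod>F\<in>C. F)) = card branches"
proof -
  have ne: "line_arc q r s t F \<noteq> 0" and
    sub: "subdegree (line_arc q r s t F) = (if F \<in> branches then 1 else 0)" if "F \<in> C" for F
  proof -
    show "subdegree (line_arc q r s t F) = (if F \<in> branches then 1 else 0)"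
    proof (cases "F \<in> branches")
      case True
      then have "fps_nth (line_arc q r s t F) 0 = 0" "fps_nth (line_arc q r s t F) 1 \<noteq> 0"
        using assms[OF True] unfolding line_arc_nth by (auto simp: curves_through_def)
      then have "subdegree (line_arc q r s t F) = 1" by (intro subdegreeI) auto
      then show ?thesis using True by simp
    next
      case False
      then have "fps_nth (line_arc q r s t F) 0 \<noteq> 0"
        using that unfolding line_arc_nth by (auto simp: curves_through_def)
      then show ?thesis using False by simp
    qed
    show "line_arc q r s t F \<noteq> 0"
    proof (cases "F \<in> branches")
      case True
      then show ?thesis using assms[OF True] line_arc_nth(2)[of q r s t F] by auto
    next
      case False
      then show ?thesis using that line_arc_nth(1)[of q r s t F] by (auto simp: curves_through_def)
    qed
  qed
  have "subdegree (line_arc q r s t (\<Prod>F\<in>C. F)) = (\<Sum>F\<in>C. if F \<in> branches then 1 else 0)"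
    unfolding chart_arc_prod using sub by (subst subdegree_prod[OF ne]) auto
  also have "\<dots> = card branches"
    using finite_C by (simp add: sum.If_cases curves_through_def Int_def Collect_conj_eq[symmetric])
  finally show ?thesis .
qed

lemma line_arc_leading:
  "fps_nth (line_arc q r s t (\<Prod>F\<in>C. F)) (card branches) =
    (\<Prod>F\<in>branches. slope q F * s + slope r F * t) * cofactor"
proof -
  have "fps_nth (line_arc q r s t (\<Prod>F\<in>C. F)) (card branches) =
      fps_nth ((\<Prod>F\<in>branches. line_arc q r s t F) * (\<Prod>F\<in>C - branches. line_arc q r s t F))
        (card branches)"
    unfolding prod_split by (simp add: chart_arc_mult chart_arc_prod)
  also have "\<dots> = (\<Prod>F\<in>branches. fps_nth (line_arc q r s t F) 1) *
      fps_nth (\<Prod>F\<in>C - branches. line_arc q r s t F) 0"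
    by (rule fps_prod_nth_card[OF finite_branches])
      (simp only: line_arc_nth, simp add: curves_through_def)
  also have "fps_nth (\<Prod>F\<in>C - branches. line_arc q r s t F) 0 = cofactor"
  proof -
    have "fps_nth (\<Prod>F\<in>A. line_arc q r s t F) 0 = (\<Prod>F\<in>A. eval3 F p)" if "finite A" for A
      using that by induction (simp_all add: line_arc_nth)
    then show ?thesis using finite_C by (simp add: cofactor_def)
  qed
  finally show ?thesis by (simp only: line_arc_nth)
qed

text \<open>The chart that \<^const>\<open>local_equation\<close> hides behind an existential quantifier is named here,
  so that the branches and the components can be compared in the same coordinates.\<close>

definition chart_equation :: "complex^3 \<Rightarrow> complex^3 \<Rightarrow> germ \<Rightarrow> bool" where
  "chart_equation q r h \<longleftrightarrow> det (vector [p, q, r] :: complex^3^3) \<noteq> 0 \<and>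
     h = subst3 germ_const (\<lambda>i. germ_const (vec_nth p i)
        + germ_const (vec_nth q i) * fps_const fps_X + germ_const (vec_nth r i) * fps_X)
       (\<Prod>F\<in>C. F)"

lemma chart_frame:
  assumes "chart_equation q r h" obtains U V where "dual_frame p q r U V"
  using assms dual_frame_exists[of p q r] unfolding chart_equation_def by blast

lemma chart_equation_arc:
  assumes "chart_equation q r h" "fps_nth u 0 = 0" "fps_nth v 0 = 0"
  shows "arc u v h = chart_arc p q r u v (\<Prod>F\<in>C. F)"
  using assms arc_local_equation by (simp add: chart_equation_def)

text \<open>Along a generic straight arc each branch, and each component through \<open>p\<close>, vanishes to first order
  exactly. So the two factorisations of the equation have equally many factors at \<open>p\<close>, and the
  products of the linear parts agree up to the value of the remaining components.\<close>

lemma factored_line_arc: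
  fixes g :: "nat \<Rightarrow> germ"
  assumes eq: "chart_equation q r (\<Prod>i<n. g i)" and sm: "\<And>i. i < n \<Longrightarrow> smooth_branch (g i)"
  shows "card branches = n"
    and "(\<Prod>i<n. germ_coeff (g i) 1 0 * s + germ_coeff (g i) 0 1 * t) =
      (\<Prod>F\<in>branches. slope q F * s + slope r F * t) * cofactor"
proof -
  define m where "m i s t = germ_coeff (g i) 1 0 * s + germ_coeff (g i) 0 1 * t" for i s t
  define \<gamma> where "\<gamma> s t = arc (fps_const s * fps_X) (fps_const t * fps_X)" for s t
  have \<gamma>f: "line_arc q r s t (\<Prod>F\<in>C. F) = (\<Prod>i<n. \<gamma> s t (g i))" for s t
    by (subst chart_equation_arc[OF eq, symmetric]) (simp_all add: arc_prod \<gamma>_def)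
  have \<gamma>0: "fps_nth (\<gamma> s t (g i)) 0 = 0" and \<gamma>1: "fps_nth (\<gamma> s t (g i)) 1 = m i s t"
    if "i < n" for i s t
  proof -
    show "fps_nth (\<gamma> s t (g i)) 0 = 0"
      using sm[OF that] by (simp add: \<gamma>_def arc_nth_0 smooth_branch_def)
    show "fps_nth (\<gamma> s t (g i)) 1 = m i s t"
      unfolding \<gamma>_def by (subst arc_nth_1) (simp_all add: m_def)
  qed
  from chart_frame[OF eq] obtain U V where fr: "dual_frame p q r U V" .
  obtain s0 t0 where st: "\<And>x. x \<in> Inl ` branches \<union> Inr ` {..<n} \<Longrightarrow>
     (case x of Inl F \<Rightarrow> slope q F | Inr i \<Rightarrow> germ_coeff (g i) 1 0) * s0 +
     (case x of Inl F \<Rightarrow> slope r F | Inr i \<Rightarrow> germ_coeff (g i) 0 1) * t0 \<noteq> 0"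
    by (rule generic_direction[of "Inl ` branches \<union> Inr ` {..<n}"
        "\<lambda>x. case x of Inl F \<Rightarrow> slope q F | Inr i \<Rightarrow> germ_coeff (g i) 1 0"
        "\<lambda>x. case x of Inl F \<Rightarrow> slope r F | Inr i \<Rightarrow> germ_coeff (g i) 0 1"])
      (use finite_branches slope_nonzero[OF fr] sm in \<open>auto simp: smooth_branch_def\<close>)
  have "subdegree (line_arc q r s0 t0 (\<Prod>F\<in>C. F)) = card branches"
  proof (rule line_arc_order)
    fix F assume "F \<in> branches"
    then show "slope q F * s0 + slope r F * t0 \<noteq> 0" using st[of "Inl F"] by simp
  qed
  moreover have "subdegree (\<gamma> s0 t0 (g i)) = 1" "\<gamma> s0 t0 (g i) \<noteq> 0" if "i < n" for i
  proof -
    have 1: "fps_nth (\<gamma> s0 t0 (g i)) 1 \<noteq> 0"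
      using st[of "Inr i"] that \<gamma>1[OF that, of s0 t0] by (simp add: m_def)
    then show "subdegree (\<gamma> s0 t0 (g i)) = 1" using \<gamma>0[OF that] by (intro subdegreeI) auto
    show "\<gamma> s0 t0 (g i) \<noteq> 0" using 1 by auto
  qed
  then have "subdegree (\<Prod>i<n. \<gamma> s0 t0 (g i)) = n"
    by (subst subdegree_prod) auto
  ultimately show card: "card branches = n" unfolding \<gamma>f by simp
  have "fps_nth ((\<Prod>i<n. \<gamma> s t (g i)) * 1) (card {..<n}) =
      (\<Prod>i<n. fps_nth (\<gamma> s t (g i)) 1) * fps_nth 1 0"
    by (rule fps_prod_nth_card) (auto simp: \<gamma>0)
  also have "(\<Prod>i<n. fps_nth (\<gamma> s t (g i)) 1) = (\<Prod>i<n. m i s t)"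
    by (rule prod.cong) (use \<gamma>1 in auto)
  finally have "fps_nth (\<Prod>i<n. \<gamma> s t (g i)) n = (\<Prod>i<n. m i s t)" by simp
  then show "(\<Prod>i<n. germ_coeff (g i) 1 0 * s + germ_coeff (g i) 0 1 * t) =
      (\<Prod>F\<in>branches. slope q F * s + slope r F * t) * cofactor"
    using line_arc_leading[of q r s t] unfolding \<gamma>f card m_def by simp
qed

text \<open>The tangent direction of a branch is a zero of the leading form, hence tangent to one of the
  components. Distinct branches lead to distinct components, because a component has only one
  tangent; as there are equally many of both, this matches the tangents of the components with the
  distinct tangents of the branches.\<close>

lemma transversal_branches:
  fixes g :: "nat \<Rightarrow> germ"
  assumes eq: "chart_equation q r (\<Prod>i<n. g i)" and sm: "\<And>i. i < n \<Longrightarrow> smooth_branch (g i)"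
    and tr: "\<And>i j. i < n \<Longrightarrow> j < n \<Longrightarrow> i \<noteq> j \<Longrightarrow> transversal (g i) (g j)"
    and F: "F \<in> branches" "F' \<in> branches" "F \<noteq> F'"
  shows "slope q F * slope r F' \<noteq> slope r F * slope q F'"
proof
  assume propl: "slope q F * slope r F' = slope r F * slope q F'"
  from chart_frame[OF eq] obtain U V where fr: "dual_frame p q r U V" .
  define a where "a i = germ_coeff (g i) 1 0" for i
  define b where "b i = germ_coeff (g i) 0 1" for i
  define l where "l G i = slope q G * (- b i) + slope r G * a i" for G i
  \<comment> \<open>\<open>l G i = 0\<close> says that the tangent of \<open>G\<close> is the tangent of the branch \<open>g i\<close>.\<close>
  have nz: "\<not> (l F i = 0 \<and> l F j = 0)" if "F \<in> branches" "i < n" "j < n" "i \<noteq> j" for F i j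
  proof
    assume 0: "l F i = 0 \<and> l F j = 0"
    have D: "a i * b j - b i * a j \<noteq> 0"
      using tr[OF that(2-4)] by (simp add: transversal_def a_def b_def)
    have "(a i * b j - b i * a j) * slope q F = a j * l F i - a i * l F j"
      "(a i * b j - b i * a j) * slope r F = b j * l F i - b i * l F j"
      by (simp_all add: l_def algebra_simps)
    then have "slope q F = 0" "slope r F = 0" using 0 D by auto
    then show False using slope_nonzero[OF fr that(1)] by simp
  qed
  have "\<exists>F\<in>branches. l F i = 0" if "i < n" for i
  proof -
    have "(\<Prod>j<n. a j * (- b i) + b j * a i) = 0"
      by (rule prod_zero) (use that in \<open>auto simp: algebra_simps\<close>)
    moreover have "(\<Prod>j<n. a j * (- b i) + b j * a i) = (\<Prod>F\<in>branches. l F i) * cofactor"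
      unfolding l_def using factored_line_arc(2)[OF eq sm, of "- b i" "a i"]
      by (simp only: a_def b_def)
    ultimately have "(\<Prod>F\<in>branches. l F i) * cofactor = 0" by (simp only:)
    then show ?thesis using cofactor_nonzero finite_branches by auto
  qed
  then obtain \<phi> where \<phi>: "\<phi> i \<in> branches" "l (\<phi> i) i = 0" if "i < n" for i by metis
  have "inj_on \<phi> {..<n}"
    by (rule inj_onI) (use \<phi> nz in \<open>metis lessThan_iff\<close>)
  then have "\<phi> ` {..<n} = branches"
    using \<phi> factored_line_arc(1)[OF eq sm]
    by (intro card_subset_eq finite_branches) (auto simp: card_image)
  then have "F \<in> \<phi> ` {..<n}" "F' \<in> \<phi> ` {..<n}" using F by simp_all
  then obtain i j where ij: "i < n" "\<phi> i = F" "j < n" "\<phi> j = F'" by blast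
  then have "i \<noteq> j" using F by auto
  have "slope q F' * l F j = slope q F * l F' j" "slope r F' * l F j = slope r F * l F' j"
    using propl by (simp_all add: l_def algebra_simps)
  moreover have "l F' j = 0" using \<phi>(2)[OF ij(3)] ij by simp
  ultimately have "l F j = 0" using slope_nonzero[OF fr F(2)] by auto
  then show False using nz[OF F(1) ij(1,3) \<open>i \<noteq> j\<close>] \<phi>(2)[OF ij(1)] ij by simp
qed

subsection \<open>Local conditions at the three kinds of singular points\<close>

lemma hom_rest: "homogeneous (\<Sum>F\<in>C - branches. deg F) (\<Prod>F\<in>C - branches. F)"
  by (rule homogeneous_prod) (use finite_C hom in auto)

lemma degree_split: "(\<Sum>F\<in>branches. deg F) + (\<Sum>F\<in>C - branches. deg F) = N"
  using sum.subset_diff[of branches C deg] finite_C degree_sum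
  by (simp add: curves_through_def add.commute)

lemma eval_rest: "eval3 (\<Prod>F\<in>C - branches. F) p = cofactor"
  by (simp add: cofactor_def)

lemma decompose_branch:
  assumes fr: "dual_frame p q r U V" and F: "F \<in> branches"
  obtains a b where "homogeneous (deg F - 1) a" "homogeneous (deg F - 1) b"
    "F = lin U * a + lin V * b" "eval3 a p = slope q F" "eval3 b p = slope r F"
proof -
  have F': "homogeneous (deg F) F" "eval3 F p = 0" "F \<in> C"
    using F hom by (auto simp: curves_through_def)
  obtain a b where ab: "homogeneous (deg F - 1) a" "homogeneous (deg F - 1) b"
    "F = lin U * a + lin V * b"
    by (rule decompose_at_point[OF fr F'(1,2)])
  have "slope w F = dot3 U w * eval3 a p + dot3 V w * eval3 b p" for w
    using fr by (simp add: ab(3) dir_deriv_add dir_deriv_mult dual_frame_def)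
  then have "eval3 a p = slope q F" "eval3 b p = slope r F"
    using fr by (simp_all add: dual_frame_def)
  with ab show thesis by (rule that)
qed

lemma node_conditions:
  assumes fr: "dual_frame p q r U V" and br: "branches = {F1, F2}" "F1 \<noteq> F2"
    and tr: "slope q F1 * slope r F2 \<noteq> slope r F1 * slope q F2"
  shows "local_conditions (\<Prod>F\<in>C. F) p j 1"
proof -
  define R where "R = (\<Prod>F\<in>C - branches. F)"
  obtain a1 b1 where 1: "F1 = lin U * a1 + lin V * b1" "eval3 a1 p = slope q F1"
    "eval3 b1 p = slope r F1" using decompose_branch[OF fr, of F1] br by blast
  obtain a2 b2 where 2: "F2 = lin U * a2 + lin V * b2" "eval3 a2 p = slope q F2"
    "eval3 b2 p = slope r F2" using decompose_branch[OF fr, of F2] br by blast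
  have R: "eval3 R p \<noteq> 0" using cofactor_nonzero unfolding R_def eval_rest .
  show ?thesis
  proof (rule local_conditions_node[OF fr])
    have "(\<Prod>F\<in>C. F) = F1 * F2 * R" using br(2) unfolding prod_split R_def br(1) by simp
    then show "(\<Prod>F\<in>C. F) = (lin U)\<^sup>2 * (R * (a1 * a2)) +
        lin U * lin V * (R * (a1 * b2 + b1 * a2)) + (lin V)\<^sup>2 * (R * (b1 * b2))"
      unfolding 1(1) 2(1) by (simp only: power2_eq_square algebra_simps)
    have "(eval3 (R * (a1 * b2 + b1 * a2)) p)\<^sup>2 - 4 * eval3 (R * (a1 * a2)) p * eval3 (R * (b1 * b2)) p
        = (eval3 R p)\<^sup>2 * (slope q F1 * slope r F2 - slope r F1 * slope q F2)\<^sup>2"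
      by (simp add: 1(2,3) 2(2,3) power2_eq_square algebra_simps)
    also have "\<dots> \<noteq> 0" using R tr by simp
    finally show "(eval3 (R * (a1 * b2 + b1 * a2)) p)\<^sup>2 \<noteq>
        4 * eval3 (R * (a1 * a2)) p * eval3 (R * (b1 * b2)) p" by simp
  qed
qed

lemma triple_point_conditions:
  assumes fr: "dual_frame p q r U V" and br: "branches = {F1, F2, F3}"
    "F1 \<noteq> F2" "F1 \<noteq> F3" "F2 \<noteq> F3"
    and tr: "slope q F1 * slope r F2 \<noteq> slope r F1 * slope q F2"
      "slope q F1 * slope r F3 \<noteq> slope r F1 * slope q F3"
      "slope q F2 * slope r F3 \<noteq> slope r F2 * slope q F3"
    and "2 \<le> j"
  shows "local_conditions (\<Prod>F\<in>C. F) p j 4"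
proof -
  define R where "R = (\<Prod>F\<in>C - branches. F)"
  define D where "D = slope q F1 * slope r F2 - slope r F1 * slope q F2"
  have D: "D \<noteq> 0" using tr(1) by (simp add: D_def)
  \<comment> \<open>Coordinates in which the first two tangent lines are the axes.\<close>
  define q' where "q' = (slope r F2 / D) *s q + (- slope q F2 / D) *s r"
  define r' where "r' = (- slope r F1 / D) *s q + (slope q F1 / D) *s r"
  have "slope r F2 / D * (slope q F1 / D) - (- slope q F2 / D) * (- slope r F1 / D) = D / (D * D)"
    by (simp add: D_def diff_divide_distrib mult.commute)
  then have "slope r F2 / D * (slope q F1 / D) - (- slope q F2 / D) * (- slope r F1 / D) \<noteq> 0"
    using D by simp
  then obtain U' V' where fr': "dual_frame p q' r' U' V'"
    unfolding q'_def r'_def by (rule dual_frame_change[OF fr])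
  have sl: "slope q' F = (slope r F2 * slope q F - slope q F2 * slope r F) / D"
    "slope r' F = (slope q F1 * slope r F - slope r F1 * slope q F) / D" for F
    unfolding q'_def r'_def dir_deriv_lincomb by (simp_all add: diff_divide_distrib)
  have sl12: "slope q' F1 = 1" "slope r' F1 = 0" "slope q' F2 = 0" "slope r' F2 = 1"
    using D unfolding sl by (simp_all add: D_def mult.commute)
  have sl3: "slope q' F3 \<noteq> 0" "slope r' F3 \<noteq> 0"
    using tr D unfolding sl by (simp_all add: mult.commute)
  obtain a1 b1 where 1: "homogeneous (deg F1 - 1) a1" "homogeneous (deg F1 - 1) b1"
    "F1 = lin U' * a1 + lin V' * b1" "eval3 a1 p = 1" "eval3 b1 p = 0"
    using decompose_branch[OF fr', of F1] br sl12 by (metis insertI1)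
  obtain a2 b2 where 2: "homogeneous (deg F2 - 1) a2" "homogeneous (deg F2 - 1) b2"
    "F2 = lin U' * a2 + lin V' * b2" "eval3 a2 p = 0" "eval3 b2 p = 1"
    using decompose_branch[OF fr', of F2] br sl12 by (metis insertI1 insertI2)
  obtain a3 b3 where 3: "homogeneous (deg F3 - 1) a3" "homogeneous (deg F3 - 1) b3"
    "F3 = lin U' * a3 + lin V' * b3" "eval3 a3 p \<noteq> 0" "eval3 b3 p \<noteq> 0"
    using decompose_branch[OF fr', of F3] br sl3 by (metis insertI1 insertI2)
  have R: "eval3 R p \<noteq> 0" using cofactor_nonzero unfolding R_def eval_rest .
  note hR = hom_rest[folded R_def]
  let ?e = "(\<Sum>F\<in>C - branches. deg F) + (deg F1 - 1 + (deg F2 - 1) + (deg F3 - 1))"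
  show ?thesis
  proof (rule local_conditions_triple_point[OF fr', where e = ?e])
    show "homogeneous ?e (R * (a1 * a2 * a3))"
      by (intro homogeneous_mult hR 1 2 3)
    show "homogeneous ?e (R * (a1 * a2 * b3 + a1 * b2 * a3 + b1 * a2 * a3))"
      by (intro homogeneous_add homogeneous_mult hR 1 2 3)
    show "homogeneous ?e (R * (a1 * b2 * b3 + b1 * a2 * b3 + b1 * b2 * a3))"
      by (intro homogeneous_add homogeneous_mult hR 1 2 3)
    show "homogeneous ?e (R * (b1 * b2 * b3))"
      by (intro homogeneous_mult hR 1 2 3)
    have "(\<Prod>F\<in>C. F) = F1 * F2 * F3 * R"
      using br(2-4) unfolding prod_split R_def br(1) by (simp add: mult.assoc)
    then show "(\<Prod>F\<in>C. F) = (lin U') ^ 3 * (R * (a1 * a2 * a3)) +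
        (lin U')\<^sup>2 * lin V' * (R * (a1 * a2 * b3 + a1 * b2 * a3 + b1 * a2 * a3)) +
        lin U' * (lin V')\<^sup>2 * (R * (a1 * b2 * b3 + b1 * a2 * b3 + b1 * b2 * a3)) +
        (lin V') ^ 3 * (R * (b1 * b2 * b3))"
      unfolding 1(3) 2(3) 3(3) by (simp only: power2_eq_square power3_eq_cube algebra_simps)
  qed (use R 1(4,5) 2(4,5) 3(4,5) \<open>2 \<le> j\<close> in simp_all)
qed

text \<open>The hypothesis on second derivatives says that the two components do not osculate: relative to
  their gradients, they have different second-order terms in the direction \<open>q\<close> of the common
  tangent.\<close>

lemma tacnode_conditions:
  assumes fr: "dual_frame p q r U V" and br: "branches = {F1, F2}" "F1 \<noteq> F2"
    and tan: "slope q F1 = 0" "slope q F2 = 0"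
    and jet: "slope r F1 * eval3 (dir_deriv q (dir_deriv q F2)) p \<noteq> slope r F2 * eval3 (dir_deriv q (dir_deriv q F1)) p"
    and "3 \<le> N" "2 \<le> j"
  shows "local_conditions (\<Prod>F\<in>C. F) p j 3"
proof -
  define R where "R = (\<Prod>F\<in>C - branches. F)"
  have dec: "\<exists>\<alpha> \<beta>. homogeneous (deg F - 1) \<alpha> \<and> (\<beta> = 0 \<or> 2 \<le> deg F \<and> homogeneous (deg F - 2) \<beta>) \<and>
      F = lin V * \<alpha> + (lin U)\<^sup>2 * \<beta> \<and> eval3 \<alpha> p = slope r F \<and> 2 * eval3 \<beta> p = eval3 (dir_deriv q (dir_deriv q F)) p"
    if Fb: "F \<in> branches" and sl0: "slope q F = 0" for F
  proof -
    have F': "homogeneous (deg F) F" "eval3 F p = 0"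
      using Fb hom by (auto simp: curves_through_def)
    obtain \<alpha> \<beta> where d: "homogeneous (deg F - 1) \<alpha>" "\<beta> = 0 \<or> 2 \<le> deg F \<and> homogeneous (deg F - 2) \<beta>"
      "F = lin V * \<alpha> + (lin U)\<^sup>2 * \<beta>"
        by (rule decompose_tangent[OF fr F' sl0])
    have "eval3 \<alpha> p = slope r F" "2 * eval3 \<beta> p = eval3 (dir_deriv q (dir_deriv q F)) p"
      using fr by (simp_all add: d(3) dir_deriv_add dir_deriv_mult power2_eq_square dual_frame_def)
    with d show ?thesis by blast
  qed
  obtain \<alpha>1 \<beta>1 where 1: "homogeneous (deg F1 - 1) \<alpha>1"
    "\<beta>1 = 0 \<or> 2 \<le> deg F1 \<and> homogeneous (deg F1 - 2) \<beta>1"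
    "F1 = lin V * \<alpha>1 + (lin U)\<^sup>2 * \<beta>1" "eval3 \<alpha>1 p = slope r F1"
    "2 * eval3 \<beta>1 p = eval3 (dir_deriv q (dir_deriv q F1)) p"
    using dec[of F1] br tan by blast
  obtain \<alpha>2 \<beta>2 where 2: "homogeneous (deg F2 - 1) \<alpha>2"
    "\<beta>2 = 0 \<or> 2 \<le> deg F2 \<and> homogeneous (deg F2 - 2) \<beta>2"
    "F2 = lin V * \<alpha>2 + (lin U)\<^sup>2 * \<beta>2" "eval3 \<alpha>2 p = slope r F2"
    "2 * eval3 \<beta>2 p = eval3 (dir_deriv q (dir_deriv q F2)) p"
    using dec[of F2] br tan by blast
  have R: "eval3 R p \<noteq> 0" using cofactor_nonzero unfolding R_def eval_rest .
  note hR = hom_rest[folded R_def]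
  have sl: "slope r F1 \<noteq> 0" "slope r F2 \<noteq> 0"
    using slope_nonzero[OF fr, of F1] slope_nonzero[OF fr, of F2] br tan by auto
  define d where "d = (\<Sum>F\<in>C - branches. deg F)"
  have N: "deg F1 + deg F2 + d = N" using degree_split br(2) unfolding br(1) d_def by simp
  have pos: "1 \<le> deg F1" "1 \<le> deg F2" using br deg_pos by (auto simp: curves_through_def)
  show ?thesis
  proof (rule local_conditions_tacnode[OF fr, where e = "N - 3"])
    have "homogeneous (d + (deg F1 - 1 + (deg F2 - 1))) (R * (\<alpha>1 * \<alpha>2))"
      unfolding d_def by (intro homogeneous_mult hR 1 2)
    moreover have "d + (deg F1 - 1 + (deg F2 - 1)) = Suc (N - 3)" using N pos \<open>3 \<le> N\<close> by linarith
    ultimately show "homogeneous (Suc (N - 3)) (R * (\<alpha>1 * \<alpha>2))" by (simp only:)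
    have "homogeneous (N - 3) (R * (\<alpha>1 * \<beta>2))"
    proof (cases "\<beta>2 = 0")
      case False
      then have "homogeneous (d + (deg F1 - 1 + (deg F2 - 2))) (R * (\<alpha>1 * \<beta>2))" "2 \<le> deg F2"
        using 2(2) homogeneous_mult[OF hR homogeneous_mult[OF 1(1), of "deg F2 - 2" \<beta>2]]
        unfolding d_def by blast+
      moreover from this have "d + (deg F1 - 1 + (deg F2 - 2)) = N - 3" using N pos by linarith
      ultimately show ?thesis by (simp only:)
    qed simp
    moreover have "homogeneous (N - 3) (R * (\<beta>1 * \<alpha>2))"
    proof (cases "\<beta>1 = 0")
      case False
      then have "homogeneous (d + (deg F1 - 2 + (deg F2 - 1))) (R * (\<beta>1 * \<alpha>2))" "2 \<le> deg F1"
        using 1(2) homogeneous_mult[OF hR homogeneous_mult[OF _ 2(1), of "deg F1 - 2" \<beta>1]]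
        unfolding d_def by blast+
      moreover from this have "d + (deg F1 - 2 + (deg F2 - 1)) = N - 3" using N pos by linarith
      ultimately show ?thesis by (simp only:)
    qed simp
    ultimately show "homogeneous (N - 3) (R * (\<alpha>1 * \<beta>2) + R * (\<beta>1 * \<alpha>2))"
      by (rule homogeneous_add)
    have "(\<Prod>F\<in>C. F) = F1 * F2 * R" using br(2) unfolding prod_split R_def br(1) by simp
    then show "(\<Prod>F\<in>C. F) = (lin V)\<^sup>2 * (R * (\<alpha>1 * \<alpha>2)) +
        lin V * (lin U)\<^sup>2 * (R * (\<alpha>1 * \<beta>2) + R * (\<beta>1 * \<alpha>2)) + lin U ^ 4 * (R * (\<beta>1 * \<beta>2))"
      unfolding 1(3) 2(3) by (simp only: power2_eq_square power4_eq_xxxx algebra_simps)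
    show "eval3 (R * (\<alpha>1 * \<alpha>2)) p \<noteq> 0" using R sl by (simp add: 1(4) 2(4))
    have "4 * ((eval3 (R * (\<alpha>1 * \<beta>2) + R * (\<beta>1 * \<alpha>2)) p)\<^sup>2
        - 4 * eval3 (R * (\<alpha>1 * \<alpha>2)) p * eval3 (R * (\<beta>1 * \<beta>2)) p)
        = (eval3 R p)\<^sup>2 * (slope r F1 * (2 * eval3 \<beta>2 p) - slope r F2 * (2 * eval3 \<beta>1 p))\<^sup>2"
      by (simp add: 1(4) 2(4) power2_eq_square algebra_simps)
    also have "\<dots> \<noteq> 0" using R jet by (simp add: 1(5) 2(5))
    finally show "(eval3 (R * (\<alpha>1 * \<beta>2) + R * (\<beta>1 * \<alpha>2)) p)\<^sup>2 \<noteq>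
        4 * eval3 (R * (\<alpha>1 * \<alpha>2)) p * eval3 (R * (\<beta>1 * \<beta>2)) p" by (auto simp only: diff_self mult_zero_right)
  qed fact
qed

end

lemma fps_mult_nth_4:
  fixes f g :: "complex fps"
  assumes "fps_nth f 0 = 0" "fps_nth f 1 = 0" "fps_nth g 0 = 0" "fps_nth g 1 = 0"
  shows "fps_nth (f * g) 4 = fps_nth f 2 * fps_nth g 2"
proof -
  have 4: "(4::nat) = Suc (Suc (Suc (Suc 0)))" by simp
  show ?thesis using assms by (simp add: fps_mult_nth 4 numeral_2_eq_2)
qed

lemma transversal_sym: "transversal g h \<Longrightarrow> transversal h g"
  by (simp add: transversal_def mult.commute)

context point_of_arrangement
begin

lemma slope_frame:
  assumes fr: "dual_frame p q r U V" and F: "F \<in> branches"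
  shows "slope z F = dot3 U z * slope q F + dot3 V z * slope r F"
proof -
  obtain a b where ab: "homogeneous (deg F - 1) a" "homogeneous (deg F - 1) b"
    "F = lin U * a + lin V * b" "eval3 a p = slope q F" "eval3 b p = slope r F"
    by (rule decompose_branch[OF fr F])
  have "slope z F = dot3 U z * eval3 a p + dot3 V z * eval3 b p"
    using fr by (subst ab(3)) (simp add: dir_deriv_add dir_deriv_mult dual_frame_def)
  then show ?thesis by (simp only: ab(4,5))
qed

text \<open>Both components have the common tangent of the branches. Along arcs with this velocity every factor
  vanishes to second order, with a leading coefficient that is affine in the second-order term of the
  arc. Comparing the coefficients of \<open>t\<^sup>4\<close> of the two factorisations shows that the roots of these
  affine functions are the same for the components as for the branches; for the branches they are
  distinct, since the intersection multiplicity is only \<open>2\<close>.\<close>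

lemma tangent_branches:
  assumes eq: "chart_equation q r (g1 * g2)" and sm: "smooth_branch g1" "smooth_branch g2"
    and tan: "\<not> transversal g1 g2" and im: "intersection_mult g1 g2 2"
    and N: "3 \<le> N" "2 \<le> j"
  shows "\<exists>F1 F2. F1 \<noteq> F2 \<and> branches = {F1, F2} \<and> tangent_at p F1 F2 \<and>
    local_conditions (\<Prod>F\<in>C. F) p j 3"
proof -
  define g where "g i = (if i = 0 then g1 else g2)" for i :: nat
  have g: "(\<Prod>i<2. g i) = g1 * g2" "\<And>i. i < 2 \<Longrightarrow> smooth_branch (g i)"
    using sm by (auto simp: g_def numeral_2_eq_2 less_Suc_eq)
  obtain F1 F2 where br: "branches = {F1, F2}" "F1 \<noteq> F2"
    using factored_line_arc(1)[of q r g 2] eq g by (auto simp: card_2_iff)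
  define a1 b1 where "a1 = germ_coeff g1 1 0" and "b1 = germ_coeff g1 0 1"
  define a2 b2 where "a2 = germ_coeff g2 1 0" and "b2 = germ_coeff g2 0 1"
  have prop12: "a1 * b2 = b1 * a2" using tan by (simp add: transversal_def a1_def b1_def a2_def b2_def)
  have nz1: "a1 \<noteq> 0 \<or> b1 \<noteq> 0" and nz2: "a2 \<noteq> 0 \<or> b2 \<noteq> 0"
    using sm by (auto simp: smooth_branch_def a1_def b1_def a2_def b2_def)
  from chart_frame[OF eq] obtain U V where fr: "dual_frame p q r U V" .
  have lead: "(a1 * s + b1 * t) * (a2 * s + b2 * t) =
      (slope q F1 * s + slope r F1 * t) * (slope q F2 * s + slope r F2 * t) * cofactor" for s t
    using factored_line_arc(2)[of q r g 2 s t] eq g br(2) unfolding br(1)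
    by (simp add: g_def numeral_2_eq_2 a1_def b1_def a2_def b2_def)
  have propl: "b1 * slope q F = a1 * slope r F" if "F \<in> branches" for F
  proof -
    have "(a1 * (- slope r F) + b1 * slope q F) * (a2 * (- slope r F) + b2 * slope q F) = 0"
      using that unfolding lead br(1) by auto
    moreover have "a1 * (- slope r F) + b1 * slope q F = 0"
      if 0: "a2 * (- slope r F) + b2 * slope q F = 0"
    proof -
      have "a2 * (a1 * (- slope r F) + b1 * slope q F) = a1 * (a2 * (- slope r F) + b2 * slope q F)"
        "b2 * (a1 * (- slope r F) + b1 * slope q F) = b1 * (a2 * (- slope r F) + b2 * slope q F)"
        using prop12 by (simp_all add: algebra_simps)
      then show ?thesis using nz2 unfolding 0 by auto
    qed
    ultimately have "a1 * (- slope r F) + b1 * slope q F = 0" unfolding mult_eq_0_iff by blast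
    then show ?thesis by (simp add: algebra_simps)
  qed
  obtain x y where xy: "a1 * x + b1 * y = 1"
    using nz1 that[of "1 / a1" 0] that[of 0 "1 / b1"] by auto
  \<comment> \<open>\<open>w\<close> spans the common tangent; the arcs below have velocity \<open>w\<close> and second-order term
    \<open>\<tau> r'\<close> for a varying \<open>\<tau>\<close>.\<close>
  define w where "w = (- b1) *s q + a1 *s r"
  define r' where "r' = x *s q + y *s r"
  have "(- b1) * y - a1 * x \<noteq> 0"
  proof -
    have "(- b1) * y - a1 * x = - (a1 * x + b1 * y)" by (simp add: algebra_simps)
    then show ?thesis unfolding xy by simp
  qed
  then obtain U' V' where fr': "dual_frame p w r' U' V'"
    unfolding w_def r'_def by (rule dual_frame_change[OF fr])
  have sw: "slope w F = 0" if "F \<in> branches" for F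
    using propl[OF that] unfolding w_def dir_deriv_lincomb by (simp add: algebra_simps)
  have sr': "slope r' F \<noteq> 0" if "F \<in> branches" for F
    using slope_nonzero[OF fr' that] sw[OF that] by simp
  define u where "u \<tau> = fps_const (- b1) * fps_X + fps_const (\<tau> * x) * fps_X ^ 2" for \<tau>
  define v where "v \<tau> = fps_const a1 * fps_X + fps_const (\<tau> * y) * fps_X ^ 2" for \<tau>
  have uv: "fps_nth (u \<tau>) 0 = 0" "fps_nth (v \<tau>) 0 = 0" "fps_nth (u \<tau>) 1 = - b1"
    "fps_nth (v \<tau>) 1 = a1" "fps_nth (u \<tau>) 2 = \<tau> * x" "fps_nth (v \<tau>) 2 = \<tau> * y" for \<tau>
    by (simp_all add: u_def v_def fps_X_power_iff)
  define K where "K F = eval3 (dir_deriv w (dir_deriv w F)) p" for F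
  define \<gamma> where "\<gamma> \<tau> = chart_arc p q r (u \<tau>) (v \<tau>)" for \<tau>
  have w1: "fps_nth (u \<tau>) 1 *s q + fps_nth (v \<tau>) 1 *s r = w" for \<tau> by (simp only: uv w_def)
  have w2: "fps_nth (u \<tau>) 2 *s q + fps_nth (v \<tau>) 2 *s r = (\<tau> * x) *s q + (\<tau> * y) *s r" for \<tau>
    by (simp only: uv)
  have \<gamma>_nth: "fps_nth (\<gamma> \<tau> F) 0 = eval3 F p" "fps_nth (\<gamma> \<tau> F) 1 = slope w F"
    "2 * fps_nth (\<gamma> \<tau> F) 2 = 2 * \<tau> * slope r' F + K F" for \<tau> F
    using chart_arc_nth[OF uv(1)[of \<tau>] uv(2)[of \<tau>], where p = p and q = q and r = r and f = F] unfolding \<gamma>_def w1 w2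
    by (simp_all only: dir_deriv_lincomb r'_def K_def) (simp add: algebra_simps)
  define \<kappa> where "\<kappa> h = germ_coeff h 2 0 * b1\<^sup>2 - germ_coeff h 1 1 * b1 * a1 + germ_coeff h 0 2 * a1\<^sup>2" for h
  define \<mu> where "\<mu> = a2 * x + b2 * y"
  have mu: "a2 = a1 * \<mu>" "b2 = b1 * \<mu>"
  proof -
    have "a1 * \<mu> = a2 * (a1 * x + b1 * y)" "b1 * \<mu> = b2 * (a1 * x + b1 * y)"
      using prop12 by (simp_all add: \<mu>_def algebra_simps)
    then show "a2 = a1 * \<mu>" "b2 = b1 * \<mu>" unfolding xy by simp_all
  qed
  have "\<mu> \<noteq> 0" using mu nz2 by auto
  have arc_g: "fps_nth (arc (u \<tau>) (v \<tau>) g1) 0 = 0" "fps_nth (arc (u \<tau>) (v \<tau>) g1) 1 = 0"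
    "fps_nth (arc (u \<tau>) (v \<tau>) g2) 0 = 0" "fps_nth (arc (u \<tau>) (v \<tau>) g2) 1 = 0"
    "fps_nth (arc (u \<tau>) (v \<tau>) g1) 2 = \<tau> + \<kappa> g1"
    "fps_nth (arc (u \<tau>) (v \<tau>) g2) 2 = \<tau> * \<mu> + \<kappa> g2" for \<tau>
  proof -
    show "fps_nth (arc (u \<tau>) (v \<tau>) g1) 0 = 0" "fps_nth (arc (u \<tau>) (v \<tau>) g2) 0 = 0"
      using sm by (simp_all add: arc_nth_0 smooth_branch_def)
    show "fps_nth (arc (u \<tau>) (v \<tau>) g1) 1 = 0" "fps_nth (arc (u \<tau>) (v \<tau>) g2) 1 = 0"
      unfolding arc_nth_1[OF uv(1)[of \<tau>] uv(2)[of \<tau>]] uv a1_def[symmetric] b1_def[symmetric]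
        a2_def[symmetric] b2_def[symmetric] by (simp_all add: mu)
    have "fps_nth (arc (u \<tau>) (v \<tau>) g1) 2 = \<tau> * (a1 * x + b1 * y) + \<kappa> g1"
      unfolding arc_nth_2[OF uv(1)[of \<tau>] uv(2)[of \<tau>]] uv a1_def[symmetric] b1_def[symmetric]
      by (simp add: \<kappa>_def algebra_simps)
    then show "fps_nth (arc (u \<tau>) (v \<tau>) g1) 2 = \<tau> + \<kappa> g1" unfolding xy by simp
    show "fps_nth (arc (u \<tau>) (v \<tau>) g2) 2 = \<tau> * \<mu> + \<kappa> g2"
      unfolding arc_nth_2[OF uv(1)[of \<tau>] uv(2)[of \<tau>]] uv a2_def[symmetric] b2_def[symmetric]
      by (simp add: \<kappa>_def \<mu>_def algebra_simps)
  qed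
  have key: "4 * ((\<tau> + \<kappa> g1) * (\<tau> * \<mu> + \<kappa> g2)) =
      (2 * \<tau> * slope r' F1 + K F1) * (2 * \<tau> * slope r' F2 + K F2) * cofactor" for \<tau>
  proof -
    define R where "R = (\<Prod>F\<in>C - branches. F)"
    have "(\<Prod>F\<in>C. F) = F1 * (F2 * R)"
      using br(2) unfolding prod_split R_def br(1) by (simp add: mult.assoc)
    then have "arc (u \<tau>) (v \<tau>) (g1 * g2) = \<gamma> \<tau> F1 * (\<gamma> \<tau> F2 * \<gamma> \<tau> R)"
      unfolding chart_equation_arc[OF eq uv(1)[of \<tau>] uv(2)[of \<tau>]] \<gamma>_def by (simp only: chart_arc_mult)
    then have "fps_nth (arc (u \<tau>) (v \<tau>) g1 * arc (u \<tau>) (v \<tau>) g2) 4 =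
        fps_nth (\<gamma> \<tau> F1 * (\<gamma> \<tau> F2 * \<gamma> \<tau> R)) 4"
      by (simp only: arc_mult[OF uv(1)[of \<tau>] uv(2)[of \<tau>]])
    also have "fps_nth (arc (u \<tau>) (v \<tau>) g1 * arc (u \<tau>) (v \<tau>) g2) 4 = (\<tau> + \<kappa> g1) * (\<tau> * \<mu> + \<kappa> g2)"
      by (subst fps_mult_nth_4) (simp_all only: arc_g)
    also have "fps_nth (\<gamma> \<tau> F1 * (\<gamma> \<tau> F2 * \<gamma> \<tau> R)) 4 =
        fps_nth (\<gamma> \<tau> F1) 2 * (fps_nth (\<gamma> \<tau> F2) 2 * cofactor)"
    proof -
      have F: "fps_nth (\<gamma> \<tau> F) 0 = 0" "fps_nth (\<gamma> \<tau> F) 1 = 0" if "F \<in> branches" for F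
        unfolding \<gamma>_nth using sw[OF that] that by (simp_all add: curves_through_def)
      have R: "fps_nth (\<gamma> \<tau> R) 0 = cofactor" unfolding \<gamma>_nth R_def eval_rest ..
      have F12: "F1 \<in> branches" "F2 \<in> branches" using br by auto
      show ?thesis
        by (subst fps_mult_nth_4)
          (simp_all only: F[OF F12(1)] F[OF F12(2)] R fps_mult_nth_0 fps_mult_nth_one fps_mult_nth_2
            mult_zero_left mult_zero_right add_0_left add_0_right)
    qed
    finally have "4 * ((\<tau> + \<kappa> g1) * (\<tau> * \<mu> + \<kappa> g2)) =
        (2 * fps_nth (\<gamma> \<tau> F1) 2) * (2 * fps_nth (\<gamma> \<tau> F2) 2) * cofactor" by simp
    then show ?thesis by (simp only: \<gamma>_nth)
  qed
  have F12: "F1 \<in> branches" "F2 \<in> branches" using br by auto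
  \<comment> \<open>Otherwise the right-hand side of \<open>key\<close> vanishes for one value of \<open>\<tau>\<close> only, and so does the
    left-hand side: a single arc then kills both branches to third order.\<close>
  have jet: "slope r' F1 * K F2 \<noteq> slope r' F2 * K F1"
  proof
    assume bad: "slope r' F1 * K F2 = slope r' F2 * K F1"
    have root: "2 * \<tau> * slope r' F1 + K F1 = 0" if "(\<tau> + \<kappa> g1) * (\<tau> * \<mu> + \<kappa> g2) = 0" for \<tau>
    proof -
      have "(2 * \<tau> * slope r' F1 + K F1) * (2 * \<tau> * slope r' F2 + K F2) = 0"
        using key[of \<tau>] cofactor_nonzero unfolding that by simp
      moreover have "slope r' F2 * (2 * \<tau> * slope r' F1 + K F1) =
          slope r' F1 * (2 * \<tau> * slope r' F2 + K F2)"
        using bad by (simp add: algebra_simps)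
      ultimately show ?thesis using sr'[OF F12(2)] by auto
    qed
    have "2 * (- \<kappa> g1) * slope r' F1 + K F1 = 0" by (rule root) simp
    moreover have "2 * (- \<kappa> g2 / \<mu>) * slope r' F1 + K F1 = 0"
      by (rule root) (simp add: \<open>\<mu> \<noteq> 0\<close>)
    ultimately have "2 * (- \<kappa> g1) * slope r' F1 = 2 * (- \<kappa> g2 / \<mu>) * slope r' F1"
      by (metis add_right_imp_eq)
    then have "2 * (- \<kappa> g1) = 2 * (- \<kappa> g2 / \<mu>)"
      using sr'[OF F12(1)] by (simp only: mult_cancel_right) simp
    then have eq12: "- \<kappa> g1 = - \<kappa> g2 / \<mu>" by (simp only: mult_cancel_left) simp
    define \<tau> where "\<tau> = - \<kappa> g1"
    have z1: "\<tau> + \<kappa> g1 = 0" by (simp add: \<tau>_def)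
    have z2: "\<tau> * \<mu> + \<kappa> g2 = 0" unfolding \<tau>_def eq12 using \<open>\<mu> \<noteq> 0\<close> by simp
    have k: "k = 0 \<or> k = 1 \<or> k = 2" if "k \<le> 2" for k :: nat using that by auto
    show False
    proof (rule intersection_mult_arc[OF im uv(1)[of \<tau>] uv(2)[of \<tau>]])
      show "fps_nth (u \<tau>) 1 \<noteq> 0 \<or> fps_nth (v \<tau>) 1 \<noteq> 0" unfolding uv using nz1 by auto
      show "fps_nth (arc (u \<tau>) (v \<tau>) g1) k = 0" if "k \<le> 2" for k
        using k[OF that] arc_g(1,2,5)[of \<tau>] z1 by metis
      show "fps_nth (arc (u \<tau>) (v \<tau>) g2) k = 0" if "k \<le> 2" for k
        using k[OF that] arc_g(3,4,6)[of \<tau>] z2 by metis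
    qed
  qed
  have "local_conditions (\<Prod>F\<in>C. F) p j 3"
    by (rule tacnode_conditions[OF fr' br sw[OF F12(1)] sw[OF F12(2)] _ N])
      (use jet in \<open>simp add: K_def\<close>)
  moreover have "tangent_at p F1 F2" unfolding tangent_at_def
  proof (intro exI conjI allI)
    show "slope r' F2 / slope r' F1 \<noteq> 0" using sr' F12 by simp
    show "slope z F2 = slope r' F2 / slope r' F1 * slope z F1" for z
      using sr'[OF F12(1)] slope_frame[OF fr' F12(1), of z] slope_frame[OF fr' F12(2), of z]
        sw[OF F12(1)] sw[OF F12(2)] by simp
  qed
  ultimately show ?thesis using br by blast
qed

lemma transversal_pair:
  assumes eq: "chart_equation q r (g1 * g2)" and sm: "smooth_branch g1" "smooth_branch g2"
    and tr: "transversal g1 g2"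
  shows "card branches = 2 \<and> local_conditions (\<Prod>F\<in>C. F) p j 1"
proof -
  define g where "g i = (if i = 0 then g1 else g2)" for i :: nat
  have g: "(\<Prod>i<2. g i) = g1 * g2" "\<And>i. i < 2 \<Longrightarrow> smooth_branch (g i)"
    using sm by (auto simp: g_def numeral_2_eq_2 less_Suc_eq)
  have gt: "transversal (g i) (g k)" if "i < 2" "k < 2" "i \<noteq> k" for i k
    using that tr transversal_sym[OF tr] by (auto simp: g_def)
  have eq': "chart_equation q r (\<Prod>i<2. g i)" unfolding g(1) by (rule eq)
  have card: "card branches = 2" by (rule factored_line_arc(1)[OF eq' g(2)])
  then obtain F1 F2 where br: "branches = {F1, F2}" "F1 \<noteq> F2" by (auto simp: card_2_iff)
  from chart_frame[OF eq] obtain U V where fr: "dual_frame p q r U V" .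
  have "slope q F1 * slope r F2 \<noteq> slope r F1 * slope q F2"
    by (rule transversal_branches[OF eq' g(2) gt]) (use br in auto)
  then show ?thesis using node_conditions[OF fr br] card by blast
qed

lemma transversal_triple:
  assumes eq: "chart_equation q r (g1 * g2 * g3)"
    and sm: "smooth_branch g1" "smooth_branch g2" "smooth_branch g3"
    and tr: "transversal g1 g2" "transversal g1 g3" "transversal g2 g3" and "2 \<le> j"
  shows "card branches = 3 \<and> local_conditions (\<Prod>F\<in>C. F) p j 4"
proof -
  define g where "g i = (if i = 0 then g1 else if i = 1 then g2 else g3)" for i :: nat
  have g: "(\<Prod>i<3. g i) = g1 * g2 * g3" "\<And>i. i < 3 \<Longrightarrow> smooth_branch (g i)"
    using sm by (simp_all add: g_def numeral_3_eq_3)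
  have gt: "transversal (g i) (g k)" if "i < 3" "k < 3" "i \<noteq> k" for i k
  proof -
    have "i \<in> {0, 1, 2}" "k \<in> {0, 1, 2}" using that by auto
    then show ?thesis using that(3) tr tr[THEN transversal_sym]
      by (elim insertE) (simp_all add: g_def)
  qed
  have eq': "chart_equation q r (\<Prod>i<3. g i)" unfolding g(1) by (rule eq)
  have card: "card branches = 3" by (rule factored_line_arc(1)[OF eq' g(2)])
  then obtain F1 F2 F3 where br: "branches = {F1, F2, F3}" "F1 \<noteq> F2" "F1 \<noteq> F3" "F2 \<noteq> F3"
    by (auto simp: card_3_iff)
  from chart_frame[OF eq] obtain U V where fr: "dual_frame p q r U V" .
  have "slope q F * slope r F' \<noteq> slope r F * slope q F'"
    if "F \<in> branches" "F' \<in> branches" "F \<noteq> F'" for F F'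
    by (rule transversal_branches[OF eq' g(2) gt that])
  then show ?thesis using triple_point_conditions[OF fr br] br card \<open>2 \<le> j\<close> by simp
qed

lemma singular_point_cases:
  assumes "node (\<Prod>F\<in>C. F) p \<or> tacnode (\<Prod>F\<in>C. F) p \<or> ordinary_triple_point (\<Prod>F\<in>C. F) p"
    and N: "3 \<le> N" "2 \<le> j"
  shows "card branches = 2 \<and> local_conditions (\<Prod>F\<in>C. F) p j 1 \<or>
    (\<exists>F1 F2. F1 \<noteq> F2 \<and> branches = {F1, F2} \<and> tangent_at p F1 F2 \<and>
      local_conditions (\<Prod>F\<in>C. F) p j 3) \<or>
    card branches = 3 \<and> local_conditions (\<Prod>F\<in>C. F) p j 4"
proof -
  have chart: "\<exists>q r. chart_equation q r h" if "local_equation (\<Prod>F\<in>C. F) p h" for h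
    using that by (simp add: local_equation_def chart_equation_def)
  consider "node (\<Prod>F\<in>C. F) p" | "tacnode (\<Prod>F\<in>C. F) p" | "ordinary_triple_point (\<Prod>F\<in>C. F) p"
    using assms(1) by blast
  then show ?thesis
  proof cases
    case 1
    then obtain g1 g2 where g: "local_equation (\<Prod>F\<in>C. F) p (g1 * g2)"
      "smooth_branch g1" "smooth_branch g2" "transversal g1 g2" unfolding node_def by blast
    from chart[OF g(1)] obtain q r where eq: "chart_equation q r (g1 * g2)" by blast
    show ?thesis using transversal_pair[OF eq g(2-4)] by simp
  next
    case 2
    then obtain g1 g2 where g: "local_equation (\<Prod>F\<in>C. F) p (g1 * g2)"
      "smooth_branch g1" "smooth_branch g2" "intersection_mult g1 g2 2"
      unfolding tacnode_def by blast
    from chart[OF g(1)] obtain q r where eq: "chart_equation q r (g1 * g2)" by blast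
    show ?thesis
    proof (cases "transversal g1 g2")
      case True
      then show ?thesis using transversal_pair[OF eq g(2,3)] by simp
    next
      case False
      then show ?thesis using tangent_branches[OF eq g(2,3) _ g(4) N] by simp
    qed
  next
    case 3
    then obtain g1 g2 g3 where g: "local_equation (\<Prod>F\<in>C. F) p (g1 * g2 * g3)"
      "smooth_branch g1" "smooth_branch g2" "smooth_branch g3"
      "transversal g1 g2" "transversal g1 g3" "transversal g2 g3"
      unfolding ordinary_triple_point_def by blast
    from chart[OF g(1)] obtain q r where eq: "chart_equation q r (g1 * g2 * g3)" by blast
    show ?thesis using transversal_triple[OF eq g(2-7) N(2)] by simp
  qed
qed

end

section \<open>Intersections of lines and conics\<close>

subsection \<open>Linear algebra in three-space\<close>

lemma dot3_axis [simp]: "dot3 (axis i 1) x = x $ i" "dot3 x (axis i 1) = x $ i"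
proof -
  have "(axis i 1 :: complex^3) $ l * x $ l = (if l = i then x $ l else 0)" for l
    by (simp add: axis_def)
  then show "dot3 (axis i 1) x = x $ i" by (simp add: dot3_def)
  then show "dot3 x (axis i 1) = x $ i" by (simp add: dot3_commute)
qed

lemma dot3_eqI: "(\<And>z. dot3 x z = dot3 y z) \<Longrightarrow> x = y"
  by (metis dot3_axis(2) vec_eq_iff)

lemma dot3_minus [simp]: "dot3 x (- y) = - dot3 x y"
  by (simp_all add: dot3_def sum_negf)

lemma basis_of_kernel:
  assumes p: "p \<noteq> 0" "dot3 a p = 0" and q: "dot3 a q = 1"
    and r: "dot3 a r = 0" "\<And>c. r \<noteq> c *s p"
  obtains x y where "z = x *s p + dot3 a z *s q + y *s r"
proof -
  define v where "v i = (if i = 0 then p else if i = 1 then q else if i = 2 then r else z)" for i :: nat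
  obtain u where u: "\<exists>i<4. u i \<noteq> 0" "\<And>k. (\<Sum>i<4. u i * v i $ k) = 0"
    using underdetermined_system[of "UNIV :: 3 set" "{..<4::nat}" "\<lambda>i k. v i $ k"] by auto
  have sum4: "(\<Sum>i<4. f i) = f 0 + f 1 + f 2 + f (3::nat)" for f :: "nat \<Rightarrow> complex"
    by (simp add: eval_nat_numeral)
  have rel: "u 0 *s p + u 1 *s q + u 2 *s r + u 3 *s z = 0"
    using u(2) unfolding sum4 by (simp add: vec_eq_iff v_def)
  have "dot3 a (u 0 *s p + u 1 *s q + u 2 *s r + u 3 *s z) = 0" unfolding rel by simp
  then have u1: "u 1 + u 3 * dot3 a z = 0" using p q r by simp
  have "u 3 \<noteq> 0"
  proof
    assume u3: "u 3 = 0"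
    then have pr: "u 0 *s p + u 2 *s r = 0" using rel u1 by simp
    have "u 2 = 0"
    proof (rule ccontr)
      assume "u 2 \<noteq> 0"
      then have "r = (- u 0 / u 2) *s p" using pr
        by (auto simp: vec_eq_iff field_simps add_eq_0_iff)
      then show False using r(2) by blast
    qed
    then have "u 0 = 0" using pr p(1) by (auto simp: vec_eq_iff)
    have "i = 0 \<or> i = 1 \<or> i = 2 \<or> i = 3" if "i < 4" for i :: nat using that by auto
    then show False using u(1) u1 u3 \<open>u 2 = 0\<close> \<open>u 0 = 0\<close> by (metis add.right_neutral mult_zero_left)
  qed
  have "z $ k = ((- u 0 / u 3) *s p + dot3 a z *s q + (- u 2 / u 3) *s r) $ k" for k
  proof -
    have "u 0 * p $ k + u 1 * q $ k + u 2 * r $ k + u 3 * z $ k = 0"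
      using arg_cong[OF rel, of "\<lambda>x. x $ k"] by simp
    moreover have "u 1 = - (u 3 * dot3 a z)" using u1 by (simp add: eq_neg_iff_add_eq_0)
    ultimately have "u 3 * z $ k = u 3 * (dot3 a z * q $ k) - u 0 * p $ k - u 2 * r $ k"
      by (simp add: algebra_simps)
    then have "z $ k = (u 3 * (dot3 a z * q $ k) - u 0 * p $ k - u 2 * r $ k) / u 3"
      using \<open>u 3 \<noteq> 0\<close> by (simp add: eq_divide_eq mult.commute)
    then show ?thesis using \<open>u 3 \<noteq> 0\<close> by (simp add: diff_divide_distrib)
  qed
  then have "z = (- u 0 / u 3) *s p + dot3 a z *s q + (- u 2 / u 3) *s r"
    unfolding vec_eq_iff by blast
  then show thesis by (rule that)
qed

lemma ex_dot3_eq_1: "a \<noteq> 0 \<Longrightarrow> \<exists>q. dot3 a q = 1"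
proof -
  assume "a \<noteq> 0"
  then obtain i where "a $ i \<noteq> 0" by (auto simp: vec_eq_iff)
  then have "dot3 a ((1 / a $ i) *s axis i 1) = 1" by simp
  then show ?thesis by blast
qed

lemma ex_second_kernel_vector:
  assumes a: "a \<noteq> 0"
  shows "\<exists>r. dot3 a r = 0 \<and> (\<forall>c. r \<noteq> c *s p)"
proof (rule ccontr)
  assume no: "\<not> ?thesis"
  obtain q where q: "dot3 a q = 1" using ex_dot3_eq_1[OF a] by blast
  have "\<exists>c. e = dot3 a e *s q + c *s p" for e
  proof -
    have "dot3 a (e - dot3 a e *s q) = 0" using q by simp
    then obtain c where "e - dot3 a e *s q = c *s p" using no by blast
    then show ?thesis by (metis diff_eq_eq add.commute)
  qed
  then obtain c where c: "e = dot3 a e *s q + c e *s p" for e by metis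
  obtain u where u: "\<exists>i\<in>UNIV. u i \<noteq> 0" "\<forall>m\<in>{0, 1::nat}. (\<Sum>i\<in>(UNIV::3 set).
      u i * (if m = 0 then dot3 a (axis i 1) else c (axis i 1))) = 0"
    using underdetermined_system[of "{0, 1::nat}" "UNIV :: 3 set"
        "\<lambda>i m. if m = 0 then dot3 a (axis i 1) else c (axis i 1)"] by auto
  have 0: "(\<Sum>i\<in>UNIV. u i * dot3 a (axis i 1)) = 0" "(\<Sum>i\<in>UNIV. u i * c (axis i 1)) = 0"
    using u(2) by auto
  have "u k = 0" for k
  proof -
    have "u k = (\<Sum>i\<in>UNIV. u i * (axis i 1 :: complex^3) $ k)"
    proof -
      have "u i * (axis i 1 :: complex^3) $ k = (if i = k then u i else 0)" for i
        by (simp add: axis_def)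
      then show ?thesis by simp
    qed
    also have "\<dots> = (\<Sum>i\<in>UNIV. u i * (dot3 a (axis i 1) * q $ k + c (axis i 1) * p $ k))"
    proof -
      have "(axis i 1 :: complex^3) $ k = dot3 a (axis i 1) * q $ k + c (axis i 1) * p $ k" for i
        using arg_cong[OF c[of "axis i 1"], of "\<lambda>x. x $ k"] by simp
      then show ?thesis by simp
    qed
    also have "\<dots> = (\<Sum>i\<in>UNIV. u i * dot3 a (axis i 1)) * q $ k + (\<Sum>i\<in>UNIV. u i * c (axis i 1)) * p $ k"
      by (simp add: distrib_left sum.distrib sum_distrib_right mult.assoc)
    also have "\<dots> = 0" unfolding 0 by simp
    finally show ?thesis .
  qed
  then show False using u(1) by simp
qed

subsection \<open>Nondegenerate symmetric matrices\<close>

definition bil :: "complex^3^3 \<Rightarrow> complex^3 \<Rightarrow> complex^3 \<Rightarrow> complex" where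
  "bil A x y = dot3 (A *v x) y"

definition conic_matrix :: "complex^3^3 \<Rightarrow> bool" where
  "conic_matrix A \<longleftrightarrow> transpose A = A \<and> (\<forall>x. A *v x = 0 \<longrightarrow> x = 0)"

lemma bil_simps [simp]:
  "bil A (x + y) z = bil A x z + bil A y z" "bil A x (y + z) = bil A x y + bil A x z"
  "bil A (c *s x) z = c * bil A x z" "bil A x (c *s z) = c * bil A x z"
  "bil A (x - y) z = bil A x z - bil A y z" "bil A x (y - z) = bil A x y - bil A x z"
  "bil A 0 x = 0" "bil A x 0 = 0"
  by (simp_all add: bil_def matrix_vector_right_distrib matrix_vector_mult_diff_distrib
      vector_scalar_commute)

lemma bil_commute:
  assumes "transpose A = A" shows "bil A x y = bil A y x"
proof -
  have "A $ i $ j = A $ j $ i" for i j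
    using arg_cong[OF assms, of "\<lambda>M. M $ i $ j"] by (simp add: transpose_def)
  from this[of 1 2] this[of 1 3] this[of 2 3] show ?thesis
    by (simp add: bil_def dot3_def matrix_vector_mult_def sum_3 algebra_simps)
qed

text \<open>If \<open>p\<close> and \<open>r\<close> were orthogonal, then \<open>A *v p\<close> and \<open>A *v r\<close> would both vanish on the plane spanned by
  \<open>p\<close> and \<open>r\<close>, and so be proportional.\<close>

lemma no_isotropic_plane:
  assumes A: "conic_matrix A" and p: "p \<noteq> 0" "bil A p p = 0" and r: "\<And>c. r \<noteq> c *s p" "bil A r r = 0"
  shows "bil A p r \<noteq> 0"
proof
  assume 0: "bil A p r = 0"
  note sym = bil_commute[of A, OF conjunct1[OF A[unfolded conic_matrix_def]]]
  have ker: "x = 0" if "A *v x = 0" for x using A that by (simp add: conic_matrix_def)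
  define a where "a = A *v p"
  have "a \<noteq> 0" using p ker by (auto simp: a_def)
  then obtain q where q: "dot3 a q = 1" using ex_dot3_eq_1 by blast
  have ab: "dot3 a z = bil A p z" for z by (simp add: a_def bil_def)
  have "A *v (r - bil A r q *s p) = 0"
  proof (rule dot3_eqI)
    fix z
    obtain x y where z: "z = x *s p + dot3 a z *s q + y *s r"
      by (rule basis_of_kernel[of p a q r z]) (use p q r 0 ab in auto)
    have "bil A (r - bil A r q *s p) z = 0"
      by (subst z) (use p q r 0 sym[of r p] in \<open>simp add: ab algebra_simps\<close>)
    then show "dot3 (A *v (r - bil A r q *s p)) z = dot3 0 z" by (simp add: bil_def)
  qed
  then have "r - bil A r q *s p = 0" by (rule ker)
  then show False using r(1) by simp
qed

text \<open>Every conic with a point is \<open>ac = b\<^sup>2\<close> in suitable coordinates; it is parametrised by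
  \<open>t\<^sup>2 X + t Y + W\<close>, with the given point \<open>X\<close> at \<open>t = \<infinity>\<close>.\<close>

definition conic_basis :: "complex^3^3 \<Rightarrow> complex^3 \<Rightarrow> complex^3 \<Rightarrow> complex^3 \<Rightarrow> bool" where
  "conic_basis A X Y W \<longleftrightarrow> (\<forall>z. \<exists>a b c. z = a *s X + b *s Y + c *s W) \<and>
     bil A X X = 0 \<and> bil A X Y = 0 \<and> bil A Y W = 0 \<and> bil A W W = 0 \<and>
     bil A Y Y = - 2 * bil A X W \<and> bil A X W \<noteq> 0"

lemma conic_basis_exists:
  assumes A: "conic_matrix A" and p: "p \<noteq> 0" "bil A p p = 0"
  obtains k Y W where "k \<noteq> 0" "conic_basis A (k *s p) Y W"
proof -
  note sym = bil_commute[of A, OF conjunct1[OF A[unfolded conic_matrix_def]]]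
  define a where "a = A *v p"
  have ab: "dot3 a z = bil A p z" for z by (simp add: a_def bil_def)
  have "a \<noteq> 0" using p A by (auto simp: a_def conic_matrix_def)
  then obtain q r where q: "dot3 a q = 1" and r: "dot3 a r = 0" "\<And>c. r \<noteq> c *s p"
    using ex_dot3_eq_1 ex_second_kernel_vector by blast
  have rr: "bil A r r \<noteq> 0"
    using no_isotropic_plane[OF A p r(2)] r(1) by (auto simp: ab)
  have pq: "bil A p q = 1" "bil A q p = 1" "bil A p r = 0" "bil A r p = 0"
    using q r sym by (auto simp: ab)
  define Y where "Y = (2 * bil A q r) *s p - 2 *s r"
  define W where "W = bil A q q *s p - 2 *s q"
  have span: "\<exists>x b c. z = x *s (bil A r r *s p) + b *s Y + c *s W" for z
  proof -
    obtain x y where z: "z = x *s p + dot3 a z *s q + y *s r"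
      by (rule basis_of_kernel[of p a q r z]) (use p q r ab in auto)
    define b where "b = - y / 2"
    define c where "c = - dot3 a z / 2"
    define x' where "x' = (x - b * (2 * bil A q r) - c * bil A q q) / bil A r r"
    have "x' * bil A r r = x - b * (2 * bil A q r) - c * bil A q q" using rr by (simp add: x'_def)
    then have x': "x' * bil A r r * p $ i =
        x * p $ i - b * (2 * bil A q r) * p $ i - c * bil A q q * p $ i" for i
      by (simp add: left_diff_distrib)
    have "(x' *s (bil A r r *s p) + b *s Y + c *s W) $ i =
        (x *s p + dot3 a z *s q + y *s r) $ i" for i
      using x'[of i] by (simp add: Y_def W_def b_def c_def algebra_simps)
    then have "z = x' *s (bil A r r *s p) + b *s Y + c *s W"
      unfolding z[symmetric] by (simp add: vec_eq_iff)
    then show ?thesis by blast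
  qed
  show thesis
  proof (rule that[of "bil A r r" Y W])
    show "conic_basis A (bil A r r *s p) Y W"
      unfolding conic_basis_def using span p pq rr sym[of r q]
      by (auto simp: Y_def W_def algebra_simps)
  qed (rule rr)
qed

lemma conic_point_parametrized:
  assumes cb: "conic_basis A X Y W" and A: "conic_matrix A" and z: "bil A z z = 0" "\<And>c. z \<noteq> c *s X"
  obtains k t where "k \<noteq> 0" "z = k *s (t\<^sup>2 *s X + t *s Y + W)"
proof -
  note sym = bil_commute[of A, OF conjunct1[OF A[unfolded conic_matrix_def]]]
  obtain a b c where abc: "z = a *s X + b *s Y + c *s W"
    using cb unfolding conic_basis_def by blast
  have cb': "bil A X X = 0" "bil A X Y = 0" "bil A Y X = 0" "bil A Y W = 0" "bil A W Y = 0"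
    "bil A W W = 0" "bil A Y Y = - 2 * bil A X W" "bil A W X = bil A X W" "bil A X W \<noteq> 0"
    using cb sym by (auto simp: conic_basis_def)
  have "2 * bil A X W * (a * c - b\<^sup>2) = bil A z z"
    by (simp add: abc cb' power2_eq_square algebra_simps)
  then have ac: "a * c = b\<^sup>2" using z(1) cb'(9) by simp
  have "c \<noteq> 0"
  proof
    assume "c = 0"
    then have "z = a *s X" using ac abc by simp
    then show False using z(2) by blast
  qed
  then have "a = c * (b / c)\<^sup>2" "b = c * (b / c)"
    using ac by (simp_all add: power2_eq_square field_simps)
  then have "z = c *s ((b / c)\<^sup>2 *s X + (b / c) *s Y + W)"
    by (subst abc) (simp add: vec_eq_iff algebra_simps)
  then show thesis using \<open>c \<noteq> 0\<close> by (rule that[rotated])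
qed

text \<open>The restriction of the quadratic form of \<open>B\<close> to the curve \<open>t\<^sup>2 X + t Y + W\<close>.\<close>

definition quartic where
  "quartic B X Y W = [:bil B W W, 2 * bil B Y W, 2 * bil B X W + bil B Y Y, 2 * bil B X Y, bil B X X:]"

lemma poly_quartic:
  assumes "transpose B = B"
  shows "poly (quartic B X Y W) t = bil B (t\<^sup>2 *s X + t *s Y + W) (t\<^sup>2 *s X + t *s Y + W)"
    "poly (pderiv (quartic B X Y W)) t =
      2 * bil B (t\<^sup>2 *s X + t *s Y + W) ((2 * t) *s X + Y)"
  using bil_commute[OF assms, of W X] bil_commute[OF assms, of W Y] bil_commute[OF assms, of Y X]
  by (simp_all add: quartic_def pderiv_pCons power2_eq_square algebra_simps)

text \<open>Restricted to the parametrisation of \<open>A\<close>, the form \<open>B\<close> is a polynomial in \<open>t\<close> with all its values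
  zero. The vanishing of its five coefficients gives the linear equations that \<open>A\<close> itself satisfies in
  this basis, and these determine a form up to a factor.\<close>

lemma conic_determined_by_points:
  assumes A: "conic_matrix A" and B: "transpose B = B"
    and p: "p \<noteq> 0" "bil A p p = 0" and sub: "\<And>z. bil A z z = 0 \<Longrightarrow> bil B z z = 0"
  obtains c where "\<And>x y. bil B x y = c * bil A x y"
proof -
  note symA = bil_commute[of A, OF conjunct1[OF A[unfolded conic_matrix_def]]]
  note symB = bil_commute[OF B]
  obtain k Y W where "k \<noteq> 0" and cb: "conic_basis A (k *s p) Y W"
    by (rule conic_basis_exists[OF A p])
  define X where "X = k *s p"
  have cbA: "bil A X X = 0" "bil A X Y = 0" "bil A Y W = 0" "bil A W W = 0"
    "bil A Y Y = - 2 * bil A X W" "bil A X W \<noteq> 0"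
    and span: "\<exists>a b c. z = a *s X + b *s Y + c *s W" for z
    using cb unfolding X_def[symmetric] by (auto simp: conic_basis_def)
  have "transpose A = A" using A by (simp add: conic_matrix_def)
  have "poly (quartic A X Y W) t = 0" for t by (simp add: quartic_def cbA)
  then have "poly (quartic B X Y W) t = 0" for t
    unfolding poly_quartic[OF B] poly_quartic[OF \<open>transpose A = A\<close>] by (rule sub)
  then have "quartic B X Y W = 0" using poly_all_0_iff_0 by blast
  then have cbB: "bil B X X = 0" "bil B X Y = 0" "bil B Y W = 0" "bil B W W = 0"
    "2 * bil B X W + bil B Y Y = 0"
    by (simp_all add: quartic_def)
  define c where "c = bil B X W / bil A X W"
  have XW: "bil B X W = c * bil A X W" using cbA by (simp add: c_def)
  have YY: "bil B Y Y = c * bil A Y Y" using cbB(5) unfolding cbA(5) XW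
    by (simp add: eq_neg_iff_add_eq_0 algebra_simps)
  have "bil B x y = c * bil A x y" for x y
  proof -
    obtain x1 x2 x3 where x: "x = x1 *s X + x2 *s Y + x3 *s W" using span by blast
    obtain y1 y2 y3 where y: "y = y1 *s X + y2 *s Y + y3 *s W" using span by blast
    show ?thesis
      using symA[of Y X] symA[of W X] symA[of W Y] symB[of Y X] symB[of W X] symB[of W Y]
      by (simp add: x y cbA(1-4) cbB(1-4) XW YY algebra_simps)
  qed
  then show thesis by (rule that)
qed

lemma card_roots_with_double_roots:
  fixes P :: "complex poly"
  assumes "P \<noteq> 0" "finite R" "\<And>t. t \<in> R \<Longrightarrow> poly P t = 0"
    and "D \<subseteq> R" "\<And>t. t \<in> D \<Longrightarrow> poly (pderiv P) t = 0"
  shows "card R + card D \<le> degree P"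
proof -
  have finD: "finite D" using assms(2,4) finite_subset by blast
  have ord: "(if t \<in> D then 2 else 1) \<le> order t P" if "t \<in> R" for t
  proof -
    have 1: "order t P \<noteq> 0" using \<open>t \<in> R\<close> assms(1,3) by (simp add: order_root)
    moreover have "order t P \<noteq> 1" if "t \<in> D"
    proof
      assume o1: "order t P = 1"
      have "degree P \<noteq> 0" using 1 assms(1) order_degree[OF assms(1), of t] by simp
      then have "pderiv P \<noteq> 0" by (simp add: pderiv_eq_0_iff)
      then have "order t P = Suc (order t (pderiv P))" 
        using order_pderiv[OF assms(1) assms(3)[OF \<open>t \<in> R\<close>]] by simp
      then have "order t (pderiv P) = 0" using o1 by simp
      then show False using assms(5)[OF that] \<open>pderiv P \<noteq> 0\<close> by (simp add: order_root)
    qed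
    ultimately show ?thesis by (auto simp: numeral_2_eq_2)
  qed
  have "card R + card D = (\<Sum>t\<in>R. if t \<in> D then 2 else 1)"
  proof -
    have "R \<inter> D = D" using assms(4) by blast
    then have "(\<Sum>t\<in>R. (if t \<in> D then 2 else 1) :: nat) = 2 * card D + card (R - D)"
      using assms(2) by (simp add: sum.If_cases Collect_neg_eq[symmetric] Diff_eq mult.commute)
    also have "card (R - D) = card R - card D" by (rule card_Diff_subset[OF finD assms(4)])
    finally show ?thesis using card_mono[OF assms(2,4)] by simp
  qed
  also have "\<dots> \<le> (\<Sum>t\<in>R. order t P)" by (rule sum_mono) (rule ord)
  also have "\<dots> \<le> (\<Sum>t | poly P t = 0. order t P)"
    by (rule sum_mono2) (use assms poly_roots_finite in auto)
  also have "\<dots> \<le> degree P" by (rule sum_order_le_degree[OF assms(1)])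
  finally show ?thesis .
qed

definition projective_points :: "(complex^3) set \<Rightarrow> bool" where
  "projective_points Z \<longleftrightarrow> (\<forall>z\<in>Z. z \<noteq> 0) \<and> (\<forall>z\<in>Z. \<forall>z'\<in>Z. \<forall>c. z' = c *s z \<longrightarrow> z' = z)"

lemma projective_pointsD:
  assumes "projective_points Z" "z \<in> Z"
  shows "z \<noteq> 0" "z' \<in> Z \<Longrightarrow> z' = c *s z \<Longrightarrow> z' = z"
  using assms unfolding projective_points_def by blast+

text \<open>Restricted to the parametrised conic \<open>A\<close>, the form of \<open>B\<close> is a quartic polynomial in \<open>t\<close>. The
  point \<open>X\<close> at infinity is chosen outside \<open>B\<close>, so that the degree is exactly \<open>4\<close> and no common point
  escapes; at a point of tangency the derivative along the conic vanishes too, which makes the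
  root a double one.\<close>

lemma conic_conic_intersection:
  assumes A: "conic_matrix A" and B: "conic_matrix B"
    and ne: "\<not> (\<exists>c. \<forall>x y. bil B x y = c * bil A x y)"
    and Z: "projective_points Z" "\<And>z. z \<in> Z \<Longrightarrow> bil A z z = 0 \<and> bil B z z = 0"
    and T: "T \<subseteq> Z" "\<And>z. z \<in> T \<Longrightarrow> \<exists>c. \<forall>w. bil B z w = c * bil A z w"
  shows "finite Z \<and> card Z + card T \<le> 4"
proof (cases "Z = {}")
  case True
  then show ?thesis using T by simp
next
  case False
  then obtain z0 where "z0 \<in> Z" by blast
  then have z0: "z0 \<noteq> 0" "bil A z0 z0 = 0" using Z by (auto simp: projective_points_def)
  have symA: "transpose A = A" and symB: "transpose B = B"
    using A B by (auto simp: conic_matrix_def)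
  have "\<exists>p. bil A p p = 0 \<and> bil B p p \<noteq> 0"
    using conic_determined_by_points[OF A symB z0] ne by metis
  then obtain p where p: "bil A p p = 0" "bil B p p \<noteq> 0" by blast
  then have "p \<noteq> 0" by auto
  then obtain k Y W where k: "k \<noteq> 0" and cb: "conic_basis A (k *s p) Y W"
    by (rule conic_basis_exists[OF A _ p(1)])
  define X where "X = k *s p"
  note cb = cb[folded X_def]
  define \<gamma> where "\<gamma> t = t\<^sup>2 *s X + t *s Y + W" for t
  have "bil B X X \<noteq> 0" using p k by (simp add: X_def)
  then have P: "quartic B X Y W \<noteq> 0" "degree (quartic B X Y W) = 4"
    by (simp_all add: quartic_def)
  have "z \<noteq> c *s X" if "z \<in> Z" for z c
  proof
    assume "z = c *s X"
    then have "c = 0" using Z(2)[OF that] \<open>bil B X X \<noteq> 0\<close> by simp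
    then show False using \<open>z = c *s X\<close> Z(1) that by (auto simp: projective_points_def)
  qed
  then have "\<exists>k t. k \<noteq> 0 \<and> z = k *s \<gamma> t" if "z \<in> Z" for z
    using conic_point_parametrized[OF cb A, of z] Z(2)[OF that] that unfolding \<gamma>_def by metis
  then obtain l \<tau> where \<tau>: "l z \<noteq> 0" "z = l z *s \<gamma> (\<tau> z)" if "z \<in> Z" for z by metis
  have inj: "inj_on \<tau> Z"
  proof (rule inj_onI)
    fix z z' assume zz: "z \<in> Z" "z' \<in> Z" "\<tau> z = \<tau> z'"
    then have "z' = l z' *s \<gamma> (\<tau> z)" using \<tau>(2)[of z'] by simp
    also have "\<gamma> (\<tau> z) = (1 / l z) *s z" using \<tau>[OF zz(1)]
      by (metis divide_self_if times_divide_eq_left mult_1 vector_smult_assoc vector_smult_lid)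
    finally have "z' = (l z' * (1 / l z)) *s z" by (simp only: vector_smult_assoc)
    then show "z = z'" by (rule projective_pointsD(2)[OF Z(1) zz(1,2), symmetric])
  qed
  have root: "poly (quartic B X Y W) (\<tau> z) = 0" if "z \<in> Z" for z
  proof -
    have "bil B (l z *s \<gamma> (\<tau> z)) (l z *s \<gamma> (\<tau> z)) = 0" using \<tau>(2)[OF that] Z(2)[OF that] by simp
    then have "bil B (\<gamma> (\<tau> z)) (\<gamma> (\<tau> z)) = 0" using \<tau>(1)[OF that] by simp
    then show ?thesis unfolding poly_quartic[OF symB] \<gamma>_def .
  qed
  have double: "poly (pderiv (quartic B X Y W)) (\<tau> z) = 0" if "z \<in> T" for z
  proof -
    have zZ: "z \<in> Z" using that T by blast
    obtain c where c: "\<And>w. bil B z w = c * bil A z w" using T(2)[OF \<open>z \<in> T\<close>] by blast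
    define w where "w = (2 * \<tau> z) *s X + Y"
    have "quartic A X Y W = 0" using cb by (simp add: quartic_def conic_basis_def)
    then have "poly (pderiv (quartic A X Y W)) (\<tau> z) = 0" by simp
    then have "bil A (\<gamma> (\<tau> z)) w = 0"
      unfolding poly_quartic[OF symA] \<gamma>_def[symmetric] w_def[symmetric] by simp
    then have "bil A z w = 0" by (subst \<tau>(2)[OF zZ]) simp
    then have "bil B (l z *s \<gamma> (\<tau> z)) w = 0" using c \<tau>(2)[OF zZ] by simp
    then have "bil B (\<gamma> (\<tau> z)) w = 0" using \<tau>(1)[OF zZ] by simp
    then show ?thesis unfolding poly_quartic[OF symB] \<gamma>_def w_def by simp
  qed
  have "finite (\<tau> ` Z)"
    by (rule finite_subset[OF _ poly_roots_finite[OF P(1)]]) (use root in auto)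
  then have fin: "finite Z" using inj finite_imageD by blast
  have "card (\<tau> ` Z) + card (\<tau> ` T) \<le> 4"
    unfolding P(2)[symmetric]
    by (rule card_roots_with_double_roots[OF P(1)]) (use fin root double T in auto)
  then show ?thesis using inj fin card_image inj_on_subset[OF inj T(1)] by metis
qed

text \<open>By \<open>no_isotropic_plane\<close> no two points of the conic on the line are orthogonal with respect to \<open>A\<close>.
  This excludes a second point beside a point of tangency, where \<open>A *v z\<close> is a multiple of \<open>a\<close>, and a
  third point beside two others, of which it would be a linear combination.\<close>

lemma conic_line_intersection:
  assumes A: "conic_matrix A" and a: "a \<noteq> 0"
    and Z: "projective_points Z" "\<And>z. z \<in> Z \<Longrightarrow> bil A z z = 0 \<and> dot3 a z = 0"
    and T: "T \<subseteq> Z" "\<And>z. z \<in> T \<Longrightarrow> \<exists>c. \<forall>w. bil A z w = c * dot3 a w"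
  shows "finite Z \<and> card Z + card T \<le> 2"
proof -
  have nz: "bil A z z' \<noteq> 0" if "z \<in> Z" "z' \<in> Z" "z \<noteq> z'" for z z'
  proof (rule no_isotropic_plane[OF A])
    show "z' \<noteq> c *s z" for c using projective_pointsD(2)[OF Z(1) that(1,2)] that(3) by metis
  qed (use projective_pointsD(1)[OF Z(1) that(1)] Z(2) that in auto)
  have nt: "Z = {z}" if "z \<in> T" for z
  proof -
    have "z' = z" if "z' \<in> Z" for z'
    proof (rule ccontr)
      assume "z' \<noteq> z"
      then have "bil A z z' \<noteq> 0" using nz[of z z'] T(1) \<open>z \<in> T\<close> \<open>z' \<in> Z\<close> by blast
      moreover obtain c where "bil A z z' = c * dot3 a z'" using T(2)[OF \<open>z \<in> T\<close>] by blast
      ultimately show False using Z(2)[OF \<open>z' \<in> Z\<close>] by simp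
    qed
    then show ?thesis using that T by blast
  qed
  show ?thesis
  proof (cases "T = {}")
    case False
    then obtain z where "z \<in> T" by blast
    then have "Z = {z}" "T = {z}" using nt T(1) by auto
    then show ?thesis by simp
  next
    case True
    have no3: False if d: "z1 \<in> Z" "z2 \<in> Z" "z3 \<in> Z" "z1 \<noteq> z2" "z1 \<noteq> z3" "z2 \<noteq> z3" for z1 z2 z3
    proof -
      have ind: "z2 \<noteq> c *s z1" "z3 \<noteq> c *s z1" "z3 \<noteq> c *s z2" "z1 \<noteq> 0" for c
        using projective_pointsD[OF Z(1) d(1)] projective_pointsD[OF Z(1) d(2)] d by metis+
      obtain q where q: "dot3 a q = 1" using ex_dot3_eq_1[OF a] by blast
      obtain x y where xy: "z3 = x *s z1 + dot3 a z3 *s q + y *s z2"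
        by (rule basis_of_kernel[of z1 a q z2 z3]) (use ind Z(2) d q in auto)
      then have z3: "z3 = x *s z1 + y *s z2" using Z(2)[OF d(3)] by simp
      have "bil A z1 z2 = bil A z2 z1" using A by (simp add: conic_matrix_def bil_commute)
      then have "2 * (x * y * bil A z1 z2) = bil A z3 z3"
        using Z(2) d by (simp add: z3 algebra_simps)
      then have "x = 0 \<or> y = 0" using Z(2)[OF d(3)] nz[OF d(1,2,4)] by auto
      then show False by (elim disjE) (use z3 ind(3)[of y] ind(2)[of x] in simp_all)
    qed
    have "card Z \<le> 2 \<and> finite Z"
    proof (rule ccontr)
      assume "\<not> (card Z \<le> 2 \<and> finite Z)"
      then have "\<exists>S\<subseteq>Z. finite S \<and> card S = 3"
        by (metis infinite_arbitrarily_large not_less_eq_eq numeral_2_eq_2 numeral_3_eq_3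
            obtain_subset_with_card_n)
      then obtain S where "S \<subseteq> Z" "card S = 3" by blast
      then obtain z1 z2 z3 where "S = {z1, z2, z3}" "z1 \<noteq> z2" "z1 \<noteq> z3" "z2 \<noteq> z3"
        by (auto simp: card_3_iff)
      then show False using no3[of z1 z2 z3] \<open>S \<subseteq> Z\<close> by blast
    qed
    then show ?thesis using True by simp
  qed
qed

lemma line_line_intersection:
  assumes a: "a \<noteq> 0" and b: "\<And>c. b \<noteq> c *s a"
    and Z: "projective_points Z" "\<And>z. z \<in> Z \<Longrightarrow> dot3 a z = 0 \<and> dot3 b z = 0"
  shows "finite Z \<and> card Z \<le> 1"
proof -
  have "z1 = z2" if z: "z1 \<in> Z" "z2 \<in> Z" for z1 z2
  proof (rule ccontr)
    assume "z1 \<noteq> z2"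
    then have ind: "z2 \<noteq> c *s z1" "z1 \<noteq> 0" for c
      using projective_pointsD[OF Z(1) z(1)] z(2) by metis+
    obtain q where q: "dot3 a q = 1" using ex_dot3_eq_1[OF a] by blast
    have "b = dot3 b q *s a"
    proof (rule dot3_eqI)
      fix w
      obtain x y where w: "w = x *s z1 + dot3 a w *s q + y *s z2"
        by (rule basis_of_kernel[of z1 a q z2 w]) (use ind Z(2) z q in auto)
      show "dot3 b w = dot3 (dot3 b q *s a) w"
        by (subst w) (use Z(2) z in \<open>simp add: mult.commute\<close>)
    qed
    then show False using b by blast
  qed
  then have "Z \<subseteq> {z}" if "z \<in> Z" for z using that by blast
  then have "Z = {} \<or> (\<exists>z. Z = {z})" by blast
  then show ?thesis by auto
qed

subsection \<open>The forms of lines and conics\<close>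

lemma line_form_lin:
  assumes "line_form l" obtains a where "a \<noteq> 0" "l = lin a"
proof -
  have h: "homogeneous 1 l" and "l \<noteq> 0" using assms by (auto simp: line_form_def)
  define a :: "complex^3" where "a = (\<chi> i. eval3 (partial i l) 0)"
  have "partial i l = cst (a $ i)" for i
    using homogeneous_0_const[of "partial i l" 0] homogeneous_partial[OF h, of i] by (simp add: a_def)
  then have "l = lin a" using euler[OF h] by (simp add: lin_def mult.commute)
  moreover from this have "a \<noteq> 0" using \<open>l \<noteq> 0\<close> by (auto simp: lin_def)
  ultimately show thesis using that by blast
qed

lemma partial_commute: "partial i (partial j f) = partial j (partial i f)"
proof (induction f rule: cpoly3_induct)
  case (var k)
  have "partial i 1 = 0" for i using partial_cst[of i 1] by simp
  moreover have "partial i 0 = 0" for i using partial_cst[of i 0] by simp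
  ultimately show ?case by simp
next
  case (cst c)
  have "partial i 0 = 0" for i using partial_cst[of i 0] by simp
  then show ?case by simp
qed (simp_all add: partial_add partial_mult algebra_simps)

text \<open>The Hessian matrix of a quadratic form is constant, so it may be evaluated at the origin.\<close>

definition hess :: "cpoly3 \<Rightarrow> complex^3^3" where
  "hess q = (\<chi> i j. eval3 (partial j (partial i q)) 0)"

lemma transpose_hess: "transpose (hess q) = hess q"
  by (simp add: hess_def transpose_def partial_commute)

lemma eval_partial_quadratic:
  assumes "homogeneous 2 q" shows "eval3 (partial i q) x = (hess q *v x) $ i"
proof -
  have h: "homogeneous 1 (partial i q)" using homogeneous_partial[OF assms, of i] by simp
  have "eval3 (partial j (partial i q)) x = hess q $ i $ j" for j
    using homogeneous_0_const[of "partial j (partial i q)" 0] homogeneous_partial[OF h, of j]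
    by (metis (no_types, lifting) diff_self_eq_0 eval3_simps(7) hess_def vec_lambda_beta)
  then have "(\<Sum>j\<in>UNIV. x $ j * hess q $ i $ j) = eval3 (partial i q) x"
    using arg_cong[OF euler[OF h], of "\<lambda>g. eval3 g x"] by simp
  then show ?thesis by (simp add: matrix_vector_mult_def mult.commute)
qed

lemma eval_dir_deriv_quadratic:
  "homogeneous 2 q \<Longrightarrow> eval3 (dir_deriv w q) x = bil (hess q) x w"
  by (simp add: dir_deriv_def eval_partial_quadratic bil_def dot3_def mult.commute)

lemma eval_quadratic: "homogeneous 2 q \<Longrightarrow> 2 * eval3 q x = bil (hess q) x x"
  using eval_euler[of 2 q x] by (simp add: eval_dir_deriv_quadratic)

lemma smooth_conic_matrix:
  assumes "smooth_conic_form q" shows "conic_matrix (hess q)"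
  unfolding conic_matrix_def
proof (intro conjI allI impI transpose_hess)
  fix x assume 0: "hess q *v x = 0"
  have h: "homogeneous 2 q" using assms by (simp add: smooth_conic_form_def)
  show "x = 0"
  proof (rule ccontr)
    assume "x \<noteq> 0"
    moreover have "eval3 q x = 0" using eval_quadratic[OF h, of x] 0 by (simp add: bil_def)
    moreover have "eval3 (partial i q) x = 0" for i using eval_partial_quadratic[OF h] 0 by simp
    ultimately have "singular_point q x" by (simp add: singular_point_def zero_locus_def)
    then show False using assms by (simp add: smooth_conic_form_def)
  qed
qed

lemma proportional_conics_same_locus:
  assumes q: "smooth_conic_form q" "smooth_conic_form q'"
    and prp: "\<And>x y. bil (hess q') x y = c * bil (hess q) x y"
  shows "zero_locus q = zero_locus q'"
proof -
  have h: "homogeneous 2 q" "homogeneous 2 q'" using q by (auto simp: smooth_conic_form_def)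
  have "c \<noteq> 0"
  proof
    assume "c = 0"
    then have "hess q' *v x = 0" for x using prp by (intro dot3_eqI) (simp add: bil_def)
    then have "axis 1 1 = (0 :: complex^3)"
      using smooth_conic_matrix[OF q(2)] by (simp add: conic_matrix_def)
    then show False by (metis axis_eq_0_iff zero_neq_one)
  qed
  have "eval3 q' x = c * eval3 q x" for x
  proof -
    have "2 * eval3 q' x = c * (2 * eval3 q x)"
      unfolding eval_quadratic[OF h(1)] eval_quadratic[OF h(2)] by (rule prp)
    then show ?thesis by simp
  qed
  then show ?thesis using \<open>c \<noteq> 0\<close> by (simp add: zero_locus_def)
qed

lemma proportional_lines_same_locus:
  assumes "b = c *s a" "b \<noteq> 0" shows "zero_locus (lin a) = zero_locus (lin b)"
  using assms by (auto simp: zero_locus_def)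

subsection \<open>Dual conics\<close>

lemma dual_conic_matrix:
  assumes "conic_matrix A"
  obtains A' where "A ** A' = mat 1" "A' ** A = mat 1" "conic_matrix A'"
proof -
  have tA: "transpose A = A" using assms by (simp add: conic_matrix_def)
  obtain A' where A': "A' ** A = mat 1"
    using assms matrix_left_invertible_ker[of A] by (auto simp: conic_matrix_def)
  then have A'': "A ** A' = mat 1" using matrix_left_right_inverse by blast
  have "transpose A' = A'"
  proof -
    have "transpose A' ** A = transpose (A ** A')" by (simp add: matrix_transpose_mul tA)
    also have "\<dots> = mat 1" by (simp add: A'' transpose_mat)
    finally have "transpose A' ** A ** A' = A'" by (simp add: matrix_mul_lid)
    then show ?thesis by (simp add: A'' matrix_mul_rid flip: matrix_mul_assoc)
  qed
  moreover have "x = 0" if "A' *v x = 0" for x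
    using arg_cong[OF that, of "\<lambda>y. A *v y"]
    by (simp add: matrix_vector_mul_assoc A'' matrix_vector_mul_lid)
  ultimately show thesis using that[OF A'' A'] by (simp add: conic_matrix_def)
qed

text \<open>\<open>M\<close> is a set of common tangent lines of two conics, \<open>S\<close> a set of points where the conics
  are tangent to each other. The tangent line at such a point is a common point of the two dual
  conics, at which these are tangent as well.\<close>

lemma common_tangents:
  assumes A: "conic_matrix A" and B: "conic_matrix B"
    and ne: "\<not> (\<exists>c. \<forall>x y. bil B x y = c * bil A x y)"
    and M: "projective_points M"
      "\<And>a. a \<in> M \<Longrightarrow> \<exists>p c. A *v p = c *s a \<and> dot3 a p = 0 \<and> p \<noteq> 0"
      "\<And>a. a \<in> M \<Longrightarrow> \<exists>p c. B *v p = c *s a \<and> dot3 a p = 0 \<and> p \<noteq> 0"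
    and S: "projective_points S" "\<And>p. p \<in> S \<Longrightarrow> bil A p p = 0"
      "\<And>p. p \<in> S \<Longrightarrow> \<exists>c. B *v p = c *s (A *v p)"
    and MS: "\<And>a p. a \<in> M \<Longrightarrow> p \<in> S \<Longrightarrow> dot3 a p \<noteq> 0"
  shows "finite M \<and> card M + 2 * card S \<le> 4"
proof -
  obtain A' where A': "A ** A' = mat 1" "A' ** A = mat 1" "conic_matrix A'"
    by (rule dual_conic_matrix[OF A])
  obtain B' where B': "B ** B' = mat 1" "B' ** B = mat 1" "conic_matrix B'"
    by (rule dual_conic_matrix[OF B])
  have inv: "A' *v (A *v x) = x" "A *v (A' *v x) = x" "B' *v (B *v x) = x" "B *v (B' *v x) = x" for x
    unfolding matrix_vector_mul_assoc A' B' by (rule matrix_vector_mul_lid)+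
  have kerA: "A *v x \<noteq> 0" and kerB: "B *v x \<noteq> 0" if "x \<noteq> 0" for x
    using that A B unfolding conic_matrix_def by blast+
  have iso: "bil C' a a = 0"
    if "\<And>x. C' *v (C *v x) = x" "C *v p = c *s a" "dot3 a p = 0" "C *v p \<noteq> 0" for C C' a p c
  proof -
    have "c \<noteq> 0" using that(2,4) by auto
    have p: "p = c *s (C' *v a)"
      using that(1)[of p] unfolding that(2) vector_scalar_commute by (rule sym)
    have "dot3 a (c *s (C' *v a)) = 0" unfolding p[symmetric] by (rule that(3))
    then have "dot3 a (C' *v a) = 0" using \<open>c \<noteq> 0\<close> by simp
    then show ?thesis unfolding bil_def by (subst dot3_commute)
  qed
  define D where "D = (\<lambda>p. A *v p) ` S"
  have S0: "p \<noteq> 0" if "p \<in> S" for p using projective_pointsD(1)[OF S(1) that] .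
  have injD: "inj_on (\<lambda>p. A *v p) S"
  proof (rule inj_onI)
    fix x y assume "A *v x = A *v y"
    then have "A' *v (A *v x) = A' *v (A *v y)" by (rule arg_cong)
    then show "x = y" by (simp only: inv)
  qed
  have disj: "a \<noteq> c *s (A *v p)" if "a \<in> M" "p \<in> S" for a p c
    using MS[OF that] S(2)[OF that(2)] by (auto simp: bil_def)
  have disj': "A *v p \<noteq> c *s a" if "a \<in> M" "p \<in> S" for a p c
  proof
    assume eq: "A *v p = c *s a"
    then have "c \<noteq> 0" using kerA[OF S0[OF that(2)]] by auto
    moreover have "c * dot3 a p = 0" using S(2)[OF that(2)] by (simp add: bil_def eq)
    ultimately show False using MS[OF that] by simp
  qed
  have "finite (M \<union> D) \<and> card (M \<union> D) + card D \<le> 4"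
  proof (rule conic_conic_intersection[OF A'(3) B'(3)])
    show "\<not> (\<exists>c. \<forall>x y. bil B' x y = c * bil A' x y)"
    proof
      assume "\<exists>c. \<forall>x y. bil B' x y = c * bil A' x y"
      then obtain c where c: "\<And>x y. bil B' x y = c * bil A' x y" by blast
      have c': "B' *v x = c *s (A' *v x)" for x
        using c by (intro dot3_eqI) (simp add: bil_def)
      have AB: "A *v y = c *s (B *v y)" for y
      proof -
        have "B *v (B' *v (A *v y)) = B *v (c *s (A' *v (A *v y)))" by (simp only: c')
        then show ?thesis by (simp only: vector_scalar_commute inv)
      qed
      have "c \<noteq> 0" using AB[of "axis 1 1"] kerA[of "axis 1 1"] by (auto simp: axis_eq_0_iff)
      then have "bil B x y = (1 / c) * bil A x y" for x y by (simp add: bil_def AB)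
      then show False using ne by blast
    qed
    show "projective_points (M \<union> D)"
      unfolding projective_points_def
    proof (intro conjI ballI allI impI)
      show "z \<noteq> 0" if "z \<in> M \<union> D" for z
        using that projective_pointsD(1)[OF M(1)] S0 kerA by (auto simp: D_def)
    next
      fix z z' c assume z: "z \<in> M \<union> D" "z' \<in> M \<union> D" "z' = c *s z"
      show "z' = z"
      proof (cases "z \<in> M"; cases "z' \<in> M")
        assume "z \<in> M" "z' \<in> M"
        then show ?thesis using projective_pointsD(2)[OF M(1)] z(3) by blast
      next
        assume m: "z \<in> M" "z' \<notin> M"
        then obtain p where p: "p \<in> S" "z' = A *v p" using z by (auto simp: D_def)
        then have "A *v p = c *s z" using z(3) by simp
        then show ?thesis using disj'[OF m(1) p(1)] by blast
      next
        assume m: "z \<notin> M" "z' \<in> M"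
        then obtain p where p: "p \<in> S" "z = A *v p" using z by (auto simp: D_def)
        then have "z' = c *s (A *v p)" using z(3) by simp
        then show ?thesis using disj[OF m(2) p(1)] by blast
      next
        assume "z \<notin> M" "z' \<notin> M"
        then obtain p p' where p: "p \<in> S" "z = A *v p" "p' \<in> S" "z' = A *v p'"
          using z by (auto simp: D_def)
        have "A' *v (A *v p') = A' *v (c *s (A *v p))" using z(3) p by (simp only:)
        then have "p' = c *s p" by (simp only: vector_scalar_commute inv)
        then have "p' = p" using projective_pointsD(2)[OF S(1)] p by blast
        then show ?thesis using p by simp
      qed
    qed
    show "bil A' z z = 0 \<and> bil B' z z = 0" if "z \<in> M \<union> D" for z
    proof (cases "z \<in> M")
      case True
      obtain p c where "A *v p = c *s z" "dot3 z p = 0" "p \<noteq> 0" using M(2)[OF True] by blast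
      then have "bil A' z z = 0" using iso[of A' A, OF inv(1)] kerA by blast
      moreover obtain p c where "B *v p = c *s z" "dot3 z p = 0" "p \<noteq> 0"
        using M(3)[OF True] by blast
      then have "bil B' z z = 0" using iso[of B' B, OF inv(3)] kerB by blast
      ultimately show ?thesis by simp
    next
      case False
      then obtain p where p: "p \<in> S" "z = A *v p" using \<open>z \<in> M \<union> D\<close> False by (auto simp: D_def)
      have "dot3 z p = 0" using S(2)[OF p(1)] by (simp add: p(2) bil_def)
      moreover obtain c where "B *v p = c *s z" using S(3)[OF p(1)] p(2) by blast
      moreover have "A *v p = 1 *s z" by (simp add: p(2))
      ultimately show ?thesis
        using iso[of A' A, OF inv(1)] iso[of B' B, OF inv(3)] kerA kerB S0[OF p(1)] by blast
    qed
    show "\<exists>c. \<forall>w. bil B' z w = c * bil A' z w" if "z \<in> D" for z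
    proof -
      obtain p where p: "p \<in> S" "z = A *v p" using \<open>z \<in> D\<close> by (auto simp: D_def)
      obtain c where c: "B *v p = c *s z" using S(3)[OF p(1)] p(2) by blast
      then have "c \<noteq> 0" using kerB[OF S0[OF p(1)]] by auto
      have "p = c *s (B' *v z)"
        using inv(3)[of p] unfolding c vector_scalar_commute by (rule sym)
      moreover have "A' *v z = p" using inv(1) p(2) by simp
      ultimately have "bil A' z w = c * bil B' z w" for w by (simp add: bil_def)
      then have "bil B' z w = (1 / c) * bil A' z w" for w using \<open>c \<noteq> 0\<close> by simp
      then show ?thesis by blast
    qed
  qed simp
  then have fin: "finite M" "finite D" and le: "card (M \<union> D) + card D \<le> 4" by auto
  have "M \<inter> D = {}" using disj[of _ _ 1] by (auto simp: D_def)
  then have "card (M \<union> D) = card M + card D" by (rule card_Un_disjoint[OF fin])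
  moreover have "card D = card S" unfolding D_def by (rule card_image[OF injD])
  ultimately show ?thesis using fin le by simp
qed

section \<open>Counting singular points\<close>

text \<open>The first nonzero coordinate is \<open>1\<close>: this picks one vector for every projective point.\<close>

definition normalized :: "complex^3 \<Rightarrow> bool" where
  "normalized p \<longleftrightarrow> p $ 1 = 1 \<or> p $ 1 = 0 \<and> p $ 2 = 1 \<or> p $ 1 = 0 \<and> p $ 2 = 0 \<and> p $ 3 = 1"

lemma normalized_nonzero: "normalized p \<Longrightarrow> p \<noteq> 0"
  by (auto simp: normalized_def)

lemma normalized_unique: "normalized p \<Longrightarrow> normalized p' \<Longrightarrow> p' = c *s p \<Longrightarrow> p' = p"
  by (auto simp: normalized_def vec_eq_iff forall_3)

lemma normalized_exists:
  assumes "p \<noteq> 0" obtains c where "c \<noteq> 0" "normalized (c *s p)"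
proof -
  consider "p $ 1 \<noteq> 0" | "p $ 1 = 0" "p $ 2 \<noteq> 0" | "p $ 1 = 0" "p $ 2 = 0" "p $ 3 \<noteq> 0"
    using assms by (auto simp: vec_eq_iff forall_3)
  then show thesis
  proof cases
    case 1
    then show ?thesis by (intro that[of "1 / p $ 1"]) (auto simp: normalized_def)
  next
    case 2
    then show ?thesis by (intro that[of "1 / p $ 2"]) (auto simp: normalized_def)
  next
    case 3
    then show ?thesis by (intro that[of "1 / p $ 3"]) (auto simp: normalized_def)
  qed
qed

lemma normalized_projective: "(\<And>p. p \<in> Z \<Longrightarrow> normalized p) \<Longrightarrow> projective_points Z"
  unfolding projective_points_def using normalized_nonzero normalized_unique by blast

lemma eval3_hom_part_nonzero:
  assumes "eval3 h p \<noteq> 0" shows "\<exists>n. eval3 (hom_part n h) p \<noteq> 0"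
proof -
  obtain N where N: "hom_part n h = 0" if "N \<le> n" for n using hom_part_eq_0_large[of h] by blast
  have "h = (\<Sum>n<N. hom_part n h)"
  proof (rule poly_mapping_eqI)
    fix m
    have "(\<Sum>n<N. Poly_Mapping.lookup (hom_part n h) m) =
        (\<Sum>n<N. if n = total_deg m then Poly_Mapping.lookup h m else 0)"
      by (rule sum.cong) (auto simp: lookup_hom_part)
    also have "\<dots> = Poly_Mapping.lookup h m"
    proof (cases "total_deg m < N")
      case False
      then have "Poly_Mapping.lookup (hom_part (total_deg m) h) m = 0" using N by simp
      then show ?thesis using False by (simp add: lookup_hom_part)
    qed simp
    finally show "Poly_Mapping.lookup h m = Poly_Mapping.lookup (\<Sum>n<N. hom_part n h) m"
      by (simp add: lookup_sum)
  qed
  then have "eval3 h p = (\<Sum>n<N. eval3 (hom_part n h) p)" by (metis eval3_sum)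
  then show ?thesis using assms by (metis sum.neutral)
qed

lemma sum_card_swap:
  assumes "finite X" "finite Y"
  shows "(\<Sum>y\<in>Y. card {x\<in>X. R x y}) = (\<Sum>x\<in>X. card {y\<in>Y. R x y})"
proof -
  have "card {x\<in>X. R x y} = (\<Sum>x\<in>X. if R x y then 1 else 0)" for y
    using assms(1) by (simp add: sum.If_cases Int_def)
  moreover have "card {y\<in>Y. R x y} = (\<Sum>y\<in>Y. if R x y then 1 else 0)" for x
    using assms(2) by (simp add: sum.If_cases Int_def)
  ultimately show ?thesis by (simp add: sum.swap[of _ X Y])
qed

locale arrangement =
  fixes d k :: nat and L Q :: "cpoly3 set"
  assumes cla: "conic_line_arrangement d k L Q" and degree_12: "2 * k + d = 12"
    and types: "\<And>p. singular_point (arrangement_form L Q) p \<Longrightarrow>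
         node (arrangement_form L Q) p \<or> tacnode (arrangement_form L Q) p \<or>
         ordinary_triple_point (arrangement_form L Q) p"
begin

definition C where "C = L \<union> Q"

definition deg where "deg F = (if F \<in> L then 1 else 2 :: nat)"

abbreviation f where "f \<equiv> arrangement_form L Q"

lemma fin: "finite L" "finite Q" "finite C" "card L = d" "card Q = k"
  using cla by (auto simp: conic_line_arrangement_def C_def)

lemma line: "l \<in> L \<Longrightarrow> line_form l" and conic: "q \<in> Q \<Longrightarrow> smooth_conic_form q"
  using cla by (auto simp: conic_line_arrangement_def)

lemma disjoint: "L \<inter> Q = {}"
proof -
  have False if "F \<in> L" "F \<in> Q" for F
    using line[OF that(1)] conic[OF that(2)] hom_part_homogeneous[of 1 F 1] hom_part_homogeneous[of 2 F 1]
    by (simp add: line_form_def smooth_conic_form_def)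
  then show ?thesis by blast
qed

lemma deg_simps: "l \<in> L \<Longrightarrow> deg l = 1" "q \<in> Q \<Longrightarrow> deg q = 2"
  using disjoint by (auto simp: deg_def)

lemma f_prod: "f = (\<Prod>F\<in>C. F)"
  using prod.union_disjoint[OF fin(1,2) disjoint, of "\<lambda>F. F"] by (simp add: arrangement_form_def C_def)

lemma hom: "F \<in> C \<Longrightarrow> homogeneous (deg F) F"
  using line conic by (auto simp: C_def deg_simps line_form_def smooth_conic_form_def)

lemma deg_sum: "(\<Sum>F\<in>C. deg F) = 12"
proof -
  have "(\<Sum>F\<in>C. deg F) = (\<Sum>F\<in>L. deg F) + (\<Sum>F\<in>Q. deg F)"
    unfolding C_def by (rule sum.union_disjoint[OF fin(1,2) disjoint])
  then show ?thesis using degree_12 fin by (simp add: deg_simps)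
qed

lemma f_hom: "homogeneous 12 f"
  unfolding f_prod deg_sum[symmetric] by (rule homogeneous_prod[OF fin(3) hom])

lemma line_vector: "l \<in> L \<Longrightarrow> \<exists>a. a \<noteq> 0 \<and> l = lin a"
  using line line_form_lin by metis

lemma conic_facts:
  assumes "q \<in> Q"
  shows "homogeneous 2 q" "conic_matrix (hess q)" "eval3 (dir_deriv w q) x = bil (hess q) x w"
    "eval3 q x = 0 \<longleftrightarrow> bil (hess q) x x = 0"
proof -
  show h: "homogeneous 2 q" using conic[OF assms] by (simp add: smooth_conic_form_def)
  show "conic_matrix (hess q)" by (rule smooth_conic_matrix[OF conic[OF assms]])
  show "eval3 (dir_deriv w q) x = bil (hess q) x w" by (rule eval_dir_deriv_quadratic[OF h])
  show "eval3 q x = 0 \<longleftrightarrow> bil (hess q) x x = 0" using eval_quadratic[OF h, of x] by auto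
qed

lemma point:
  assumes "p \<noteq> 0" shows "point_of_arrangement C deg p 12"
proof
  show "finite C" by (rule fin)
  show "(\<Sum>F\<in>C. deg F) = 12" by (rule deg_sum)
  fix F assume F: "F \<in> C"
  show "homogeneous (deg F) F" by (rule hom[OF F])
  show "1 \<le> deg F" by (simp add: deg_def)
  show "\<exists>w. eval3 (dir_deriv w F) p \<noteq> 0" if "eval3 F p = 0"
  proof (cases "F \<in> L")
    case True
    then obtain a where a: "a \<noteq> 0" "F = lin a" using line_vector by blast
    obtain w where "dot3 a w = 1" using ex_dot3_eq_1[OF a(1)] by blast
    then show ?thesis by (intro exI[of _ w]) (simp add: a)
  next
    case False
    then have q: "F \<in> Q" using F by (simp add: C_def)
    then have "hess F *v p \<noteq> 0" using conic_facts(2)[OF q] assms by (auto simp: conic_matrix_def)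
    then obtain w where "dot3 (hess F *v p) w = 1" using ex_dot3_eq_1 by blast
    then show ?thesis using conic_facts(3)[OF q] by (intro exI[of _ w]) (simp add: bil_def)
  qed
qed

abbreviation br where "br \<equiv> curves_through C"

lemma br_finite: "finite (br p)"
  using fin by (simp add: curves_through_def)

definition P where "P = {p. normalized p \<and> singular_point f p}"

definition tacs where
  "tacs = {p\<in>P. (\<exists>F1 F2. F1 \<noteq> F2 \<and> br p = {F1, F2} \<and> tangent_at p F1 F2) \<and> local_conditions f p 15 3}"

text \<open>The subtraction of the tacnodes makes the three kinds of points a partition of \<open>P\<close> by
  definition, independently of whether the germs could fit two kinds at once.\<close>

definition nodes where
  "nodes = {p\<in>P. card (br p) = 2 \<and> local_conditions f p 15 1} - tacs"

definition trips where
  "trips = {p\<in>P. card (br p) = 3 \<and> local_conditions f p 15 4}"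

lemma P_nonzero: "p \<in> P \<Longrightarrow> p \<noteq> 0"
  by (simp add: P_def normalized_nonzero)

lemma nodes_card: "p \<in> nodes \<Longrightarrow> card (br p) = 2"
  and tacs_card: "p \<in> tacs \<Longrightarrow> card (br p) = 2"
  and trips_card: "p \<in> trips \<Longrightarrow> card (br p) = 3"
  by (auto simp: nodes_def tacs_def trips_def)

lemma P_split: "P = nodes \<union> tacs \<union> trips" "nodes \<inter> tacs = {}" "(nodes \<union> tacs) \<inter> trips = {}"
proof -
  have "p \<in> nodes \<union> tacs \<union> trips" if p: "p \<in> P" for p
  proof -
    interpret point_of_arrangement C deg p 12 by (rule point[OF P_nonzero[OF p]])
    have "node f p \<or> tacnode f p \<or> ordinary_triple_point f p" using p types by (simp add: P_def)
    from singular_point_cases[OF this[unfolded f_prod], of 15] p show ?thesis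
      unfolding f_prod[symmetric] by (auto simp: nodes_def tacs_def trips_def)
  qed
  then show "P = nodes \<union> tacs \<union> trips" by (auto simp: nodes_def tacs_def trips_def)
  show "nodes \<inter> tacs = {}" by (auto simp: nodes_def)
  show "(nodes \<union> tacs) \<inter> trips = {}" using tacs_card by (auto simp: nodes_def trips_def)
qed

lemma P_cases: "p \<in> P \<Longrightarrow> p \<in> nodes \<or> p \<in> tacs \<or> p \<in> trips"
  using P_split(1) by blast

lemma tangent_at_sym: "tangent_at p F F' \<Longrightarrow> tangent_at p F' F"
proof -
  assume "tangent_at p F F'"
  then obtain c where c: "c \<noteq> 0" "\<And>w. eval3 (dir_deriv w F') p = c * eval3 (dir_deriv w F) p"
    by (auto simp: tangent_at_def)
  then have "eval3 (dir_deriv w F) p = (1 / c) * eval3 (dir_deriv w F') p" for w by simp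
  then show "tangent_at p F' F" using c(1) unfolding tangent_at_def by (intro exI[of _ "1 / c"]) auto
qed

lemma tacs_pair:
  assumes "p \<in> tacs" "F \<in> br p" "F' \<in> br p" "F \<noteq> F'"
  shows "br p = {F, F'}" "tangent_at p F F'"
proof -
  obtain F1 F2 where "br p = {F1, F2}" "tangent_at p F1 F2" using assms(1) by (auto simp: tacs_def)
  then show "br p = {F, F'}" "tangent_at p F F'" using assms tangent_at_sym by auto
qed

subsection \<open>Bezout inequalities for the components\<close>

definition meet where "meet X F F' = {p\<in>X. F \<in> br p \<and> F' \<in> br p}"

lemma meet_commute: "meet X F F' = meet X F' F"
  by (auto simp: meet_def)

lemma meet_projective: "X \<subseteq> P \<Longrightarrow> projective_points (meet X F F')"
  by (rule normalized_projective) (auto simp: meet_def P_def)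

lemma tacs_P: "tacs \<subseteq> P"
  by (auto simp: tacs_def)

lemma meet_line_line:
  assumes l: "l \<in> L" "l' \<in> L" "l \<noteq> l'"
  shows "finite (meet P l l') \<and> card (meet P l l') + card (meet tacs l l') \<le> 1"
proof -
  obtain a b where ab: "a \<noteq> 0" "l = lin a" "b \<noteq> 0" "l' = lin b" using l line_vector by metis
  have np: "b \<noteq> c *s a" for c
  proof
    assume "b = c *s a"
    then have "zero_locus l = zero_locus l'" using ab proportional_lines_same_locus by blast
    then show False using cla l by (auto simp: conic_line_arrangement_def inj_on_def)
  qed
  have "meet tacs l l' = {}"
  proof (rule equals0I)
    fix p assume p: "p \<in> meet tacs l l'"
    then have "tangent_at p l l'" using tacs_pair(2) l(3) by (auto simp: meet_def)
    then obtain c where "\<And>w. dot3 b w = c * dot3 a w" by (auto simp: tangent_at_def ab)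
    then have "b = c *s a" by (intro dot3_eqI) simp
    then show False using np by blast
  qed
  moreover have "finite (meet P l l') \<and> card (meet P l l') \<le> 1"
    by (rule line_line_intersection[OF ab(1) np meet_projective[OF order_refl]])
      (auto simp: meet_def curves_through_def ab)
  ultimately show ?thesis by simp
qed

lemma meet_line_conic:
  assumes l: "l \<in> L" and q: "q \<in> Q"
  shows "finite (meet P l q) \<and> card (meet P l q) + card (meet tacs l q) \<le> 2"
proof -
  obtain a where a: "a \<noteq> 0" "l = lin a" using l line_vector by blast
  show ?thesis
  proof (rule conic_line_intersection[OF conic_facts(2)[OF q] a(1) meet_projective[OF order_refl]])
    show "bil (hess q) z z = 0 \<and> dot3 a z = 0" if "z \<in> meet P l q" for z
      using that conic_facts(4)[OF q] by (auto simp: meet_def curves_through_def a)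
    show "meet tacs l q \<subseteq> meet P l q" using tacs_P by (auto simp: meet_def)
    show "\<exists>c. \<forall>w. bil (hess q) z w = c * dot3 a w" if "z \<in> meet tacs l q" for z
    proof -
      have "l \<noteq> q" using l q disjoint by blast
      then have "tangent_at z l q" using that tacs_pair(2) by (auto simp: meet_def)
      then show ?thesis by (auto simp: tangent_at_def a conic_facts(3)[OF q])
    qed
  qed
qed

lemma conics_not_proportional:
  assumes "q \<in> Q" "q' \<in> Q" "q \<noteq> q'"
  shows "\<not> (\<exists>c. \<forall>x y. bil (hess q') x y = c * bil (hess q) x y)"
proof
  assume "\<exists>c. \<forall>x y. bil (hess q') x y = c * bil (hess q) x y"
  then have "zero_locus q = zero_locus q'"
    using proportional_conics_same_locus[OF conic[OF assms(1)] conic[OF assms(2)]] by blast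
  then show False using cla assms by (auto simp: conic_line_arrangement_def inj_on_def)
qed

lemma meet_conic_conic:
  assumes q: "q \<in> Q" "q' \<in> Q" "q \<noteq> q'"
  shows "finite (meet P q q') \<and> card (meet P q q') + card (meet tacs q q') \<le> 4"
proof (rule conic_conic_intersection[OF conic_facts(2)[OF q(1)] conic_facts(2)[OF q(2)]
      conics_not_proportional[OF q] meet_projective[OF order_refl]])
  show "bil (hess q) z z = 0 \<and> bil (hess q') z z = 0" if "z \<in> meet P q q'" for z
    using that conic_facts(4)[OF q(1)] conic_facts(4)[OF q(2)]
    by (auto simp: meet_def curves_through_def)
  show "meet tacs q q' \<subseteq> meet P q q'" using tacs_P by (auto simp: meet_def)
  show "\<exists>c. \<forall>w. bil (hess q') z w = c * bil (hess q) z w" if "z \<in> meet tacs q q'" for z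
  proof -
    have "tangent_at z q q'" using that tacs_pair(2) q(3) by (auto simp: meet_def)
    then show ?thesis by (auto simp: tangent_at_def conic_facts(3)[OF q(1)] conic_facts(3)[OF q(2)])
  qed
qed

lemma meet_bound:
  assumes "F \<in> C" "F' \<in> C" "F \<noteq> F'"
  shows "finite (meet P F F') \<and> card (meet P F F') + card (meet tacs F F') \<le> deg F * deg F'"
proof -
  consider "F \<in> L" "F' \<in> L" | "F \<in> L" "F' \<in> Q" | "F \<in> Q" "F' \<in> L" | "F \<in> Q" "F' \<in> Q"
    using assms by (auto simp: C_def)
  then show ?thesis
  proof cases
    case 1
    then show ?thesis using meet_line_line assms(3) by (simp add: deg_simps)
  next
    case 2
    then show ?thesis using meet_line_conic by (simp add: deg_simps)
  next
    case 3
    then show ?thesis using meet_line_conic[of F' F] by (simp add: deg_simps meet_commute[of _ F F'])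
  next
    case 4
    then show ?thesis using meet_conic_conic assms(3) by (simp add: deg_simps)
  qed
qed

lemma finite_P: "finite P"
proof -
  have "P \<subseteq> (\<Union>(F, F')\<in>{(F, F')\<in>C \<times> C. F \<noteq> F'}. meet P F F')"
  proof
    fix p assume p: "p \<in> P"
    have "\<not> card (br p) \<le> Suc 0"
      using P_cases[OF p] tacs_card[of p] by (auto simp: nodes_def trips_def)
    then obtain F F' where "F \<in> br p" "F' \<in> br p" "F \<noteq> F'"
      by (auto simp: card_le_Suc0_iff_eq[OF br_finite])
    then show "p \<in> (\<Union>(F, F')\<in>{(F, F')\<in>C \<times> C. F \<noteq> F'}. meet P F F')"
      using p by (auto simp: meet_def curves_through_def)
  qed
  moreover have "finite (\<Union>(F, F')\<in>{(F, F')\<in>C \<times> C. F \<noteq> F'}. meet P F F')"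
    using meet_bound fin(3) by (intro finite_UN_I) (auto intro: finite_subset[of _ "C \<times> C"])
  ultimately show ?thesis by (rule finite_subset)
qed

lemma finite_types: "finite nodes" "finite tacs" "finite trips"
  using finite_P P_split(1) by (auto intro: finite_subset)

definition number_on where "number_on X F = card {p\<in>X. F \<in> br p}"

text \<open>Bezout's inequality, summed over the other components. A tacnode on \<open>F\<close> counts twice because of the
  tangency, a triple point because two other components pass through it.\<close>

lemma degree_bound:
  assumes F: "F \<in> C"
  shows "number_on nodes F + 2 * number_on tacs F + 2 * number_on trips F \<le> deg F * (12 - deg F)"
proof -
  have count: "(\<Sum>F'\<in>C - {F}. card (meet X F F')) = (m - 1) * number_on X F"
    if X: "finite X" "\<And>p. p \<in> X \<Longrightarrow> card (br p) = m" for X m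
  proof -
    have "(\<Sum>F'\<in>C - {F}. card (meet X F F')) =
        (\<Sum>F'\<in>C - {F}. card {p\<in>{p\<in>X. F \<in> br p}. F' \<in> br p})"
      by (simp add: meet_def conj_assoc)
    also have "\<dots> = (\<Sum>p\<in>{p\<in>X. F \<in> br p}. card {F'\<in>C - {F}. F' \<in> br p})"
      by (rule sum_card_swap) (use X fin in auto)
    also have "\<dots> = (\<Sum>p\<in>{p\<in>X. F \<in> br p}. m - 1)"
    proof (rule sum.cong)
      fix p assume p: "p \<in> {p\<in>X. F \<in> br p}"
      have "{F'\<in>C - {F}. F' \<in> br p} = br p - {F}" by (auto simp: curves_through_def)
      then show "card {F'\<in>C - {F}. F' \<in> br p} = m - 1"
        using p X(2) by (simp add: card_Diff_singleton)
    qed simp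
    finally show ?thesis by (simp add: number_on_def)
  qed
  have split: "card (meet P F F') = card (meet nodes F F') + card (meet tacs F F') + card (meet trips F F')"
    for F'
  proof -
    have "meet P F F' = (meet nodes F F' \<union> meet tacs F F') \<union> meet trips F F'"
      using P_split(1) by (auto simp: meet_def)
    moreover have "(meet nodes F F' \<union> meet tacs F F') \<inter> meet trips F F' = {}"
      "meet nodes F F' \<inter> meet tacs F F' = {}"
      using P_split(2,3) by (auto simp: meet_def)
    moreover have "finite (meet nodes F F')" "finite (meet tacs F F')" "finite (meet trips F F')"
      using finite_types by (auto simp: meet_def)
    ultimately show ?thesis by (simp add: card_Un_disjoint)
  qed
  have "number_on nodes F + 2 * number_on tacs F + 2 * number_on trips F =
      (\<Sum>F'\<in>C - {F}. card (meet nodes F F')) + (\<Sum>F'\<in>C - {F}. card (meet tacs F F'))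
      + (\<Sum>F'\<in>C - {F}. card (meet trips F F')) + (\<Sum>F'\<in>C - {F}. card (meet tacs F F'))"
  proof -
    have "(\<Sum>F'\<in>C - {F}. card (meet nodes F F')) = (2 - 1) * number_on nodes F"
      "(\<Sum>F'\<in>C - {F}. card (meet tacs F F')) = (2 - 1) * number_on tacs F"
      "(\<Sum>F'\<in>C - {F}. card (meet trips F F')) = (3 - 1) * number_on trips F"
      by (rule count; simp add: finite_types nodes_card tacs_card trips_card)+
    then show ?thesis by simp
  qed
  also have "\<dots> = (\<Sum>F'\<in>C - {F}. card (meet P F F') + card (meet tacs F F'))"
    by (simp add: split sum.distrib)
  also have "\<dots> \<le> (\<Sum>F'\<in>C - {F}. deg F * deg F')"
    by (rule sum_mono) (use meet_bound F in auto)
  also have "\<dots> = deg F * (\<Sum>F'\<in>C - {F}. deg F')" by (simp add: sum_distrib_left)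
  also have "(\<Sum>F'\<in>C - {F}. deg F') = 12 - deg F"
    using sum.remove[OF fin(3) F, of deg] deg_sum by simp
  finally show ?thesis .
qed

lemma sum_number_on:
  assumes "finite X" "\<And>p. p \<in> X \<Longrightarrow> card (br p) = m"
  shows "(\<Sum>F\<in>C. number_on X F) = m * card X"
proof -
  have "(\<Sum>F\<in>C. number_on X F) = (\<Sum>p\<in>X. card {F\<in>C. F \<in> br p})"
    unfolding number_on_def by (rule sum_card_swap[OF assms(1) fin(3)])
  also have "\<dots> = (\<Sum>p\<in>X. m)"
  proof (rule sum.cong)
    fix p assume "p \<in> X"
    moreover have "{F\<in>C. F \<in> br p} = br p" by (auto simp: curves_through_def)
    ultimately show "card {F\<in>C. F \<in> br p} = m" using assms(2) by simp
  qed simp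
  finally show ?thesis by simp
qed

text \<open>The weights \<open>1\<close>, \<open>3\<close>, \<open>4\<close> are shared out among the two, two and three components through the point;
  the factor \<open>6\<close> clears the denominators of the shares \<open>1/2\<close>, \<open>3/2\<close>, \<open>4/3\<close>.\<close>

lemma tjurina_bound:
  "6 * (card nodes + 3 * card tacs + 4 * card trips) \<le> 43 * d + 80 * k + 2 * card tacs"
proof -
  have line_le: "3 * number_on nodes l + 9 * number_on tacs l + 8 * number_on trips l \<le> 43 + number_on tacs l" if "l \<in> L" for l
  proof -
    have b: "number_on nodes l + 2 * number_on tacs l + 2 * number_on trips l \<le> 11"
      using degree_bound[of l] that by (simp add: C_def deg_simps)
    then have "number_on tacs l + number_on trips l \<le> 5" by linarith
    with b show ?thesis by linarith
  qed
  have conic_le: "3 * number_on nodes q + 9 * number_on tacs q + 8 * number_on trips q \<le> 80 + number_on tacs q" if "q \<in> Q" for q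
  proof -
    have "number_on nodes q + 2 * number_on tacs q + 2 * number_on trips q \<le> 20"
      using degree_bound[of q] that by (simp add: C_def deg_simps)
    then show ?thesis by linarith
  qed
  have sums: "(\<Sum>F\<in>C. number_on nodes F) = 2 * card nodes" "(\<Sum>F\<in>C. number_on tacs F) = 2 * card tacs"
    "(\<Sum>F\<in>C. number_on trips F) = 3 * card trips"
    by (rule sum_number_on; simp add: finite_types nodes_card tacs_card trips_card)+
  have "6 * (card nodes + 3 * card tacs + 4 * card trips) =
      3 * (2 * card nodes) + 9 * (2 * card tacs) + 8 * (3 * card trips)" by simp
  also have "\<dots> = 3 * (\<Sum>F\<in>C. number_on nodes F) + 9 * (\<Sum>F\<in>C. number_on tacs F) + 8 * (\<Sum>F\<in>C. number_on trips F)"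
    unfolding sums ..
  also have "\<dots> = (\<Sum>F\<in>C. 3 * number_on nodes F + 9 * number_on tacs F + 8 * number_on trips F)"
    by (simp add: sum.distrib sum_distrib_left)
  also have "\<dots> = (\<Sum>F\<in>L. 3 * number_on nodes F + 9 * number_on tacs F + 8 * number_on trips F)
      + (\<Sum>F\<in>Q. 3 * number_on nodes F + 9 * number_on tacs F + 8 * number_on trips F)"
    unfolding C_def by (rule sum.union_disjoint[OF fin(1,2) disjoint])
  also have "\<dots> \<le> (\<Sum>F\<in>L. 43 + number_on tacs F) + (\<Sum>F\<in>Q. 80 + number_on tacs F)"
    by (intro add_mono sum_mono line_le conic_le)
  also have "\<dots> = 43 * d + 80 * k + ((\<Sum>F\<in>L. number_on tacs F) + (\<Sum>F\<in>Q. number_on tacs F))"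
    using fin by (simp add: sum.distrib)
  also have "(\<Sum>F\<in>L. number_on tacs F) + (\<Sum>F\<in>Q. number_on tacs F) = (\<Sum>F\<in>C. number_on tacs F)"
    unfolding C_def by (rule sum.union_disjoint[OF fin(1,2) disjoint, symmetric])
  also have "\<dots> = 2 * card tacs" by (rule sums)
  finally show ?thesis .
qed

subsection \<open>Bounding the number of tacnodes\<close>

lemma tac_has_conic:
  assumes p: "p \<in> tacs"
  obtains F q where "br p = {F, q}" "F \<noteq> q" "q \<in> Q" "F \<in> C"
proof -
  obtain F1 F2 where F: "br p = {F1, F2}" "F1 \<noteq> F2" using p by (auto simp: tacs_def)
  have C: "F1 \<in> C" "F2 \<in> C" using F by (auto simp: curves_through_def)
  have "\<not> (F1 \<in> L \<and> F2 \<in> L)"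
  proof
    assume l: "F1 \<in> L \<and> F2 \<in> L"
    have "p \<in> meet tacs F1 F2" "p \<in> meet P F1 F2" using p F tacs_P by (auto simp: meet_def)
    moreover have "finite (meet P F1 F2)" "card (meet P F1 F2) + card (meet tacs F1 F2) \<le> 1"
      using meet_line_line l F(2) by auto
    moreover have "finite (meet tacs F1 F2)" using finite_types by (simp add: meet_def)
    ultimately have "0 < card (meet P F1 F2)" "0 < card (meet tacs F1 F2)"
      by (auto simp: card_gt_0_iff)
    then show False using \<open>card (meet P F1 F2) + card (meet tacs F1 F2) \<le> 1\<close> by linarith
  qed
  then have "F1 \<in> Q \<or> F2 \<in> Q" using C by (auto simp: C_def)
  then show thesis
  proof
    assume "F1 \<in> Q"
    then show thesis using that[of F2 F1] F C by (simp add: insert_commute)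
  next
    assume "F2 \<in> Q"
    then show thesis using that[of F1 F2] F C by simp
  qed
qed

definition tangent_conics where "tangent_conics l = {q\<in>Q. meet tacs l q \<noteq> {}}"

definition conic_tacs where "conic_tacs = {p\<in>tacs. br p \<subseteq> Q}"

lemma card_tacs_le: "card tacs \<le> (\<Sum>l\<in>L. card (tangent_conics l)) + card conic_tacs"
proof -
  have "tacs \<subseteq> (\<Union>l\<in>L. \<Union>q\<in>tangent_conics l. meet tacs l q) \<union> conic_tacs"
  proof
    fix p assume p: "p \<in> tacs"
    obtain F q where F: "br p = {F, q}" "F \<noteq> q" "q \<in> Q" "F \<in> C" by (rule tac_has_conic[OF p])
    show "p \<in> (\<Union>l\<in>L. \<Union>q\<in>tangent_conics l. meet tacs l q) \<union> conic_tacs"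
    proof (cases "F \<in> L")
      case True
      have "p \<in> meet tacs F q" using p F by (simp add: meet_def)
      then show ?thesis using True F(3) by (auto simp: tangent_conics_def)
    next
      case False
      then show ?thesis using p F by (auto simp: conic_tacs_def C_def)
    qed
  qed
  then have "card tacs \<le> card ((\<Union>l\<in>L. \<Union>q\<in>tangent_conics l. meet tacs l q) \<union> conic_tacs)"
    using finite_types fin by (intro card_mono) (auto simp: meet_def conic_tacs_def tangent_conics_def)
  also have "\<dots> \<le> card (\<Union>l\<in>L. \<Union>q\<in>tangent_conics l. meet tacs l q) + card conic_tacs"
    by (rule card_Un_le)
  also have "card (\<Union>l\<in>L. \<Union>q\<in>tangent_conics l. meet tacs l q) \<le>
      (\<Sum>l\<in>L. card (\<Union>q\<in>tangent_conics l. meet tacs l q))"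
    by (rule card_UN_le[OF fin(1)])
  also have "\<dots> \<le> (\<Sum>l\<in>L. \<Sum>q\<in>tangent_conics l. card (meet tacs l q))"
    using fin by (intro sum_mono card_UN_le) (simp add: tangent_conics_def)
  also have "\<dots> \<le> (\<Sum>l\<in>L. \<Sum>q\<in>tangent_conics l. 1)"
  proof (intro sum_mono)
    fix l q assume l: "l \<in> L" and q: "q \<in> tangent_conics l"
    have "finite (meet P l q)" "card (meet P l q) + card (meet tacs l q) \<le> 2"
      using meet_line_conic[OF l, of q] q by (auto simp: tangent_conics_def)
    moreover have "meet tacs l q \<subseteq> meet P l q" using tacs_P by (auto simp: meet_def)
    ultimately show "card (meet tacs l q) \<le> 1" using card_mono[of "meet P l q" "meet tacs l q"] by simp
  qed
  finally show ?thesis by simp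
qed

text \<open>A line of the arrangement that touches both conics does so at tacnodes, so it passes through no
  point where the conics touch each other: three components would meet there.\<close>

lemma common_tangent_bound:
  assumes q: "q \<in> Q" "q' \<in> Q" "q \<noteq> q'"
  shows "card {l\<in>L. q \<in> tangent_conics l \<and> q' \<in> tangent_conics l} + 2 * card (meet tacs q q') \<le> 4"
proof -
  define M0 where "M0 = {l\<in>L. q \<in> tangent_conics l \<and> q' \<in> tangent_conics l}"
  obtain vec where vec: "vec l \<noteq> 0" "l = lin (vec l)" if "l \<in> L" for l using line_vector by metis
  have inj: "inj_on vec M0" 
  proof (rule inj_onI)
    fix x y assume xy: "x \<in> M0" "y \<in> M0" "vec x = vec y"
    have "x = lin (vec x)" using xy(1) vec(2)[of x] unfolding M0_def by blast
    also have "\<dots> = lin (vec y)" using xy(3) by simp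
    also have "\<dots> = y" using xy(2) vec(2)[of y, symmetric] unfolding M0_def by blast
    finally show "x = y" .
  qed
  have touch: "\<exists>p c. hess r *v p = c *s vec l \<and> dot3 (vec l) p = 0 \<and> p \<noteq> 0"
    if l: "l \<in> L" and r: "r \<in> Q" "r \<in> tangent_conics l" for l r
  proof -
    obtain p where p: "p \<in> tacs" "l \<in> br p" "r \<in> br p" using r by (auto simp: tangent_conics_def meet_def)
    have "l \<noteq> r" using l r disjoint by blast
    then have "tangent_at p l r" using tacs_pair(2)[OF p] by simp
    then obtain c where c: "\<And>w. eval3 (dir_deriv w r) p = c * eval3 (dir_deriv w l) p"
      by (auto simp: tangent_at_def)
    have "dot3 (hess r *v p) w = dot3 (c *s vec l) w" for w
      using c[of w] conic_facts(3)[OF r(1)] by (subst (asm) vec(2)[OF l]) (simp add: bil_def)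
    then have "hess r *v p = c *s vec l" by (rule dot3_eqI)
    moreover have "dot3 (vec l) p = 0"
      using p(2) by (subst (asm) vec(2)[OF l]) (simp add: curves_through_def)
    moreover have "p \<noteq> 0" using p(1) tacs_P P_nonzero by blast
    ultimately show ?thesis by blast
  qed
  have "finite (vec ` M0) \<and> card (vec ` M0) + 2 * card (meet tacs q q') \<le> 4"
  proof (rule common_tangents[OF conic_facts(2)[OF q(1)] conic_facts(2)[OF q(2)]
        conics_not_proportional[OF q]])
    show "projective_points (vec ` M0)" unfolding projective_points_def
    proof (intro conjI ballI allI impI)
      show "z \<noteq> 0" if "z \<in> vec ` M0" for z using that vec(1) by (auto simp: M0_def)
    next
      fix z z' c assume z: "z \<in> vec ` M0" "z' \<in> vec ` M0" "z' = c *s z"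
      obtain l l' where l: "l \<in> L" "z = vec l" "l' \<in> L" "z' = vec l'" using z by (auto simp: M0_def)
      have lz: "lin z = l" "lin z' = l'"
        using vec(2)[OF l(1), symmetric] vec(2)[OF l(3), symmetric] l(2,4) by simp_all
      have "zero_locus (lin z) = zero_locus (lin z')"
        using proportional_lines_same_locus[OF z(3)] vec(1)[OF l(3)] l(4) by simp
      then have "zero_locus l = zero_locus l'" unfolding lz .
      then have "l = l'" using cla l by (auto simp: conic_line_arrangement_def inj_on_def)
      then show "z' = z" using l by simp
    qed
    show "\<exists>p c. hess q *v p = c *s a \<and> dot3 a p = 0 \<and> p \<noteq> 0" if "a \<in> vec ` M0" for a
      using that touch q by (auto simp: M0_def)
    show "\<exists>p c. hess q' *v p = c *s a \<and> dot3 a p = 0 \<and> p \<noteq> 0" if "a \<in> vec ` M0" for a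
      using that touch q by (auto simp: M0_def)
    show "projective_points (meet tacs q q')" by (rule meet_projective[OF tacs_P])
    show "bil (hess q) p p = 0" if "p \<in> meet tacs q q'" for p
      using that conic_facts(4)[OF q(1)] by (auto simp: meet_def curves_through_def)
    show "\<exists>c. hess q' *v p = c *s (hess q *v p)" if "p \<in> meet tacs q q'" for p
    proof -
      have "tangent_at p q q'" using that tacs_pair(2) q(3) by (auto simp: meet_def)
      then obtain c where "\<And>w. bil (hess q') p w = c * bil (hess q) p w"
        by (auto simp: tangent_at_def conic_facts(3)[OF q(1)] conic_facts(3)[OF q(2)])
      then have "hess q' *v p = c *s (hess q *v p)" by (intro dot3_eqI) (simp add: bil_def)
      then show ?thesis by blast
    qed
    show "dot3 a p \<noteq> 0" if "a \<in> vec ` M0" "p \<in> meet tacs q q'" for a p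
    proof
      assume 0: "dot3 a p = 0"
      obtain l where l: "l \<in> L" "a = vec l" using \<open>a \<in> vec ` M0\<close> by (auto simp: M0_def)
      have "eval3 (lin (vec l)) p = 0" using 0 by (simp add: l(2))
      then have "eval3 l p = 0" unfolding vec(2)[OF l(1), symmetric] .
      then have "l \<in> br p" using l(1) by (simp add: curves_through_def C_def)
      moreover have "br p = {q, q'}" using that(2) tacs_pair(1) q(3) by (auto simp: meet_def)
      ultimately have "l \<in> Q" using q by auto
      then show False using l(1) disjoint by blast
    qed
  qed
  then show ?thesis using card_image[OF inj] by (simp add: M0_def)
qed

text \<open>The sum of \<open>common_tangent_bound\<close> over all ordered pairs of distinct conics: a line that touches \<open>j\<close>
  conics is counted \<open>j (j - 1)\<close> times, a tacnode of two conics twice with the factor \<open>2\<close>.\<close>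

lemma sum_tangent_conics:
  "(\<Sum>l\<in>L. card (tangent_conics l) * (card (tangent_conics l) - 1)) + 4 * card conic_tacs
    \<le> 4 * (k * (k - 1))"
proof -
  have tan: "(\<Sum>q\<in>Q. \<Sum>q'\<in>Q - {q}. card {l\<in>L. q \<in> tangent_conics l \<and> q' \<in> tangent_conics l}) =
      (\<Sum>l\<in>L. card (tangent_conics l) * (card (tangent_conics l) - 1))"
  proof -
    have inner: "(\<Sum>q'\<in>Q - {q}. card {l\<in>L. q \<in> tangent_conics l \<and> q' \<in> tangent_conics l}) =
        (\<Sum>l\<in>L. if q \<in> tangent_conics l then card (tangent_conics l) - 1 else 0)" for q
    proof -
      have "(\<Sum>q'\<in>Q - {q}. card {l\<in>L. q \<in> tangent_conics l \<and> q' \<in> tangent_conics l}) =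
          (\<Sum>l\<in>L. card {q'\<in>Q - {q}. q \<in> tangent_conics l \<and> q' \<in> tangent_conics l})"
        by (rule sum_card_swap) (use fin in auto)
      also have "\<dots> = (\<Sum>l\<in>L. if q \<in> tangent_conics l then card (tangent_conics l) - 1 else 0)"
      proof (rule sum.cong)
        fix l
        have "{q'\<in>Q - {q}. q \<in> tangent_conics l \<and> q' \<in> tangent_conics l} =
            (if q \<in> tangent_conics l then tangent_conics l - {q} else {})"
          by (auto simp: tangent_conics_def)
        then show "card {q'\<in>Q - {q}. q \<in> tangent_conics l \<and> q' \<in> tangent_conics l} =
            (if q \<in> tangent_conics l then card (tangent_conics l) - 1 else 0)"
          by (simp add: card_Diff_singleton)
      qed simp
      finally show ?thesis .
    qed
    have "(\<Sum>q\<in>Q. if q \<in> tangent_conics l then card (tangent_conics l) - 1 else 0) =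
        card (tangent_conics l) * (card (tangent_conics l) - 1)" for l
    proof -
      have "Q \<inter> {q. q \<in> tangent_conics l} = tangent_conics l" by (auto simp: tangent_conics_def)
      then show ?thesis using fin(2) by (simp add: sum.If_cases)
    qed
    then show ?thesis unfolding inner by (subst sum.swap) simp
  qed
  have con: "(\<Sum>q\<in>Q. \<Sum>q'\<in>Q - {q}. card (meet tacs q q')) \<ge> 2 * card conic_tacs"
  proof -
    have "2 * card conic_tacs = (\<Sum>p\<in>conic_tacs. 2)" by simp
    also have "\<dots> \<le> (\<Sum>p\<in>conic_tacs. card {x\<in>Sigma Q (\<lambda>q. Q - {q}). fst x \<in> br p \<and> snd x \<in> br p})"
    proof (rule sum_mono)
      fix p assume p: "p \<in> conic_tacs"
      then obtain F1 F2 where F: "br p = {F1, F2}" "F1 \<noteq> F2" "F1 \<in> Q" "F2 \<in> Q"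
        by (auto simp: conic_tacs_def tacs_def)
      have "{(F1, F2), (F2, F1)} \<subseteq> {x\<in>Sigma Q (\<lambda>q. Q - {q}). fst x \<in> br p \<and> snd x \<in> br p}"
        using F by auto
      moreover have "finite {x\<in>Sigma Q (\<lambda>q. Q - {q}). fst x \<in> br p \<and> snd x \<in> br p}"
        using fin by auto
      moreover have "card {(F1, F2), (F2, F1)} = 2" using F(2) by simp
      ultimately show "2 \<le> card {x\<in>Sigma Q (\<lambda>q. Q - {q}). fst x \<in> br p \<and> snd x \<in> br p}"
        using card_mono[of "{x\<in>Sigma Q (\<lambda>q. Q - {q}). fst x \<in> br p \<and> snd x \<in> br p}"
          "{(F1, F2), (F2, F1)}"] by simp
    qed
    also have "\<dots> = (\<Sum>x\<in>Sigma Q (\<lambda>q. Q - {q}). card {p\<in>conic_tacs. fst x \<in> br p \<and> snd x \<in> br p})"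
      by (rule sum_card_swap[symmetric]) (use fin finite_types in \<open>auto simp: conic_tacs_def\<close>)
    also have "\<dots> \<le> (\<Sum>x\<in>Sigma Q (\<lambda>q. Q - {q}). card (meet tacs (fst x) (snd x)))"
      using finite_types by (intro sum_mono card_mono) (auto simp: meet_def conic_tacs_def)
    also have "\<dots> = (\<Sum>q\<in>Q. \<Sum>q'\<in>Q - {q}. card (meet tacs q q'))"
      using fin by (subst sum.Sigma) (auto simp: split_beta)
    finally show ?thesis .
  qed
  have "(\<Sum>l\<in>L. card (tangent_conics l) * (card (tangent_conics l) - 1)) + 4 * card conic_tacs \<le>
      (\<Sum>q\<in>Q. \<Sum>q'\<in>Q - {q}. card {l\<in>L. q \<in> tangent_conics l \<and> q' \<in> tangent_conics l})
      + 2 * (\<Sum>q\<in>Q. \<Sum>q'\<in>Q - {q}. card (meet tacs q q'))"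
    using con unfolding tan by simp
  also have "\<dots> = (\<Sum>q\<in>Q. \<Sum>q'\<in>Q - {q}.
      card {l\<in>L. q \<in> tangent_conics l \<and> q' \<in> tangent_conics l} + 2 * card (meet tacs q q'))"
    by (simp add: sum.distrib sum_distrib_left)
  also have "\<dots> \<le> (\<Sum>q\<in>Q. \<Sum>q'\<in>Q - {q}. 4)"
    by (intro sum_mono) (use common_tangent_bound in auto)
  also have "\<dots> = 4 * (k * (k - 1))"
    using fin by (simp add: card_Diff_singleton)
  finally show ?thesis .
qed

lemma two_tacs_le: "2 * card tacs \<le> 2 * (k * (k - 1)) + 3 * d"
proof -
  \<comment> \<open>Equivalent to \<open>(n - 2) (n - 3) \<ge> 0\<close>.\<close>
  have "4 * n \<le> n * (n - 1) + 6" for n :: nat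
  proof (cases "n \<le> 3")
    case True
    then have "n \<in> {0, 1, 2, 3}" by auto
    then show ?thesis by auto
  next
    case False
    define m where "m = n - 4"
    have "n = m + 4" using False by (simp add: m_def)
    then show ?thesis by (simp add: algebra_simps)
  qed
  then have "(\<Sum>l\<in>L. 4 * card (tangent_conics l)) \<le>
      (\<Sum>l\<in>L. card (tangent_conics l) * (card (tangent_conics l) - 1) + 6)"
    by (intro sum_mono) auto
  then have "4 * (\<Sum>l\<in>L. card (tangent_conics l)) + 4 * card conic_tacs \<le> 4 * (k * (k - 1)) + 6 * d"
    using sum_tangent_conics fin by (simp add: sum.distrib sum_distrib_left)
  then show ?thesis using card_tacs_le by linarith
qed

lemma card_tacs_le_conics: "card tacs \<le> 10 * k"
proof -
  have "tacs \<subseteq> (\<Union>q\<in>Q. {p\<in>tacs. q \<in> br p})"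
  proof
    fix p assume p: "p \<in> tacs"
    obtain F q where "br p = {F, q}" "q \<in> Q" using tac_has_conic[OF p] by metis
    then show "p \<in> (\<Union>q\<in>Q. {p\<in>tacs. q \<in> br p})" using p by auto
  qed
  then have "card tacs \<le> card (\<Union>q\<in>Q. {p\<in>tacs. q \<in> br p})"
    using fin finite_types by (intro card_mono) auto
  also have "\<dots> \<le> (\<Sum>q\<in>Q. number_on tacs q)" unfolding number_on_def by (rule card_UN_le[OF fin(2)])
  also have "\<dots> \<le> (\<Sum>q\<in>Q. 10)"
  proof (rule sum_mono)
    fix q assume "q \<in> Q"
    then show "number_on tacs q \<le> 10" using degree_bound[of q] by (simp add: C_def deg_simps)
  qed
  finally show ?thesis using fin by simp
qed

subsection \<open>Comparing the bounds\<close>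

text \<open>Away from the singular points some partial derivative does not vanish. The multiplier at a normalized singular point
  need not be a form, so it is replaced by one of its homogeneous components to reach the other
  representatives of the point.\<close>

lemma in_saturation:
  assumes g: "homogeneous 15 g" and loc: "\<And>p. p \<in> P \<Longrightarrow> g \<in> local_ideal (jacobian_ideal f) p"
  shows "g \<in> saturation (jacobian_ideal f)"
proof (rule in_saturation_if_locally[OF is_ideal_jacobian _ g])
  have f11: "homogeneous (Suc 11) f" using f_hom by simp
  show hc: "hom_part n h \<in> jacobian_ideal f" if "h \<in> jacobian_ideal f" for h n
    by (rule hom_part_in_jacobian[OF f11 that])
  fix p :: "complex^3" assume p: "p \<noteq> 0"
  show "\<exists>h. eval3 h p \<noteq> 0 \<and> h * g \<in> jacobian_ideal f"
  proof (cases "\<forall>i. eval3 (partial i f) p = 0")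
    case False
    then obtain i where i: "eval3 (partial i f) p \<noteq> 0" by blast
    have "partial i f = (\<Sum>j\<in>UNIV. (if j = i then 1 else 0) * partial j f)"
    proof -
      have "(if j = i then 1 else 0) * partial j f = (if j = i then partial i f else 0)" for j by simp
      then show ?thesis by simp
    qed
    then have "partial i f \<in> jacobian_ideal f"
      unfolding jacobian_ideal_def by (intro CollectI exI[of _ "\<lambda>j. if j = i then 1 else 0"])
    then show ?thesis using i is_idealD(4)[OF is_ideal_jacobian] by blast
  next
    case True
    then have "eval3 (dir_deriv p f) p = 0" by (simp add: dir_deriv_def)
    then have "eval3 f p = 0" using eval_euler[OF f_hom, of p] by simp
    obtain c where c: "c \<noteq> 0" "normalized (c *s p)" using normalized_exists[OF p] .
    have "eval3 f (c *s p) = 0" using eval3_scale[OF f_hom] \<open>eval3 f p = 0\<close> by simp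
    moreover have "eval3 (partial i f) (c *s p) = 0" for i
      using eval3_scale[OF homogeneous_partial[OF f_hom]] True by simp
    ultimately have "c *s p \<in> P"
      using c(2) normalized_nonzero[OF c(2)]
      by (simp add: P_def singular_point_def zero_locus_def)
    then obtain h where h: "eval3 h (c *s p) \<noteq> 0" "h * g \<in> jacobian_ideal f"
      using loc by (auto simp: local_ideal_def)
    obtain n where n: "eval3 (hom_part n h) (c *s p) \<noteq> 0" using eval3_hom_part_nonzero[OF h(1)] by blast
    have "hom_part (n + 15) (h * g) = hom_part n h * g"
      using hom_part_mult[OF g, of "n + 15" h] by (simp add: mult.commute)
    then have "hom_part n h * g \<in> jacobian_ideal f" using hc[OF h(2), of "n + 15"] by simp
    moreover have "eval3 (hom_part n h) p \<noteq> 0" using n eval3_scale[OF homogeneous_hom_part, of n h c p] by auto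
    ultimately show ?thesis by blast
  qed
qed

lemma nearly_free_tjurina:
  assumes nf: "nearly_free f"
  shows "90 \<le> card nodes + 3 * card tacs + 4 * card trips"
proof -
  define n where "n p = (if p \<in> nodes then 1 else if p \<in> tacs then 3 else 4 :: nat)" for p
  have "local_conditions f p 15 (n p)" if "p \<in> P" for p
    using P_cases[OF that] by (auto simp: n_def nodes_def tacs_def trips_def)
  then have "\<forall>p\<in>P. \<exists>\<Phi>. finite \<Phi> \<and> card \<Phi> \<le> n p \<and> (\<forall>\<phi>\<in>\<Phi>. functional \<phi>) \<and>
     (\<forall>g. homogeneous 15 g \<longrightarrow> (\<forall>\<phi>\<in>\<Phi>. \<phi> g = 0) \<longrightarrow> g \<in> local_ideal (jacobian_ideal f) p)"
    unfolding local_conditions_def by blast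
  from bchoice[OF this] obtain \<Phi> where
    "\<forall>p\<in>P. finite (\<Phi> p) \<and> card (\<Phi> p) \<le> n p \<and> (\<forall>\<phi>\<in>\<Phi> p. functional \<phi>) \<and>
     (\<forall>g. homogeneous 15 g \<longrightarrow> (\<forall>\<phi>\<in>\<Phi> p. \<phi> g = 0) \<longrightarrow> g \<in> local_ideal (jacobian_ideal f) p)" ..
  then have \<Phi>: "\<And>p. p \<in> P \<Longrightarrow> finite (\<Phi> p)" "\<And>p. p \<in> P \<Longrightarrow> card (\<Phi> p) \<le> n p"
    "\<And>p. p \<in> P \<Longrightarrow> \<forall>\<phi>\<in>\<Phi> p. functional \<phi>"
    "\<And>p g. p \<in> P \<Longrightarrow> homogeneous 15 g \<Longrightarrow> \<forall>\<phi>\<in>\<Phi> p. \<phi> g = 0 \<Longrightarrow>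
      g \<in> local_ideal (jacobian_ideal f) p"
    by blast+
  define \<Psi> where "\<Psi> = (\<Union>p\<in>P. \<Phi> p)"
  have "(15 + 2) choose 2 \<le> 3 * ((15 - 11 + 2) choose 2) + 1 + card \<Psi>"
  proof (rule nearly_free_functional_bound[OF _ nf])
    show "homogeneous (Suc 11) f" using f_hom by simp
    show "finite \<Psi>" using finite_P \<Phi>(1) by (simp add: \<Psi>_def)
    show "\<forall>\<phi>\<in>\<Psi>. functional \<phi>" using \<Phi>(3) by (auto simp: \<Psi>_def)
    show "g \<in> saturation (jacobian_ideal f)" if "homogeneous 15 g" "\<forall>\<phi>\<in>\<Psi>. \<phi> g = 0" for g
      by (rule in_saturation[OF that(1)], rule \<Phi>(4)) (use that in \<open>auto simp: \<Psi>_def\<close>)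
  qed simp
  then have "90 \<le> card \<Psi>" by (simp add: choose_two)
  also have "\<dots> \<le> (\<Sum>p\<in>P. card (\<Phi> p))" unfolding \<Psi>_def by (rule card_UN_le[OF finite_P])
  also have "\<dots> \<le> (\<Sum>p\<in>P. n p)" by (rule sum_mono) (rule \<Phi>(2))
  also have "\<dots> = (\<Sum>p\<in>nodes \<union> tacs. n p) + (\<Sum>p\<in>trips. n p)"
    unfolding P_split(1) using finite_types P_split(3) by (intro sum.union_disjoint) auto
  also have "(\<Sum>p\<in>nodes \<union> tacs. n p) = (\<Sum>p\<in>nodes. n p) + (\<Sum>p\<in>tacs. n p)"
    using finite_types P_split(2) by (intro sum.union_disjoint) auto
  also have "(\<Sum>p\<in>nodes. n p) = card nodes" by (simp add: n_def)
  also have "(\<Sum>p\<in>tacs. n p) = (\<Sum>p\<in>tacs. 3)"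
    by (rule sum.cong) (use P_split(2) in \<open>auto simp: n_def\<close>)
  also have "(\<Sum>p\<in>trips. n p) = (\<Sum>p\<in>trips. 4)"
    by (rule sum.cong) (use P_split(3) in \<open>auto simp: n_def\<close>)
  finally show ?thesis by simp
qed

lemma not_nearly_free:
  assumes "d \<ge> 1" "k \<ge> 1" shows "\<not> nearly_free f"
proof
  assume nf: "nearly_free f"
  have "540 \<le> 6 * (card nodes + 3 * card tacs + 4 * card trips)"
    using mult_le_mono2[OF nearly_free_tjurina[OF nf], of 6] by simp
  also note tjurina_bound
  finally have "540 \<le> 43 * d + 80 * k + 2 * card tacs" .
  then have lower: "12 + 3 * k \<le> card tacs" using degree_12 by linarith
  have "k \<in> {1, 2, 3, 4, 5}" using assms degree_12 by auto
  then show False using lower two_tacs_le card_tacs_le_conics degree_12 by auto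
qed

end

theorem theorem5p3:
  "\<not> (\<exists>(d::nat) (k::nat) (L::cpoly3 set) (Q::cpoly3 set).
      d \<ge> 1 \<and> k \<ge> 1 \<and> 2 * k + d = 12 \<and>
      conic_line_arrangement d k L Q \<and>
      nearly_free (arrangement_form L Q) \<and>
      (\<forall>p. singular_point (arrangement_form L Q) p \<longrightarrow>
         node (arrangement_form L Q) p \<or>
         tacnode (arrangement_form L Q) p \<or>
         ordinary_triple_point (arrangement_form L Q) p))"
proof clarify
  fix d k :: nat and L Q :: "cpoly3 set"
  assume A: "d \<ge> 1" "k \<ge> 1" "2 * k + d = 12" "conic_line_arrangement d k L Q"
    "nearly_free (arrangement_form L Q)"
    "\<forall>p. singular_point (arrangement_form L Q) p \<longrightarrow> node (arrangement_form L Q) p \<or>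
       tacnode (arrangement_form L Q) p \<or> ordinary_triple_point (arrangement_form L Q) p"
  interpret arrangement d k L Q by unfold_locales (use A in auto)
  show False using not_nearly_free A by blast
qed

end
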